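(* Let $(\mathbb A,\mathsf E,\mathsf M)$ be a context. (a) If $(Y,\phi)$ is compact and $f:(X,\mu)\to(Y,\phi)$ is a proper morphism then $(X,\mu)$ is compact. (b) If $(X,\mu)$ is compact and $f:(X,\mu)\to(Y,\phi)$ is a preneighbourhood morphism with $f$ stably continuous and stably in $\mathsf E$ then $(Y,\phi)$ is compact. (c) The full subcategory of compact preneighbourhood spaces is finitely productive (closed under finite products); if every preneighbourhood morphism is continuous then it is closed hereditary, i.e. if $(X,\mu)$ is compact and $m:M\to X$ is in $\mathfrak C_\mu$ then $(M,\mu|_m)$ is compact.
   Context: A context is a triple $(\mathbb A,\mathsf E,\mathsf M)$ where $\mathbb A$ is a finitely complete category with finite coproducts, $(\mathsf E,\mathsf M)$ is a proper factorization system on $\mathbb A$ ($\mathsf E\subseteq$ epimorphisms, $\mathsf M\subseteq$ monomorphisms), and for each object $X$ the poset $\mathrm{Sub}(X)$ of admissible subobjects of $X$ ($\mathsf M$-morphisms with codomain $X$, equivalent ones identified) is a complete lattice, with largest element $\mathrm{id}_X$ and smallest element $\sigma_X$ (the $\mathsf M$-part of the factorization of the unique morphism from the initial object to $X$). For $f:X\to Y$, $\exists_f m$ is the $\mathsf M$-part of the factorization of $f\circ m$ ($m\in\mathrm{Sub}(X)$) and $f^{-1}n$ is the pullback of $n\in\mathrm{Sub}(Y)$ along $f$. A filter on $X$ is an up-closed subset of $\mathrm{Sub}(X)$ closed under finite meets; filters $\mathrm{Fil}(X)$ are ordered by inclusion. A preneighbourhood system on $X$ is an order preserving map $\mu:\mathrm{Sub}(X)^{\mathrm{op}}\to\mathrm{Fil}(X)$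 with $\mu(\sigma_X)=\mathrm{Sub}(X)$ and $p\in\mu(m)\Rightarrow m\leq p$; $(X,\mu)$ is then an internal preneighbourhood space. A preneighbourhood morphism $f:(X,\mu)\to(Y,\phi)$ is a morphism $f:X\to Y$ such that $p\in\phi(u)\Rightarrow f^{-1}p\in\mu(f^{-1}u)$. Limit objects of diagrams of preneighbourhood spaces carry the smallest preneighbourhood system making the limit projections preneighbourhood morphisms; in particular the terminal object $1$ carries $\nabla_1$ ($\nabla_1(\sigma_1)=\mathrm{Sub}(1)$, $\nabla_1(x)=\{\mathrm{id}_1\}$ otherwise), and for $m:M\to X$ in $\mathsf M$, $M$ carries $\mu|_m(a)=\{u\in\mathrm{Sub}(M):(\exists v\in\mu(m\circ a))(m^{-1}v\leq u)\}$. Define $\mathtt{Far}_\mu p=\{x\in\mathrm{Sub}(X):(\exists u\in\mu(x))(u\wedge p=\sigma_X)\}$, $\mathrm{cl}_\mu p=\bigvee\{x\in\mathrm{Sub}(X): p\not< x\text{ and }x\notin\mathtt{Far}_\mu p\}$, and $\mathfrak C_\mu=\{p:\mathrm{cl}_\mu p=p\}$. For preneighbourhood spaces $(X,\mu)$, $(Y,\phi)$, a morphism $f:X\to Y$ is closed if $p\in\mathfrak C_\mu\Rightarrow\exists_f p\in\mathfrak C_\phi$, and continuous if $t\in\mathfrak C_\phi\Rightarrow f^{-1}t\in\mathfrak C_\mu$. A preneighbourhood morphism $f$ is proper if its pullback along every preneighbourhood morphism is closed; it is stably continuous (stably in $\mathsf E$) if its pullback along every preneighbourhood morphism is continuous (in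 $\mathsf E$). $(X,\mu)$ is compact if the unique morphism $(X,\mu)\to(1,\nabla_1)$ is proper.
   Formalization: Compactness asks only that all pullbacks of X→1 along preneighbourhood morphisms be closed, not that X→1 be a preneighbourhood morphism (else (b) fails); finite products in (c) are those with the universal property among preneighbourhood spaces (else (c) fails). *)

theory Defs
  imports "HOL-Algebra.Complete_Lattice"
begin

section \<open>Categories, limits and colimits\<close>

record ('o, 'a) cat =
  Ob :: "'o set"
  Ar :: "'a set"
  Dom :: "'a \<Rightarrow> 'o"
  Cod :: "'a \<Rightarrow> 'o"
  Id :: "'o \<Rightarrow> 'a"
  Comp :: "'a \<Rightarrow> 'a \<Rightarrow> 'a"  (infixl \<open>\<cdot>\<index>\<close> 75)

definition Hom :: "('o, 'a, 'm) cat_scheme \<Rightarrow> 'o \<Rightarrow> 'o \<Rightarrow> 'a set" where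
  "Hom C X Y = {f \<in> Ar C. Dom C f = X \<and> Cod C f = Y}"

locale category =
  fixes C :: "('o, 'a, 'm) cat_scheme" (structure)
  assumes dom_in_Ob: "f \<in> Ar C \<Longrightarrow> Dom C f \<in> Ob C"
    and cod_in_Ob: "f \<in> Ar C \<Longrightarrow> Cod C f \<in> Ob C"
    and id_in_Hom: "X \<in> Ob C \<Longrightarrow> Id C X \<in> Hom C X X"
    and comp_in_Hom: "\<lbrakk>f \<in> Hom C X Y; g \<in> Hom C Y Z\<rbrakk> \<Longrightarrow> g \<cdot> f \<in> Hom C X Z"
    and comp_id_right: "f \<in> Hom C X Y \<Longrightarrow> f \<cdot> Id C X = f"
    and comp_id_left: "f \<in> Hom C X Y \<Longrightarrow> Id C Y \<cdot> f = f"
    and comp_assoc: "\<lbrakk>f \<in> Hom C W X; g \<in> Hom C X Y; h \<in> Hom C Y Z\<rbrakk>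
      \<Longrightarrow> (h \<cdot> g) \<cdot> f = h \<cdot> (g \<cdot> f)"

definition is_mono :: "('o, 'a, 'm) cat_scheme \<Rightarrow> 'a \<Rightarrow> bool" where
  "is_mono C m \<longleftrightarrow> m \<in> Ar C \<and>
     (\<forall>W. \<forall>x\<in>Hom C W (Dom C m). \<forall>y\<in>Hom C W (Dom C m).
        m \<cdot>\<^bsub>C\<^esub> x = m \<cdot>\<^bsub>C\<^esub> y \<longrightarrow> x = y)"

definition is_epi :: "('o, 'a, 'm) cat_scheme \<Rightarrow> 'a \<Rightarrow> bool" where
  "is_epi C e \<longleftrightarrow> e \<in> Ar C \<and>
     (\<forall>W. \<forall>x\<in>Hom C (Cod C e) W. \<forall>y\<in>Hom C (Cod C e) W.
        x \<cdot>\<^bsub>C\<^esub> e = y \<cdot>\<^bsub>C\<^esub> e \<longrightarrow> x = y)"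

definition is_iso :: "('o, 'a, 'm) cat_scheme \<Rightarrow> 'a \<Rightarrow> bool" where
  "is_iso C f \<longleftrightarrow> f \<in> Ar C \<and>
     (\<exists>g\<in>Hom C (Cod C f) (Dom C f).
        g \<cdot>\<^bsub>C\<^esub> f = Id C (Dom C f) \<and> f \<cdot>\<^bsub>C\<^esub> g = Id C (Cod C f))"

definition is_initial :: "('o, 'a, 'm) cat_scheme \<Rightarrow> 'o \<Rightarrow> bool" where
  "is_initial C I \<longleftrightarrow> I \<in> Ob C \<and> (\<forall>X\<in>Ob C. \<exists>!f. f \<in> Hom C I X)"

definition is_terminal :: "('o, 'a, 'm) cat_scheme \<Rightarrow> 'o \<Rightarrow> bool" where
  "is_terminal C T \<longleftrightarrow> T \<in> Ob C \<and> (\<forall>X\<in>Ob C. \<exists>!f. f \<in> Hom C X T)"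

text \<open>
  A diagram has the vertices \<open>i \<in> I\<close>, labelled by the objects \<open>D i\<close>, and the edges
  \<open>(i, a, j) \<in> G\<close>, labelled by arrows \<open>a : D i \<rightarrow> D j\<close>; with \<open>G = {}\<close>, a limit
  is a product.
\<close>

definition is_diagram ::
  "('o, 'a, 'm) cat_scheme \<Rightarrow> 'i set \<Rightarrow> ('i \<Rightarrow> 'o) \<Rightarrow> ('i \<times> 'a \<times> 'i) set \<Rightarrow> bool" where
  "is_diagram C I D G \<longleftrightarrow> (\<forall>i\<in>I. D i \<in> Ob C) \<and>
     (\<forall>(i, a, j)\<in>G. i \<in> I \<and> j \<in> I \<and> a \<in> Hom C (D i) (D j))"

definition is_cone ::
  "('o, 'a, 'm) cat_scheme \<Rightarrow> 'i set \<Rightarrow> ('i \<Rightarrow> 'o) \<Rightarrow> ('i \<times> 'a \<times> 'i) set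
    \<Rightarrow> 'o \<Rightarrow> ('i \<Rightarrow> 'a) \<Rightarrow> bool" where
  "is_cone C I D G L p \<longleftrightarrow> L \<in> Ob C \<and> (\<forall>i\<in>I. p i \<in> Hom C L (D i)) \<and>
     (\<forall>(i, a, j)\<in>G. a \<cdot>\<^bsub>C\<^esub> p i = p j)"

definition is_limit ::
  "('o, 'a, 'm) cat_scheme \<Rightarrow> 'i set \<Rightarrow> ('i \<Rightarrow> 'o) \<Rightarrow> ('i \<times> 'a \<times> 'i) set
    \<Rightarrow> 'o \<Rightarrow> ('i \<Rightarrow> 'a) \<Rightarrow> bool" where
  "is_limit C I D G L p \<longleftrightarrow> is_diagram C I D G \<and> is_cone C I D G L p \<and>
     (\<forall>K q. is_cone C I D G K q \<longrightarrow>
        (\<exists>!h. h \<in> Hom C K L \<and> (\<forall>i\<in>I. p i \<cdot>\<^bsub>C\<^esub> h = q i)))"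

definition is_coproduct ::
  "('o, 'a, 'm) cat_scheme \<Rightarrow> 'i set \<Rightarrow> ('i \<Rightarrow> 'o) \<Rightarrow> 'o \<Rightarrow> ('i \<Rightarrow> 'a) \<Rightarrow> bool" where
  "is_coproduct C I D K k \<longleftrightarrow> K \<in> Ob C \<and> (\<forall>i\<in>I. D i \<in> Ob C \<and> k i \<in> Hom C (D i) K) \<and>
     (\<forall>Y\<in>Ob C. \<forall>q. (\<forall>i\<in>I. q i \<in> Hom C (D i) Y) \<longrightarrow>
        (\<exists>!h. h \<in> Hom C K Y \<and> (\<forall>i\<in>I. h \<cdot>\<^bsub>C\<^esub> k i = q i)))"

definition finitely_complete :: "('o, 'a, 'm) cat_scheme \<Rightarrow> bool" where
  "finitely_complete C \<longleftrightarrow>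
     (\<forall>(I :: nat set) D G. finite I \<and> finite G \<and> is_diagram C I D G \<longrightarrow>
        (\<exists>L p. is_limit C I D G L p))"

definition has_finite_coproducts :: "('o, 'a, 'm) cat_scheme \<Rightarrow> bool" where
  "has_finite_coproducts C \<longleftrightarrow>
     (\<forall>(I :: nat set) D. finite I \<and> (\<forall>i\<in>I. D i \<in> Ob C) \<longrightarrow>
        (\<exists>K k. is_coproduct C I D K k))"

text \<open>
  The projections of a pullback of the cospan \<open>(f, g)\<close>: \<open>q\<close> is the pullback of \<open>f\<close>
  along \<open>g\<close>, and \<open>p\<close> is the pullback of \<open>g\<close> along \<open>f\<close>.
\<close>

definition is_pullback ::
  "('o, 'a, 'm) cat_scheme \<Rightarrow> 'a \<Rightarrow> 'a \<Rightarrow> 'a \<Rightarrow> 'a \<Rightarrow> bool" where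
  "is_pullback C f g p q \<longleftrightarrow>
     f \<in> Ar C \<and> g \<in> Ar C \<and> Cod C f = Cod C g \<and>
     p \<in> Hom C (Dom C p) (Dom C f) \<and> q \<in> Hom C (Dom C p) (Dom C g) \<and>
     f \<cdot>\<^bsub>C\<^esub> p = g \<cdot>\<^bsub>C\<^esub> q \<and>
     (\<forall>W. \<forall>x\<in>Hom C W (Dom C f). \<forall>y\<in>Hom C W (Dom C g).
        f \<cdot>\<^bsub>C\<^esub> x = g \<cdot>\<^bsub>C\<^esub> y \<longrightarrow>
        (\<exists>!h. h \<in> Hom C W (Dom C p) \<and> p \<cdot>\<^bsub>C\<^esub> h = x \<and> q \<cdot>\<^bsub>C\<^esub> h = y))"

section \<open>Contexts and admissible subobjects\<close>

record ('o, 'a) ctx = "('o, 'a) cat" +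
  EE :: "'a set"
  MM :: "'a set"

definition proper_factorization_system :: "('o, 'a, 'm) ctx_scheme \<Rightarrow> bool" where
  "proper_factorization_system C \<longleftrightarrow>
     (\<forall>e\<in>EE C. is_epi C e) \<and> (\<forall>m\<in>MM C. is_mono C m) \<and>
     (\<forall>e\<in>EE C. \<forall>i. is_iso C i \<longrightarrow>
        (Dom C i = Cod C e \<longrightarrow> i \<cdot>\<^bsub>C\<^esub> e \<in> EE C) \<and>
        (Cod C i = Dom C e \<longrightarrow> e \<cdot>\<^bsub>C\<^esub> i \<in> EE C)) \<and>
     (\<forall>m\<in>MM C. \<forall>i. is_iso C i \<longrightarrow>
        (Dom C i = Cod C m \<longrightarrow> i \<cdot>\<^bsub>C\<^esub> m \<in> MM C) \<and>
        (Cod C i = Dom C m \<longrightarrow> m \<cdot>\<^bsub>C\<^esub> i \<in> MM C)) \<and>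
     (\<forall>f\<in>Ar C. \<exists>e\<in>EE C. \<exists>m\<in>MM C. Cod C e = Dom C m \<and> f = m \<cdot>\<^bsub>C\<^esub> e) \<and>
     (\<forall>e\<in>EE C. \<forall>m\<in>MM C. \<forall>u\<in>Hom C (Dom C e) (Dom C m). \<forall>v\<in>Hom C (Cod C e) (Cod C m).
        m \<cdot>\<^bsub>C\<^esub> u = v \<cdot>\<^bsub>C\<^esub> e \<longrightarrow>
        (\<exists>!d. d \<in> Hom C (Cod C e) (Dom C m) \<and>
              d \<cdot>\<^bsub>C\<^esub> e = u \<and> m \<cdot>\<^bsub>C\<^esub> d = v))"

text \<open>A subobject is an equivalence class of \<open>MM\<close>-arrows, hence a set of arrows.\<close>

definition sub_class :: "('o, 'a, 'm) ctx_scheme \<Rightarrow> 'a \<Rightarrow> 'a set" where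
  "sub_class C m = {n \<in> MM C. Cod C n = Cod C m \<and>
     (\<exists>i\<in>Hom C (Dom C n) (Dom C m). is_iso C i \<and> n = m \<cdot>\<^bsub>C\<^esub> i)}"

definition Sub :: "('o, 'a, 'm) ctx_scheme \<Rightarrow> 'o \<Rightarrow> 'a set gorder" where
  "Sub C X =
     \<lparr>carrier = sub_class C ` {m \<in> MM C. Cod C m = X},
      eq = (=),
      le = (\<lambda>A B. \<exists>m\<in>A. \<exists>n\<in>B. \<exists>h\<in>Hom C (Dom C m) (Dom C n). m = n \<cdot>\<^bsub>C\<^esub> h)\<rparr>"

locale internal_context = category C
  for C :: "('o, 'a, 'm) ctx_scheme" (structure) +
  assumes fin_complete: "finitely_complete C"
    and fin_coproducts: "has_finite_coproducts C"
    and factorization: "proper_factorization_system C"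
    and Sub_complete_lattice: "X \<in> Ob C \<Longrightarrow> complete_lattice (Sub C X)"

text \<open>
  The next three definitions collect all the representatives at once, so that no choice of
  a factorization or of a pullback is needed; the results are equivalence classes.
  For an initial \<open>Dom C e\<close>, the composite \<open>m \<cdot> e\<close> below is the only arrow to \<open>X\<close>.
\<close>

definition bot_sub :: "('o, 'a, 'm) ctx_scheme \<Rightarrow> 'o \<Rightarrow> 'a set" where
  "bot_sub C X = {m \<in> MM C. Cod C m = X \<and>
     (\<exists>e\<in>EE C. is_initial C (Dom C e) \<and> Cod C e = Dom C m)}"

definition sub_image :: "('o, 'a, 'm) ctx_scheme \<Rightarrow> 'a \<Rightarrow> 'a set \<Rightarrow> 'a set" where
  "sub_image C f A = {n \<in> MM C. Cod C n = Cod C f \<and>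
     (\<exists>m\<in>A. \<exists>e\<in>EE C. e \<in> Hom C (Dom C m) (Dom C n) \<and> f \<cdot>\<^bsub>C\<^esub> m = n \<cdot>\<^bsub>C\<^esub> e)}"

definition sub_preimage :: "('o, 'a, 'm) ctx_scheme \<Rightarrow> 'a \<Rightarrow> 'a set \<Rightarrow> 'a set" where
  "sub_preimage C f B = {m \<in> MM C. \<exists>n\<in>B. \<exists>h. is_pullback C f n m h}"

section \<open>Preneighbourhood spaces\<close>

definition Fil :: "('o, 'a, 'm) ctx_scheme \<Rightarrow> 'o \<Rightarrow> 'a set set set" where
  "Fil C X = {F. F \<subseteq> carrier (Sub C X) \<and>
     (\<forall>p\<in>F. \<forall>q\<in>carrier (Sub C X). p \<sqsubseteq>\<^bsub>Sub C X\<^esub> q \<longrightarrow> q \<in> F) \<and>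
     (\<forall>S. finite S \<and> S \<subseteq> F \<longrightarrow> \<Sqinter>\<^bsub>Sub C X\<^esub> S \<in> F)}"

definition pnbd_system :: "('o, 'a, 'm) ctx_scheme \<Rightarrow> 'o \<Rightarrow> ('a set \<Rightarrow> 'a set set) \<Rightarrow> bool" where
  "pnbd_system C X \<mu> \<longleftrightarrow>
     \<mu> \<in> carrier (Sub C X) \<rightarrow>\<^sub>E Fil C X \<and>
     (\<forall>m\<in>carrier (Sub C X). \<forall>n\<in>carrier (Sub C X). m \<sqsubseteq>\<^bsub>Sub C X\<^esub> n \<longrightarrow> \<mu> n \<subseteq> \<mu> m) \<and>
     \<mu> (bot_sub C X) = carrier (Sub C X) \<and>
     (\<forall>m\<in>carrier (Sub C X). \<forall>p\<in>\<mu> m. m \<sqsubseteq>\<^bsub>Sub C X\<^esub> p)"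

type_synonym ('o, 'a) pspace = "'o \<times> ('a set \<Rightarrow> 'a set set)"

definition pspaces :: "('o, 'a, 'm) ctx_scheme \<Rightarrow> ('o, 'a) pspace set" where
  "pspaces C = {(X, \<mu>). X \<in> Ob C \<and> pnbd_system C X \<mu>}"

definition pnbd_morphism ::
  "('o, 'a, 'm) ctx_scheme \<Rightarrow> ('o, 'a) pspace \<Rightarrow> ('o, 'a) pspace \<Rightarrow> 'a \<Rightarrow> bool" where
  "pnbd_morphism C S T f \<longleftrightarrow> f \<in> Hom C (fst S) (fst T) \<and>
     (\<forall>u\<in>carrier (Sub C (fst T)). \<forall>p\<in>snd T u.
        sub_preimage C f p \<in> snd S (sub_preimage C f u))"

definition pNbd ::
  "('o, 'a, 'm) ctx_scheme \<Rightarrow>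
    (('o, 'a) pspace, ('o, 'a) pspace \<times> 'a \<times> ('o, 'a) pspace) cat" where
  "pNbd C =
     \<lparr>Ob = pspaces C,
      Ar = {(S, f, T). S \<in> pspaces C \<and> T \<in> pspaces C \<and> pnbd_morphism C S T f},
      Dom = (\<lambda>(S, f, T). S),
      Cod = (\<lambda>(S, f, T). T),
      Id = (\<lambda>S. (S, Id C (fst S), S)),
      Comp = (\<lambda>(T, g, U) (S, f, T'). (S, g \<cdot>\<^bsub>C\<^esub> f, U))\<rparr>"

text \<open>
  A limit in \<open>pNbd C\<close> lies over a limit in \<open>C\<close>, because the forgetful functor has the
  left adjoint \<open>X \<mapsto> (X, \<lambda>m. {p. m \<sqsubseteq> p})\<close>, and it carries the smallest system that
  makes the projections preneighbourhood morphisms. Conversely, a limit in \<open>C\<close> with this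
  system need not be a limit in \<open>pNbd C\<close>: a mediating arrow may fail to pull the least
  subobject back to a subobject that is a preneighbourhood of itself.
\<close>

definition smallest_system ::
  "('o, 'a, 'm) ctx_scheme \<Rightarrow> 'o \<Rightarrow> ('a \<times> ('o, 'a) pspace) set
    \<Rightarrow> ('a set \<Rightarrow> 'a set set) \<Rightarrow> bool" where
  "smallest_system C P L \<pi> \<longleftrightarrow>
     pnbd_system C P \<pi> \<and> (\<forall>(h, S)\<in>L. pnbd_morphism C (P, \<pi>) S h) \<and>
     (\<forall>\<pi>'. pnbd_system C P \<pi>' \<and> (\<forall>(h, S)\<in>L. pnbd_morphism C (P, \<pi>') S h) \<longrightarrow>
        (\<forall>u\<in>carrier (Sub C P). \<pi> u \<subseteq> \<pi>' u))"

text \<open>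
  The pullback of \<open>f : S \<rightarrow> T\<close> along \<open>g : U \<rightarrow> T\<close>. The third projection of this limit,
  to \<open>T\<close>, is \<open>g \<cdot> q\<close>, which is a preneighbourhood morphism as soon as \<open>g\<close> and \<open>q\<close> are.
\<close>

definition pnbd_pullback ::
  "('o, 'a, 'm) ctx_scheme \<Rightarrow> ('o, 'a) pspace \<Rightarrow> ('o, 'a) pspace \<Rightarrow> 'a \<Rightarrow> 'a
    \<Rightarrow> ('o, 'a) pspace \<Rightarrow> 'a \<Rightarrow> 'a \<Rightarrow> bool" where
  "pnbd_pullback C S U f g W p q \<longleftrightarrow>
     is_pullback C f g p q \<and> Dom C p = fst W \<and>
     smallest_system C (fst W) {(p, S), (q, U)} (snd W)"

text \<open>\<open>stably C Q S T f\<close>: all pullbacks of \<open>f : S \<rightarrow> T\<close> along preneighbourhood morphisms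
  have the property \<open>Q\<close>.\<close>

definition stably ::
  "('o, 'a, 'm) ctx_scheme \<Rightarrow> (('o, 'a) pspace \<Rightarrow> ('o, 'a) pspace \<Rightarrow> 'a \<Rightarrow> bool)
    \<Rightarrow> ('o, 'a) pspace \<Rightarrow> ('o, 'a) pspace \<Rightarrow> 'a \<Rightarrow> bool" where
  "stably C Q S T f \<longleftrightarrow>
     (\<forall>U\<in>pspaces C. \<forall>g W p q.
        pnbd_morphism C U T g \<and> pnbd_pullback C S U f g W p q \<longrightarrow> Q W U q)"

section \<open>Closure, closed, continuous and proper morphisms, compactness\<close>

definition Far :: "('o, 'a, 'm) ctx_scheme \<Rightarrow> ('o, 'a) pspace \<Rightarrow> 'a set \<Rightarrow> 'a set set" where
  "Far C S p = {x \<in> carrier (Sub C (fst S)).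
     \<exists>u\<in>snd S x. u \<sqinter>\<^bsub>Sub C (fst S)\<^esub> p = bot_sub C (fst S)}"

definition pcl :: "('o, 'a, 'm) ctx_scheme \<Rightarrow> ('o, 'a) pspace \<Rightarrow> 'a set \<Rightarrow> 'a set" where
  "pcl C S p = \<Squnion>\<^bsub>Sub C (fst S)\<^esub>
     {x \<in> carrier (Sub C (fst S)). \<not> p \<sqsubset>\<^bsub>Sub C (fst S)\<^esub> x \<and> x \<notin> Far C S p}"

definition closed_subs :: "('o, 'a, 'm) ctx_scheme \<Rightarrow> ('o, 'a) pspace \<Rightarrow> 'a set set" where
  "closed_subs C S = {p \<in> carrier (Sub C (fst S)). pcl C S p = p}"

definition closed_morphism ::
  "('o, 'a, 'm) ctx_scheme \<Rightarrow> ('o, 'a) pspace \<Rightarrow> ('o, 'a) pspace \<Rightarrow> 'a \<Rightarrow> bool" where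
  "closed_morphism C S T f \<longleftrightarrow>
     (\<forall>p\<in>closed_subs C S. sub_image C f p \<in> closed_subs C T)"

definition continuous_morphism ::
  "('o, 'a, 'm) ctx_scheme \<Rightarrow> ('o, 'a) pspace \<Rightarrow> ('o, 'a) pspace \<Rightarrow> 'a \<Rightarrow> bool" where
  "continuous_morphism C S T f \<longleftrightarrow>
     (\<forall>t\<in>closed_subs C T. sub_preimage C f t \<in> closed_subs C S)"

text \<open>
  That \<open>f\<close> is a preneighbourhood morphism is a premise of this notion, not a part of it: it
  has to be assumed separately. For the arrow to the terminal object in the definition of
  compactness it is not demanded; there it is automatic whenever \<open>(1, \<nabla>\<^sub>1)\<close> is terminal
  among the preneighbourhood spaces.
\<close>

definition proper_morphism ::
  "('o, 'a, 'm) ctx_scheme \<Rightarrow> ('o, 'a) pspace \<Rightarrow> ('o, 'a) pspace \<Rightarrow> 'a \<Rightarrow> bool" where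
  "proper_morphism C S T f \<longleftrightarrow> stably C (closed_morphism C) S T f"

definition one :: "('o, 'a, 'm) ctx_scheme \<Rightarrow> 'o" where
  "one C = (SOME T. is_terminal C T)"

definition bang :: "('o, 'a, 'm) ctx_scheme \<Rightarrow> 'o \<Rightarrow> 'a" where
  "bang C X = (THE f. f \<in> Hom C X (one C))"

definition one_space :: "('o, 'a, 'm) ctx_scheme \<Rightarrow> ('o, 'a) pspace" where
  "one_space C = (one C,
     (\<lambda>x\<in>carrier (Sub C (one C)).
        if x = bot_sub C (one C) then carrier (Sub C (one C))
        else {sub_class C (Id C (one C))}))"

definition compact_space :: "('o, 'a, 'm) ctx_scheme \<Rightarrow> ('o, 'a) pspace \<Rightarrow> bool" where
  "compact_space C S \<longleftrightarrow>
     S \<in> pspaces C \<and> proper_morphism C S (one_space C) (bang C (fst S))"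

text \<open>The image of the class \<open>a\<close> under \<open>k \<mapsto> m \<cdot> k\<close> is the class of the composite.\<close>

definition sub_space :: "('o, 'a, 'm) ctx_scheme \<Rightarrow> ('o, 'a) pspace \<Rightarrow> 'a \<Rightarrow> ('o, 'a) pspace" where
  "sub_space C S m = (Dom C m,
     (\<lambda>a\<in>carrier (Sub C (Dom C m)).
        {u \<in> carrier (Sub C (Dom C m)).
           \<exists>v\<in>snd S ((\<lambda>k. m \<cdot>\<^bsub>C\<^esub> k) ` a).
             sub_preimage C m v \<sqsubseteq>\<^bsub>Sub C (Dom C m)\<^esub> u}))"

end

theory Submission
  imports Defs
begin

text \<open>
  The classical proofs multiply with a test space \<open>U\<close>: compactness of \<open>S\<close> says that the
  projections \<open>S \<times> U \<rightarrow> U\<close> are closed, and one factors or lifts closed subobjects along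
  \<open>f \<times> 1 : S \<times> U \<rightarrow> T \<times> U\<close>, which is a pullback of \<open>f\<close>. The difficulty is that products carry
  the smallest system for the two projections, and that \<open>f \<times> 1\<close> may fail to be a
  preneighbourhood morphism for these systems: it can pull the least subobject \<open>\<sigma>\<close> back to a
  subobject that is no preneighbourhood of itself. This is the only obstruction
  (\<open>mediating_morphism\<close>), and it is circumvented by two properties of closed subobjects.

  A subobject \<open>k \<noteq> \<sigma>\<close> is closed iff every \<open>x\<close> incomparable with \<open>k\<close> has a preneighbourhood that
  meets \<open>k\<close> in \<open>\<sigma>\<close> (\<open>closed_subs_iff\<close>). Hence closed subobjects stay closed when the system
  grows, and the system may even change arbitrarily below \<open>k\<close> (\<open>closed_subs_finer_off\<close>).

  For proper \<open>f\<close> and compact \<open>T\<close>, the object \<open>S \<times> U\<close> receives the smallest system that makes the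
  projection to \<open>S\<close> and \<open>f \<times> 1\<close> morphisms; it is finer than the product system, so closed
  subobjects of the product are closed for it, and the composite
  \<open>S \<times> U \<rightarrow> T \<times> U \<rightarrow> U\<close> of closed morphisms takes them to closed ones.

  For \<open>f\<close> stably continuous and stably in \<open>EE\<close>, the inverse image \<open>k\<close> of a closed \<open>t\<close> under \<open>f \<times> 1\<close>
  is closed for that finer system. The two systems differ only below the inverse image of \<open>\<sigma>\<close>,
  which lies below \<open>k\<close>, so that \<open>k\<close> is closed for the product system as well; its image in \<open>U\<close>
  is the image of \<open>t\<close>.

  For a finite product \<open>P\<close> in the category of preneighbourhood spaces, \<open>P \<times> U\<close> is built by multiplying
  \<open>U\<close> with one factor after the other. This gives \<open>P \<times> U\<close> a system for which the projection to \<open>U\<close>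
  is closed, and the universal property of \<open>P\<close> makes the projection to \<open>P\<close> a morphism, so that
  this system is finer than the product system.

  For a closed \<open>m : M \<rightarrow> X\<close>, the morphism \<open>h = m \<times> 1\<close> is the inverse image of \<open>m\<close> along a projection,
  hence closed. A closed \<open>k\<close> in \<open>M \<times> U\<close> then has a closed image in \<open>X \<times> U\<close>: a subobject not below \<open>h\<close> is
  separated from \<open>h\<close>, and one below \<open>h\<close> is separated from \<open>k\<close> inside \<open>M \<times> U\<close>, whose system is coarser
  than the subspace system.
\<close>

section \<open>Arrows, isomorphisms and pullbacks\<close>

lemma HomD: "f \<in> Hom C X Y \<Longrightarrow> f \<in> Ar C \<and> Dom C f = X \<and> Cod C f = Y"
  by (simp add: Hom_def)

lemma HomI: "f \<in> Ar C \<Longrightarrow> f \<in> Hom C (Dom C f) (Cod C f)"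
  by (simp add: Hom_def)

text \<open>Factorization through a subobject plays the role of membership of a generalized
  element: subobjects are compared, and inverse images computed, by the arrows factoring through
  them, independently of representatives.\<close>

definition factors :: "('o, 'a, 'm) cat_scheme \<Rightarrow> 'a \<Rightarrow> 'a set \<Rightarrow> bool" where
  "factors C k A \<longleftrightarrow> (\<exists>n\<in>A. \<exists>h\<in>Hom C (Dom C k) (Dom C n). k = n \<cdot>\<^bsub>C\<^esub> h)"

context category
begin

lemma comp_Hom [intro]: "\<lbrakk>g \<in> Hom C Y Z; f \<in> Hom C X Y\<rbrakk> \<Longrightarrow> g \<cdot> f \<in> Hom C X Z"
  by (rule comp_in_Hom)

lemma Hom_Ob: "f \<in> Hom C X Y \<Longrightarrow> X \<in> Ob C \<and> Y \<in> Ob C"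
  using dom_in_Ob[of f] cod_in_Ob[of f] HomD[of f C X Y] by auto

lemma is_isoE:
  assumes "is_iso C i" "i \<in> Hom C X Y"
  obtains j where "j \<in> Hom C Y X" "j \<cdot> i = Id C X" "i \<cdot> j = Id C Y" "is_iso C j"
proof -
  obtain j where j: "j \<in> Hom C Y X" "j \<cdot> i = Id C X" "i \<cdot> j = Id C Y"
    using assms(1) HomD[OF assms(2)] unfolding is_iso_def by auto
  then have "is_iso C j" unfolding is_iso_def using assms(2) HomD[OF j(1)] by auto
  then show thesis using that j by blast
qed

lemma is_isoI:
  "\<lbrakk>i \<in> Hom C X Y; j \<in> Hom C Y X; j \<cdot> i = Id C X; i \<cdot> j = Id C Y\<rbrakk> \<Longrightarrow> is_iso C i"
  unfolding is_iso_def using HomD[of i C X Y] by auto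

lemma is_iso_Id: "X \<in> Ob C \<Longrightarrow> is_iso C (Id C X)"
  using is_isoI[OF id_in_Hom id_in_Hom] comp_id_left[OF id_in_Hom] by simp

lemma is_iso_comp:
  assumes "is_iso C i" "i \<in> Hom C X Y" "is_iso C j" "j \<in> Hom C Y Z"
  shows "is_iso C (j \<cdot> i)"
proof -
  obtain i' where i': "i' \<in> Hom C Y X" "i' \<cdot> i = Id C X" "i \<cdot> i' = Id C Y" "is_iso C i'"
    by (rule is_isoE[OF assms(1,2)])
  obtain j' where j': "j' \<in> Hom C Z Y" "j' \<cdot> j = Id C Y" "j \<cdot> j' = Id C Z" "is_iso C j'"
    by (rule is_isoE[OF assms(3,4)])
  note ij = comp_Hom[OF assms(4,2)] and ij' = comp_Hom[OF i'(1) j'(1)]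
  show ?thesis
  proof (rule is_isoI[OF ij ij'])
    have "(i' \<cdot> j') \<cdot> (j \<cdot> i) = i' \<cdot> ((j' \<cdot> j) \<cdot> i)"
      using comp_assoc[OF ij j'(1) i'(1)] comp_assoc[OF assms(2,4) j'(1)] by simp
    then show "(i' \<cdot> j') \<cdot> (j \<cdot> i) = Id C X"
      using i'(2) j'(2) comp_id_left[OF assms(2)] by simp
    have "(j \<cdot> i) \<cdot> (i' \<cdot> j') = j \<cdot> ((i \<cdot> i') \<cdot> j')"
      using comp_assoc[OF ij' assms(2,4)] comp_assoc[OF j'(1) i'(1) assms(2)] by simp
    then show "(j \<cdot> i) \<cdot> (i' \<cdot> j') = Id C Z"
      using i'(3) j'(3) comp_id_left[OF j'(1)] by simp
  qed
qed

lemma monoD: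
  "\<lbrakk>is_mono C m; m \<in> Hom C X Y; x \<in> Hom C W X; y \<in> Hom C W X; m \<cdot> x = m \<cdot> y\<rbrakk> \<Longrightarrow> x = y"
  unfolding is_mono_def using HomD[of m C X Y] by blast

lemma epiD:
  "\<lbrakk>is_epi C e; e \<in> Hom C X Y; x \<in> Hom C Y W; y \<in> Hom C Y W; x \<cdot> e = y \<cdot> e\<rbrakk> \<Longrightarrow> x = y"
  unfolding is_epi_def using HomD[of e C X Y] by blast

lemma pullback_Hom:
  assumes "is_pullback C f g p q" "f \<in> Hom C X Z"
  shows "g \<in> Hom C (Dom C g) Z" "p \<in> Hom C (Dom C p) X" "q \<in> Hom C (Dom C p) (Dom C g)"
    "f \<cdot> p = g \<cdot> q" "Dom C p \<in> Ob C"
proof -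
  have b: "f \<in> Ar C" "g \<in> Ar C" "Cod C f = Cod C g" "p \<in> Hom C (Dom C p) (Dom C f)"
    "q \<in> Hom C (Dom C p) (Dom C g)" "f \<cdot> p = g \<cdot> q"
    by (insert assms(1), unfold is_pullback_def, blast)+
  then show "g \<in> Hom C (Dom C g) Z" "p \<in> Hom C (Dom C p) X" "q \<in> Hom C (Dom C p) (Dom C g)"
    "f \<cdot> p = g \<cdot> q" "Dom C p \<in> Ob C"
    using HomD[OF assms(2)] HomI[of g C] Hom_Ob[OF b(4)] by simp_all
qed

lemma pullbackE:
  assumes "is_pullback C f g p q" "f \<in> Hom C X Z" "x \<in> Hom C W X" "y \<in> Hom C W (Dom C g)"
    "f \<cdot> x = g \<cdot> y"
  obtains h where "h \<in> Hom C W (Dom C p)" "p \<cdot> h = x" "q \<cdot> h = y"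
proof -
  have "\<exists>!h. h \<in> Hom C W (Dom C p) \<and> p \<cdot> h = x \<and> q \<cdot> h = y"
    using assms(1,3-5) HomD[OF assms(2)] unfolding is_pullback_def by blast
  then show thesis using that by blast
qed

lemma pullback_eq:
  assumes "is_pullback C f g p q" "h \<in> Hom C W (Dom C p)" "k \<in> Hom C W (Dom C p)"
    "p \<cdot> h = p \<cdot> k" "q \<cdot> h = q \<cdot> k"
  shows "h = k"
proof -
  have f: "f \<in> Hom C (Dom C f) (Cod C f)" using assms(1) HomI[of f C] unfolding is_pullback_def by blast
  note P = pullback_Hom[OF assms(1) f]
  have "f \<cdot> (p \<cdot> h) = g \<cdot> (q \<cdot> h)" using comp_assoc[OF assms(2) P(2) f] comp_assoc[OF assms(2) P(3) P(1)] P(4) by simp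
  moreover have "p \<cdot> h \<in> Hom C W (Dom C f)" "q \<cdot> h \<in> Hom C W (Dom C g)"
    using P assms(2) by auto
  ultimately have "\<exists>!l. l \<in> Hom C W (Dom C p) \<and> p \<cdot> l = p \<cdot> h \<and> q \<cdot> l = q \<cdot> h"
    using assms(1) unfolding is_pullback_def by blast
  then show ?thesis using assms(2-5) by auto
qed

lemma pullbackI:
  assumes "f \<in> Hom C X Z" "g \<in> Hom C Y Z" "p \<in> Hom C P X" "q \<in> Hom C P Y" "f \<cdot> p = g \<cdot> q"
    and ex: "\<And>W x y. \<lbrakk>x \<in> Hom C W X; y \<in> Hom C W Y; f \<cdot> x = g \<cdot> y\<rbrakk>
      \<Longrightarrow> \<exists>h\<in>Hom C W P. p \<cdot> h = x \<and> q \<cdot> h = y"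
    and un: "\<And>W h k. \<lbrakk>h \<in> Hom C W P; k \<in> Hom C W P; p \<cdot> h = p \<cdot> k; q \<cdot> h = q \<cdot> k\<rbrakk> \<Longrightarrow> h = k"
  shows "is_pullback C f g p q"
proof -
  have "\<exists>!h. h \<in> Hom C W P \<and> p \<cdot> h = x \<and> q \<cdot> h = y"
    if "x \<in> Hom C W X" "y \<in> Hom C W Y" "f \<cdot> x = g \<cdot> y" for W x y
    using ex[OF that] un[of _ W] by metis
  moreover have "Dom C p = P" "Dom C f = X" "Cod C f = Z" "Dom C g = Y" "Cod C g = Z"
    "f \<in> Ar C" "g \<in> Ar C"
    using HomD[OF assms(1)] HomD[OF assms(2)] HomD[OF assms(3)] by auto
  ultimately show ?thesis unfolding is_pullback_def using assms by auto
qed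

text \<open>Lets a stability hypothesis on \<open>f\<close> apply to the restrictions of a pullback \<open>h\<close> of \<open>f\<close>.\<close>

lemma pullback_paste:
  assumes 1: "is_pullback C f g p h" and 2: "is_pullback C h t a b" and f: "f \<in> Hom C X Y"
  shows "is_pullback C f (g \<cdot> t) (p \<cdot> a) b"
proof -
  note P = pullback_Hom[OF 1 f]
  note Q = pullback_Hom[OF 2 P(3)]
  have c: "f \<cdot> (p \<cdot> a) = (g \<cdot> t) \<cdot> b"
    using comp_assoc[OF Q(2) P(2) f, symmetric] comp_assoc[OF Q(2) P(3) P(1)]
      comp_assoc[OF Q(3) Q(1) P(1)] P(4) Q(4) by simp
  show ?thesis
  proof (rule pullbackI[OF f _ _ Q(3) c])
    show "g \<cdot> t \<in> Hom C (Dom C t) Y" "p \<cdot> a \<in> Hom C (Dom C a) X" using P Q by auto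
  next
    fix W x y assume x: "x \<in> Hom C W X" and y: "y \<in> Hom C W (Dom C t)" and e: "f \<cdot> x = (g \<cdot> t) \<cdot> y"
    have ty: "t \<cdot> y \<in> Hom C W (Dom C g)" using Q y by auto
    have "f \<cdot> x = g \<cdot> (t \<cdot> y)" using e comp_assoc[OF y Q(1) P(1)] by simp
    then obtain k where k: "k \<in> Hom C W (Dom C p)" "p \<cdot> k = x" "h \<cdot> k = t \<cdot> y"
      using pullbackE[OF 1 f x ty] by metis
    obtain l where l: "l \<in> Hom C W (Dom C a)" "a \<cdot> l = k" "b \<cdot> l = y"
      using pullbackE[OF 2 P(3) k(1) y k(3)] by metis
    have "(p \<cdot> a) \<cdot> l = x" using l k comp_assoc[OF l(1) Q(2) P(2)] by simp
    then show "\<exists>l\<in>Hom C W (Dom C a). (p \<cdot> a) \<cdot> l = x \<and> b \<cdot> l = y" using l by blast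
  next
    fix W k l assume k: "k \<in> Hom C W (Dom C a)" and l: "l \<in> Hom C W (Dom C a)"
      and e: "(p \<cdot> a) \<cdot> k = (p \<cdot> a) \<cdot> l" "b \<cdot> k = b \<cdot> l"
    have "p \<cdot> (a \<cdot> k) = p \<cdot> (a \<cdot> l)"
      using e comp_assoc[OF k Q(2) P(2)] comp_assoc[OF l Q(2) P(2)] by simp
    moreover have "h \<cdot> (a \<cdot> k) = h \<cdot> (a \<cdot> l)"
      using e comp_assoc[OF k Q(2) P(3)] comp_assoc[OF l Q(2) P(3)] comp_assoc[OF k Q(3) Q(1)]
        comp_assoc[OF l Q(3) Q(1)] Q(4) by simp
    moreover have "a \<cdot> k \<in> Hom C W (Dom C p)" "a \<cdot> l \<in> Hom C W (Dom C p)" using Q k l by auto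
    ultimately have "a \<cdot> k = a \<cdot> l" using pullback_eq[OF 1] by blast
    then show "k = l" using pullback_eq[OF 2 k l _ e(2)] by blast
  qed
qed

end

section \<open>Limits in a context\<close>

context internal_context
begin

lemma pullback_exists:
  assumes f: "f \<in> Hom C X Z" and g: "g \<in> Hom C Y Z"
  shows "\<exists>p q. is_pullback C f g p q"
proof -
  define D where "D = (\<lambda>i::nat. if i = 0 then X else if i = 1 then Y else Z)"
  define G where "G = {(0::nat, f, 2::nat), (1, g, 2)}"
  have dia: "is_diagram C {0,1,2} D G"
    unfolding is_diagram_def D_def G_def using f g Hom_Ob[OF f] Hom_Ob[OF g] by simp
  have "finite G" unfolding G_def by simp
  then obtain L r where L: "is_limit C {0,1,2} D G L r"
    using fin_complete[unfolded finitely_complete_def, rule_format, of "{0,1,2}" G D] dia by auto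
  then have cone: "is_cone C {0,1,2} D G L r" unfolding is_limit_def by blast
  then have r: "r 0 \<in> Hom C L X" "r 1 \<in> Hom C L Y" "r 2 \<in> Hom C L Z"
      "f \<cdot> r 0 = r 2" "g \<cdot> r 1 = r 2"
    unfolding is_cone_def D_def G_def by simp_all
  have un: "\<exists>!h. h \<in> Hom C W L \<and> r 0 \<cdot> h = x \<and> r 1 \<cdot> h = y"
    if x: "x \<in> Hom C W X" and y: "y \<in> Hom C W Y" and e: "f \<cdot> x = g \<cdot> y" for W x y
  proof -
    define s where "s = (\<lambda>i::nat. if i = 0 then x else if i = 1 then y else f \<cdot> x)"
    have "is_cone C {0,1,2} D G W s"
      unfolding is_cone_def D_def G_def s_def using x y e comp_Hom[OF f x] Hom_Ob[OF x] by simp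
    then have ex: "\<exists>!h. h \<in> Hom C W L \<and> (\<forall>i\<in>{0,1,2}. r i \<cdot> h = s i)"
      using L unfolding is_limit_def by blast
    have "(h \<in> Hom C W L \<and> (\<forall>i\<in>{0,1,2}. r i \<cdot> h = s i))
        \<longleftrightarrow> (h \<in> Hom C W L \<and> r 0 \<cdot> h = x \<and> r 1 \<cdot> h = y)" for h
      using comp_assoc[OF _ r(1) f, of h W] r(4) unfolding s_def by force
    then show ?thesis using ex by simp
  qed
  have "is_pullback C f g (r 0) (r 1)"
  proof (rule pullbackI[OF f g r(1,2)])
    show "f \<cdot> r 0 = g \<cdot> r 1" using r by simp
    show "\<exists>h\<in>Hom C W L. r 0 \<cdot> h = x \<and> r 1 \<cdot> h = y"
      if "x \<in> Hom C W X" "y \<in> Hom C W Y" "f \<cdot> x = g \<cdot> y" for W x y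
      using un[OF that] by blast
    show "h = k" if h: "h \<in> Hom C W L" and k: "k \<in> Hom C W L"
      and e: "r 0 \<cdot> h = r 0 \<cdot> k" "r 1 \<cdot> h = r 1 \<cdot> k" for W h k
    proof -
      have "f \<cdot> (r 0 \<cdot> h) = g \<cdot> (r 1 \<cdot> h)"
        using comp_assoc[OF h r(1) f] comp_assoc[OF h r(2) g] r(4,5) by simp
      then show ?thesis using un[of "r 0 \<cdot> h" W "r 1 \<cdot> h"] h k e r(1,2) by (metis comp_Hom)
    qed
  qed
  then show ?thesis by blast
qed

lemma one_terminal: "is_terminal C (one C)"
proof -
  have "is_diagram C ({} :: nat set) D {}" for D by (simp add: is_diagram_def)
  then obtain L r where L: "is_limit C ({} :: nat set) (\<lambda>_. undefined) {} L r"
    using fin_complete unfolding finitely_complete_def by (metis finite.emptyI)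
  have "is_terminal C L"
    using L unfolding is_terminal_def is_limit_def is_cone_def by simp
  then show ?thesis unfolding one_def by (rule someI)
qed

lemma initial_exists: "\<exists>I. is_initial C I"
proof -
  obtain K k where K: "is_coproduct C ({} :: nat set) (\<lambda>_. undefined) K k"
    using fin_coproducts unfolding has_finite_coproducts_def by (metis empty_iff finite.emptyI)
  have "is_initial C K"
    using K unfolding is_initial_def is_coproduct_def by simp
  then show ?thesis by blast
qed

lemma Hom_one_unique: "\<lbrakk>f \<in> Hom C X (one C); g \<in> Hom C X (one C)\<rbrakk> \<Longrightarrow> f = g"
  using one_terminal Hom_Ob[of f X] unfolding is_terminal_def by blast

lemma bang_Hom:
  assumes "X \<in> Ob C"
  shows "bang C X \<in> Hom C X (one C)"
proof -
  have "\<exists>!f. f \<in> Hom C X (one C)" using one_terminal assms unfolding is_terminal_def by blast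
  then show ?thesis unfolding bang_def by (rule theI')
qed

lemma bang_eq:
  assumes "f \<in> Hom C X (one C)"
  shows "f = bang C X"
  by (rule Hom_one_unique[OF assms bang_Hom]) (use Hom_Ob[OF assms] in simp)

lemma productE:
  assumes "is_pullback C (bang C X) (bang C Y) p q" "X \<in> Ob C" "Y \<in> Ob C"
    "x \<in> Hom C W X" "y \<in> Hom C W Y"
  obtains h where "h \<in> Hom C W (Dom C p)" "p \<cdot> h = x" "q \<cdot> h = y"
proof -
  have "bang C X \<cdot> x = bang C Y \<cdot> y"
    using Hom_one_unique comp_Hom[OF bang_Hom[OF assms(2)] assms(4)]
      comp_Hom[OF bang_Hom[OF assms(3)] assms(5)] by blast
  moreover have "y \<in> Hom C W (Dom C (bang C Y))" using assms HomD[OF bang_Hom[OF assms(3)]] by simp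
  ultimately show ?thesis
    using pullbackE[OF assms(1) bang_Hom[OF assms(2)] assms(4)] that by blast
qed

lemma product_Hom:
  assumes "is_pullback C (bang C X) (bang C Y) p q" "X \<in> Ob C" "Y \<in> Ob C"
  shows "p \<in> Hom C (Dom C p) X" "q \<in> Hom C (Dom C p) Y" "Dom C p \<in> Ob C"
  using pullback_Hom[OF assms(1) bang_Hom[OF assms(2)]] HomD[OF bang_Hom[OF assms(3)]] by auto

lemma product_exists:
  "\<lbrakk>X \<in> Ob C; Y \<in> Ob C\<rbrakk> \<Longrightarrow> \<exists>p q. is_pullback C (bang C X) (bang C Y) p q"
  by (rule pullback_exists[OF bang_Hom bang_Hom])

text \<open>The arrow \<open>h = f \<times> 1\<close> between binary products is the pullback of \<open>f\<close> along the projection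
  \<open>p'\<close>: a generalized element of \<open>X \<times> Z\<close> is one of \<open>Y \<times> Z\<close> with a lift of its first coordinate.
  Products are written as pullbacks over the terminal object, the form in which compactness
  speaks of them.\<close>

lemma product_pullback:
  assumes 1: "is_pullback C (bang C X) (bang C Z) p q" and 2: "is_pullback C (bang C Y) (bang C Z) p' q'"
    and f: "f \<in> Hom C X Y" and Z: "Z \<in> Ob C" and h: "h \<in> Hom C (Dom C p) (Dom C p')"
    and ph: "p' \<cdot> h = f \<cdot> p" and qh: "q' \<cdot> h = q"
  shows "is_pullback C f p' p h"
proof -
  have X: "X \<in> Ob C" and Y: "Y \<in> Ob C" using f Hom_Ob by blast+
  note P = product_Hom[OF 1 X Z] and P' = product_Hom[OF 2 Y Z]
  show ?thesis
  proof (rule pullbackI[OF f P'(1) P(1) h])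
    show "f \<cdot> p = p' \<cdot> h" using ph by simp
  next
    fix W x y assume x: "x \<in> Hom C W X" and y: "y \<in> Hom C W (Dom C p')" and e: "f \<cdot> x = p' \<cdot> y"
    obtain k where k: "k \<in> Hom C W (Dom C p)" "p \<cdot> k = x" "q \<cdot> k = q' \<cdot> y"
      using productE[OF 1 X Z x] y P'(2) by (metis comp_Hom)
    have "p' \<cdot> (h \<cdot> k) = p' \<cdot> y"
      using comp_assoc[OF k(1) h P'(1)] comp_assoc[OF k(1) P(1) f] ph k(2) e by simp
    moreover have "q' \<cdot> (h \<cdot> k) = q' \<cdot> y"
      using comp_assoc[OF k(1) h P'(2)] qh k(3) by simp
    ultimately have "h \<cdot> k = y" using pullback_eq[OF 2] h k(1) y by (metis comp_Hom)
    then show "\<exists>k\<in>Hom C W (Dom C p). p \<cdot> k = x \<and> h \<cdot> k = y" using k by blast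
  next
    fix W k l assume k: "k \<in> Hom C W (Dom C p)" and l: "l \<in> Hom C W (Dom C p)"
      and e: "p \<cdot> k = p \<cdot> l" "h \<cdot> k = h \<cdot> l"
    have "q \<cdot> k = q \<cdot> l"
      using comp_assoc[OF k h P'(2)] comp_assoc[OF l h P'(2)] e(2) qh by simp
    then show "k = l" using pullback_eq[OF 1 k l e(1)] by blast
  qed
qed

section \<open>Factorizations\<close>

lemma E_epi: "e \<in> EE C \<Longrightarrow> is_epi C e"
  using factorization unfolding proper_factorization_system_def by blast

lemma M_mono: "m \<in> MM C \<Longrightarrow> is_mono C m"
  using factorization unfolding proper_factorization_system_def by blast

lemma M_Hom: "m \<in> MM C \<Longrightarrow> m \<in> Hom C (Dom C m) (Cod C m)"
  using M_mono[of m] HomI[of m C] unfolding is_mono_def by blast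

lemma E_Hom: "e \<in> EE C \<Longrightarrow> e \<in> Hom C (Dom C e) (Cod C e)"
  using E_epi[of e] HomI[of e C] unfolding is_epi_def by blast

lemma E_iso:
  assumes "e \<in> EE C" "e \<in> Hom C X Y" "is_iso C i" "i \<in> Hom C Y Z"
  shows "i \<cdot> e \<in> EE C"
proof -
  have "Dom C i = Cod C e" using HomD[OF assms(2)] HomD[OF assms(4)] by simp
  then show ?thesis
    using factorization assms(1,3) unfolding proper_factorization_system_def by blast
qed

lemma M_iso:
  assumes "m \<in> MM C" "m \<in> Hom C X Y" "is_iso C i" "i \<in> Hom C Z X"
  shows "m \<cdot> i \<in> MM C"
proof -
  have "Cod C i = Dom C m" using HomD[OF assms(2)] HomD[OF assms(4)] by simp
  then show ?thesis
    using factorization assms(1,3) unfolding proper_factorization_system_def by blast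
qed

lemma factorize:
  assumes f: "f \<in> Hom C X Y"
  obtains e m Z where "e \<in> EE C" "e \<in> Hom C X Z" "m \<in> MM C" "m \<in> Hom C Z Y" "f = m \<cdot> e"
proof -
  obtain e m where em: "e \<in> EE C" "m \<in> MM C" "Cod C e = Dom C m" "f = m \<cdot> e"
    using factorization HomD[OF f] unfolding proper_factorization_system_def by blast
  have m: "m \<in> Hom C (Dom C m) (Cod C m)" using M_Hom[OF em(2)] .
  have e: "e \<in> Hom C (Dom C e) (Dom C m)" using E_Hom[OF em(1)] em(3) by simp
  have "f \<in> Hom C (Dom C e) (Cod C m)" using em(4) comp_Hom[OF m e] by simp
  then have "Dom C e = X" "Cod C m = Y" using HomD[OF f] HomD[of f C] by auto
  then show thesis using that em m e by blast
qed

lemma diagonal: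
  assumes "e \<in> EE C" "e \<in> Hom C X Y" "m \<in> MM C" "m \<in> Hom C A B" "u \<in> Hom C X A" "v \<in> Hom C Y B"
    "m \<cdot> u = v \<cdot> e"
  obtains d where "d \<in> Hom C Y A" "d \<cdot> e = u" "m \<cdot> d = v"
proof -
  have "u \<in> Hom C (Dom C e) (Dom C m)" "v \<in> Hom C (Cod C e) (Cod C m)"
    using assms(5,6) HomD[OF assms(2)] HomD[OF assms(4)] by simp_all
  then have "\<exists>!d. d \<in> Hom C (Cod C e) (Dom C m) \<and> d \<cdot> e = u \<and> m \<cdot> d = v"
    using factorization assms(1,3,7) unfolding proper_factorization_system_def by blast
  then show thesis using that HomD[OF assms(2)] HomD[OF assms(4)] by auto
qed

text \<open>\<open>MM\<close> is the class of arrows with lifts against \<open>EE\<close>: in the factorization \<open>f = m \<cdot> e\<close> a lift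
  of the identity along \<open>e\<close> splits the epimorphism \<open>e\<close>, which makes it invertible. Closure of
  \<open>MM\<close> under composition and pullback follows, since both preserve lifts.\<close>

lemma M_orthogonal:
  assumes f: "f \<in> Hom C X Y"
    and d: "\<And>e A B u v. \<lbrakk>e \<in> EE C; e \<in> Hom C A B; u \<in> Hom C A X; v \<in> Hom C B Y; f \<cdot> u = v \<cdot> e\<rbrakk>
      \<Longrightarrow> \<exists>d\<in>Hom C B X. d \<cdot> e = u"
  shows "f \<in> MM C"
proof -
  obtain e m Z where em: "e \<in> EE C" "e \<in> Hom C X Z" "m \<in> MM C" "m \<in> Hom C Z Y" "f = m \<cdot> e"
    using factorize[OF f] .
  have X: "X \<in> Ob C" and Z: "Z \<in> Ob C" using Hom_Ob[OF em(2)] by auto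
  have "f \<cdot> Id C X = m \<cdot> e" using comp_id_right[OF f] em(5) by simp
  then obtain k where k: "k \<in> Hom C Z X" "k \<cdot> e = Id C X"
    using d[OF em(1,2) id_in_Hom[OF X] em(4)] by blast
  have "(e \<cdot> k) \<cdot> e = Id C Z \<cdot> e"
    using comp_assoc[OF em(2) k(1) em(2)] k(2) comp_id_right[OF em(2)] comp_id_left[OF em(2)] by simp
  then have "e \<cdot> k = Id C Z"
    using epiD[OF E_epi[OF em(1)] em(2) comp_Hom[OF em(2) k(1)] id_in_Hom[OF Z]] by blast
  then have "is_iso C e" using is_isoI[OF em(2) k(1) k(2)] by blast
  then show ?thesis using M_iso[OF em(3,4) _ em(2)] em(5) by simp
qed

lemma M_Id: "X \<in> Ob C \<Longrightarrow> Id C X \<in> MM C"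
proof (rule M_orthogonal[OF id_in_Hom])
  fix e A B u v
  assume "u \<in> Hom C A X" "v \<in> Hom C B X" "Id C X \<cdot> u = v \<cdot> e"
  then show "\<exists>d\<in>Hom C B X. d \<cdot> e = u" using comp_id_left[of u A X] by auto
qed

lemma M_comp:
  assumes m: "m \<in> MM C" "m \<in> Hom C X Y" and n: "n \<in> MM C" "n \<in> Hom C Y Z"
  shows "n \<cdot> m \<in> MM C"
proof (rule M_orthogonal[OF comp_Hom[OF n(2) m(2)]])
  fix e A B u v
  assume e: "e \<in> EE C" "e \<in> Hom C A B" and u: "u \<in> Hom C A X" and v: "v \<in> Hom C B Z"
    and c: "(n \<cdot> m) \<cdot> u = v \<cdot> e"
  have "n \<cdot> (m \<cdot> u) = v \<cdot> e" using c comp_assoc[OF u m(2) n(2)] by simp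
  then obtain d where d: "d \<in> Hom C B Y" "d \<cdot> e = m \<cdot> u"
    using diagonal[OF e n comp_Hom[OF m(2) u] v] by blast
  obtain d' where "d' \<in> Hom C B X" "d' \<cdot> e = u"
    using diagonal[OF e m u d(1)] d(2) by metis
  then show "\<exists>d\<in>Hom C B X. d \<cdot> e = u" by blast
qed

lemma M_pullback:
  assumes pb: "is_pullback C f n m h" and f: "f \<in> Hom C X Y" and n: "n \<in> MM C"
  shows "m \<in> MM C"
proof -
  note P = pullback_Hom[OF pb f]
  show ?thesis
  proof (rule M_orthogonal[OF P(2)])
    fix e A B u v
    assume e: "e \<in> EE C" "e \<in> Hom C A B" and u: "u \<in> Hom C A (Dom C m)" and v: "v \<in> Hom C B X"
      and c: "m \<cdot> u = v \<cdot> e"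
    have "n \<cdot> (h \<cdot> u) = (f \<cdot> v) \<cdot> e"
      using comp_assoc[OF u P(3) P(1)] comp_assoc[OF u P(2) f] comp_assoc[OF e(2) v f] P(4) c by simp
    then obtain d where d: "d \<in> Hom C B (Dom C n)" "d \<cdot> e = h \<cdot> u" "n \<cdot> d = f \<cdot> v"
      using diagonal[OF e n P(1) comp_Hom[OF P(3) u] comp_Hom[OF f v]] by metis
    obtain w where w: "w \<in> Hom C B (Dom C m)" "m \<cdot> w = v" "h \<cdot> w = d"
      using pullbackE[OF pb f v d(1) d(3)[symmetric]] by metis
    have "m \<cdot> (w \<cdot> e) = m \<cdot> u" using comp_assoc[OF e(2) w(1) P(2)] w(2) c by simp
    moreover have "h \<cdot> (w \<cdot> e) = h \<cdot> u" using comp_assoc[OF e(2) w(1) P(3)] w(3) d(2) by simp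
    ultimately have "w \<cdot> e = u" using pullback_eq[OF pb comp_Hom[OF w(1) e(2)] u] by blast
    then show "\<exists>d\<in>Hom C B (Dom C m). d \<cdot> e = u" using w(1) by blast
  qed
qed

section \<open>Admissible subobjects\<close>

abbreviation subs :: "'o \<Rightarrow> 'a set set" where
  "subs X \<equiv> carrier (Sub C X)"

lemma subs_iff: "A \<in> subs X \<longleftrightarrow> (\<exists>m\<in>MM C. Cod C m = X \<and> A = sub_class C m)"
  unfolding Sub_def by auto

lemma sub_class_iff:
  assumes m: "m \<in> Hom C X Y"
  shows "n \<in> sub_class C m \<longleftrightarrow> n \<in> MM C \<and> n \<in> Hom C (Dom C n) Y \<and>
    (\<exists>i\<in>Hom C (Dom C n) X. is_iso C i \<and> n = m \<cdot> i)"
  using HomD[OF m] M_Hom[of n] unfolding sub_class_def Hom_def by auto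

lemma sub_class_self:
  assumes "m \<in> MM C"
  shows "m \<in> sub_class C m"
proof -
  note m = M_Hom[OF assms]
  have X: "Dom C m \<in> Ob C" using Hom_Ob[OF m] by simp
  show ?thesis using assms m is_iso_Id[OF X] id_in_Hom[OF X] comp_id_right[OF m]
    unfolding sub_class_iff[OF m] by (metis)
qed

lemma sub_class_eqI:
  assumes m: "m \<in> MM C" and n: "n \<in> sub_class C m"
  shows "sub_class C n = sub_class C m"
proof -
  note mh = M_Hom[OF m]
  obtain i where nM: "n \<in> MM C" "n \<in> Hom C (Dom C n) (Cod C m)"
    and i: "i \<in> Hom C (Dom C n) (Dom C m)" "is_iso C i" "n = m \<cdot> i"
    using n unfolding sub_class_iff[OF mh] by blast
  obtain j where j: "j \<in> Hom C (Dom C m) (Dom C n)" "j \<cdot> i = Id C (Dom C n)" "i \<cdot> j = Id C (Dom C m)"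
    "is_iso C j"
    by (rule is_isoE[OF i(2,1)])
  have mn: "m = n \<cdot> j"
    using comp_assoc[OF j(1) i(1) mh] i(3) j(3) comp_id_right[OF mh] by simp
  show ?thesis
  proof (rule Set.set_eqI)
    fix k
    show "k \<in> sub_class C n \<longleftrightarrow> k \<in> sub_class C m"
      unfolding sub_class_iff[OF mh] sub_class_iff[OF nM(2)]
    proof (intro conj_cong refl iffI)
      assume "\<exists>l\<in>Hom C (Dom C k) (Dom C n). is_iso C l \<and> k = n \<cdot> l"
      then obtain l where l: "l \<in> Hom C (Dom C k) (Dom C n)" "is_iso C l" "k = n \<cdot> l" by blast
      have "k = m \<cdot> (i \<cdot> l)" using comp_assoc[OF l(1) i(1) mh] l(3) i(3) by simp
      then show "\<exists>l\<in>Hom C (Dom C k) (Dom C m). is_iso C l \<and> k = m \<cdot> l"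
        using comp_Hom[OF i(1) l(1)] is_iso_comp[OF l(2,1) i(2,1)] by blast
    next
      assume "\<exists>l\<in>Hom C (Dom C k) (Dom C m). is_iso C l \<and> k = m \<cdot> l"
      then obtain l where l: "l \<in> Hom C (Dom C k) (Dom C m)" "is_iso C l" "k = m \<cdot> l" by blast
      have "k = n \<cdot> (j \<cdot> l)" using comp_assoc[OF l(1) j(1) nM(2)] l(3) mn by simp
      then show "\<exists>l\<in>Hom C (Dom C k) (Dom C n). is_iso C l \<and> k = n \<cdot> l"
        using comp_Hom[OF j(1) l(1)] is_iso_comp[OF l(2,1) j(4,1)] by blast
    qed
  qed
qed

lemma subs_memD:
  assumes "A \<in> subs X" "m \<in> A"
  shows "m \<in> MM C" "m \<in> Hom C (Dom C m) X" "A = sub_class C m"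
proof -
  obtain n where n: "n \<in> MM C" "Cod C n = X" "A = sub_class C n" using assms(1) subs_iff by auto
  note nh = M_Hom[OF n(1)]
  show "m \<in> MM C" "m \<in> Hom C (Dom C m) X"
    using assms(2) n(2) unfolding n(3) sub_class_iff[OF nh] by auto
  show "A = sub_class C m" using sub_class_eqI[OF n(1)] assms(2) n(3) by simp
qed

lemma sub_class_subs: "\<lbrakk>m \<in> MM C; m \<in> Hom C Y X\<rbrakk> \<Longrightarrow> sub_class C m \<in> subs X"
  unfolding subs_iff Hom_def by auto

lemma subsE:
  assumes "A \<in> subs X"
  obtains m where "m \<in> A" "m \<in> MM C" "m \<in> Hom C (Dom C m) X" "A = sub_class C m" "X \<in> Ob C"
proof -
  obtain n where n: "n \<in> MM C" "Cod C n = X" "A = sub_class C n" using assms subs_iff by auto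
  have nA: "n \<in> A" using sub_class_self[OF n(1)] n(3) by simp
  have nh: "n \<in> Hom C (Dom C n) X" using subs_memD(2)[OF assms nA] .
  show thesis using that[OF nA n(1) nh n(3)] Hom_Ob[OF nh] by blast
qed

lemma subs_Ob: "A \<in> subs X \<Longrightarrow> X \<in> Ob C"
  by (erule subsE)

lemma factors_iff:
  assumes A: "A \<in> subs X" and n: "n \<in> A"
  shows "factors C k A \<longleftrightarrow> (\<exists>h\<in>Hom C (Dom C k) (Dom C n). k = n \<cdot> h)"
proof
  assume "factors C k A"
  then obtain n' h where n': "n' \<in> A" and h: "h \<in> Hom C (Dom C k) (Dom C n')" "k = n' \<cdot> h"
    unfolding factors_def by blast
  note N = subs_memD[OF A n]
  have "n' \<in> sub_class C n" using n' N(3) by simp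
  then obtain i where i: "i \<in> Hom C (Dom C n') (Dom C n)" "n' = n \<cdot> i"
    unfolding sub_class_iff[OF N(2)] by blast
  have "k = n \<cdot> (i \<cdot> h)" using comp_assoc[OF h(1) i(1) N(2)] i(2) h(2) by simp
  then show "\<exists>h\<in>Hom C (Dom C k) (Dom C n). k = n \<cdot> h" using comp_Hom[OF i(1) h(1)] by blast
qed (use n in \<open>auto simp: factors_def\<close>)

lemma factors_comp:
  assumes A: "A \<in> subs X" and k: "k \<in> Hom C W X" and x: "x \<in> Hom C V W" and f: "factors C k A"
  shows "factors C (k \<cdot> x) A"
proof -
  obtain n where n: "n \<in> A" "n \<in> Hom C (Dom C n) X" using subsE[OF A] .
  obtain h where h: "h \<in> Hom C W (Dom C n)" "k = n \<cdot> h"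
    using f HomD[OF k] unfolding factors_iff[OF A n(1)] by auto
  have "k \<cdot> x = n \<cdot> (h \<cdot> x)" using comp_assoc[OF x h(1) n(2)] h(2) by simp
  moreover have "Dom C (k \<cdot> x) = V" using HomD[OF comp_Hom[OF k x]] by simp
  ultimately show ?thesis unfolding factors_iff[OF A n(1)] using comp_Hom[OF h(1) x] by auto
qed

lemma factors_self:
  assumes A: "A \<in> subs X" and n: "n \<in> A"
  shows "factors C n A"
proof -
  note N = subs_memD[OF A n]
  show ?thesis unfolding factors_iff[OF A n]
    by (rule bexI[of _ "Id C (Dom C n)"]) (simp_all add: comp_id_right[OF N(2)] id_in_Hom Hom_Ob[OF N(2)])
qed

lemma le_iff_factors:
  assumes A: "A \<in> subs X" and B: "B \<in> subs X" and m: "m \<in> A"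
  shows "A \<sqsubseteq>\<^bsub>Sub C X\<^esub> B \<longleftrightarrow> factors C m B"
proof
  assume "A \<sqsubseteq>\<^bsub>Sub C X\<^esub> B"
  then obtain m' n h where m': "m' \<in> A" and n: "n \<in> B" and h: "h \<in> Hom C (Dom C m') (Dom C n)" "m' = n \<cdot> h"
    unfolding Sub_def by auto
  note M' = subs_memD[OF A m']
  have f: "factors C m' B" using n h unfolding factors_def by blast
  have "m \<in> sub_class C m'" using m M'(3) by simp
  then obtain i where i: "i \<in> Hom C (Dom C m) (Dom C m')" "m = m' \<cdot> i"
    unfolding sub_class_iff[OF M'(2)] by blast
  show "factors C m B" using factors_comp[OF B M'(2) i(1) f] i(2) by simp
next
  assume "factors C m B"
  then show "A \<sqsubseteq>\<^bsub>Sub C X\<^esub> B" using m unfolding Sub_def factors_def by auto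
qed

lemma sub_refl:
  assumes A: "A \<in> subs X"
  shows "A \<sqsubseteq>\<^bsub>Sub C X\<^esub> A"
proof -
  obtain m where m: "m \<in> A" using subsE[OF A] .
  show ?thesis using le_iff_factors[OF A A m] factors_self[OF A m] by simp
qed

lemma factors_le:
  assumes A: "A \<in> subs X" and B: "B \<in> subs X" and le: "A \<sqsubseteq>\<^bsub>Sub C X\<^esub> B" and f: "factors C k A"
  shows "factors C k B"
proof -
  obtain n where n: "n \<in> A" "n \<in> Hom C (Dom C n) X" using subsE[OF A] .
  obtain h where h: "h \<in> Hom C (Dom C k) (Dom C n)" "k = n \<cdot> h"
    using f unfolding factors_iff[OF A n(1)] by auto
  have "factors C n B" using le le_iff_factors[OF A B n(1)] by simp
  then show ?thesis using factors_comp[OF B n(2) h(1)] h(2) by simp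
qed

lemma sub_trans:
  assumes "A \<in> subs X" "B \<in> subs X" "D \<in> subs X" "A \<sqsubseteq>\<^bsub>Sub C X\<^esub> B" "B \<sqsubseteq>\<^bsub>Sub C X\<^esub> D"
  shows "A \<sqsubseteq>\<^bsub>Sub C X\<^esub> D"
proof -
  obtain m where m: "m \<in> A" using subsE[OF assms(1)] .
  show ?thesis
    using le_iff_factors[OF assms(1,2) m] le_iff_factors[OF assms(1,3) m] factors_le[OF assms(2,3,5)]
      assms(4) by blast
qed

lemma sub_lattice: "A \<in> subs X \<Longrightarrow> complete_lattice (Sub C X)"
  using Sub_complete_lattice subs_Ob by blast

lemma Sub_eq [simp]: "A .=\<^bsub>Sub C X\<^esub> B \<longleftrightarrow> A = B"
  unfolding Sub_def by simp

lemma sub_antisym: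
  assumes "A \<in> subs X" "B \<in> subs X" "A \<sqsubseteq>\<^bsub>Sub C X\<^esub> B" "B \<sqsubseteq>\<^bsub>Sub C X\<^esub> A"
  shows "A = B"
proof -
  interpret L: complete_lattice "Sub C X" using sub_lattice[OF assms(1)] .
  show ?thesis using L.le_antisym assms by blast
qed

text \<open>Generalized elements determine a subobject, because each contains its own
  representatives.\<close>

lemma sub_eqI:
  assumes A: "A \<in> subs X" and B: "B \<in> subs X"
    and "\<And>W k. k \<in> Hom C W X \<Longrightarrow> factors C k A \<longleftrightarrow> factors C k B"
  shows "A = B"
proof (rule sub_antisym[OF A B])
  obtain m where m: "m \<in> A" "m \<in> Hom C (Dom C m) X" using subsE[OF A] .
  obtain n where n: "n \<in> B" "n \<in> Hom C (Dom C n) X" using subsE[OF B] .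
  show "A \<sqsubseteq>\<^bsub>Sub C X\<^esub> B"
    using le_iff_factors[OF A B m(1)] assms(3)[OF m(2)] factors_self[OF A m(1)] by simp
  show "B \<sqsubseteq>\<^bsub>Sub C X\<^esub> A"
    using le_iff_factors[OF B A n(1)] assms(3)[OF n(2)] factors_self[OF B n(1)] by simp
qed

lemma sub_meet:
  assumes A: "A \<in> subs X" and B: "B \<in> subs X"
  shows "A \<sqinter>\<^bsub>Sub C X\<^esub> B \<in> subs X" "A \<sqinter>\<^bsub>Sub C X\<^esub> B \<sqsubseteq>\<^bsub>Sub C X\<^esub> A"
    "A \<sqinter>\<^bsub>Sub C X\<^esub> B \<sqsubseteq>\<^bsub>Sub C X\<^esub> B"
proof -
  interpret L: complete_lattice "Sub C X" using sub_lattice[OF A] .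
  show "A \<sqinter>\<^bsub>Sub C X\<^esub> B \<in> subs X" "A \<sqinter>\<^bsub>Sub C X\<^esub> B \<sqsubseteq>\<^bsub>Sub C X\<^esub> A"
    "A \<sqinter>\<^bsub>Sub C X\<^esub> B \<sqsubseteq>\<^bsub>Sub C X\<^esub> B"
    using L.meet_closed L.meet_left L.meet_right A B by blast+
qed

lemma sub_meet_greatest:
  assumes A: "A \<in> subs X" and B: "B \<in> subs X" and D: "D \<in> subs X"
    and "D \<sqsubseteq>\<^bsub>Sub C X\<^esub> A" "D \<sqsubseteq>\<^bsub>Sub C X\<^esub> B"
  shows "D \<sqsubseteq>\<^bsub>Sub C X\<^esub> A \<sqinter>\<^bsub>Sub C X\<^esub> B"
proof -
  interpret L: complete_lattice "Sub C X" using sub_lattice[OF A] .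
  show ?thesis using L.meet_le assms by blast
qed

lemma sub_meet_mono:
  assumes "A \<in> subs X" "B \<in> subs X" "A' \<in> subs X" "B' \<in> subs X"
    "A \<sqsubseteq>\<^bsub>Sub C X\<^esub> A'" "B \<sqsubseteq>\<^bsub>Sub C X\<^esub> B'"
  shows "A \<sqinter>\<^bsub>Sub C X\<^esub> B \<sqsubseteq>\<^bsub>Sub C X\<^esub> A' \<sqinter>\<^bsub>Sub C X\<^esub> B'"
  using sub_meet_greatest sub_meet sub_trans assms by meson

text \<open>The diagonal filler between the \<open>EE\<close>-part of the arrow from an initial object and any
  subobject makes \<open>bot_sub\<close> least; being least, it is a single equivalence class.\<close>

lemma bot_sub_rep:
  assumes X: "X \<in> Ob C"
  obtains m where "m \<in> MM C" "m \<in> Hom C (Dom C m) X" "bot_sub C X = sub_class C m"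
    "\<forall>A\<in>subs X. factors C m A"
proof -
  obtain I where I: "is_initial C I" using initial_exists ..
  have *: "factors C n A" if n: "n \<in> MM C" "n \<in> Hom C (Dom C n) X"
      and e: "e \<in> EE C" "is_initial C (Dom C e)" "e \<in> Hom C (Dom C e) (Dom C n)" and A: "A \<in> subs X" for n e A
  proof -
    obtain a where a: "a \<in> A" "a \<in> MM C" "a \<in> Hom C (Dom C a) X" using subsE[OF A] .
    have "Dom C a \<in> Ob C" using Hom_Ob[OF a(3)] by simp
    then obtain u where u: "u \<in> Hom C (Dom C e) (Dom C a)" using e(2) unfolding is_initial_def by blast
    have "a \<cdot> u = n \<cdot> e"
      using comp_Hom[OF a(3) u] comp_Hom[OF n(2) e(3)] e(2) X unfolding is_initial_def by blast
    then obtain d where "d \<in> Hom C (Dom C n) (Dom C a)" "a \<cdot> d = n"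
      using diagonal[OF e(1,3) a(2,3) u n(2)] by blast
    then show ?thesis unfolding factors_iff[OF A a(1)] by auto
  qed
  obtain f where "f \<in> Hom C I X" using I X unfolding is_initial_def by blast
  then obtain e m Z where em: "e \<in> EE C" "e \<in> Hom C I Z" "m \<in> MM C" "m \<in> Hom C Z X" "f = m \<cdot> e"
    by (rule factorize)
  have Z: "Z = Dom C m" and De: "I = Dom C e" using HomD[OF em(4)] HomD[OF em(2)] by auto
  have mb: "m \<in> Hom C (Dom C m) X" "e \<in> Hom C (Dom C e) (Dom C m)" "is_initial C (Dom C e)"
    using em Z De I by simp_all
  have mS: "sub_class C m \<in> subs X" using sub_class_subs[OF em(3,4)] .
  have mm: "m \<in> sub_class C m" using sub_class_self[OF em(3)] .
  have "n \<in> bot_sub C X \<longleftrightarrow> n \<in> sub_class C m" for n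
  proof
    assume "n \<in> bot_sub C X"
    then obtain e' where n: "n \<in> MM C" "Cod C n = X"
      and e': "e' \<in> EE C" "is_initial C (Dom C e')" "Cod C e' = Dom C n"
      unfolding bot_sub_def by blast
    have nh: "n \<in> Hom C (Dom C n) X" using M_Hom[OF n(1)] n(2) by simp
    have eh: "e' \<in> Hom C (Dom C e') (Dom C n)" using E_Hom[OF e'(1)] e'(3) by simp
    have nS: "sub_class C n \<in> subs X" using sub_class_subs[OF n(1) nh] .
    have nn: "n \<in> sub_class C n" using sub_class_self[OF n(1)] .
    have "sub_class C n \<sqsubseteq>\<^bsub>Sub C X\<^esub> sub_class C m"
      using le_iff_factors[OF nS mS nn] *[OF n(1) nh e'(1,2) eh mS] by simp
    moreover have "sub_class C m \<sqsubseteq>\<^bsub>Sub C X\<^esub> sub_class C n"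
      using le_iff_factors[OF mS nS mm] *[OF em(3) mb(1) em(1) mb(3,2) nS] by simp
    ultimately show "n \<in> sub_class C m" using sub_antisym[OF nS mS] nn by simp
  next
    assume "n \<in> sub_class C m"
    then obtain i where n: "n \<in> MM C" "n \<in> Hom C (Dom C n) X"
      and i: "i \<in> Hom C (Dom C n) (Dom C m)" "is_iso C i" "n = m \<cdot> i"
      unfolding sub_class_iff[OF mb(1)] by blast
    obtain j where j: "j \<in> Hom C (Dom C m) (Dom C n)" "is_iso C j" by (rule is_isoE[OF i(2,1)])
    have "j \<cdot> e \<in> EE C" using E_iso[OF em(1) mb(2) j(2,1)] .
    moreover have "j \<cdot> e \<in> Hom C (Dom C e) (Dom C n)" using comp_Hom[OF j(1) mb(2)] .
    moreover from this have "Dom C (j \<cdot> e) = Dom C e" "Cod C (j \<cdot> e) = Dom C n"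
      using HomD by fast+
    ultimately show "n \<in> bot_sub C X"
      using n(1) mb(3) HomD[OF n(2)]
      unfolding bot_sub_def by (auto intro: bexI[of _ "j \<cdot> e"])
  qed
  then have "bot_sub C X = sub_class C m" by blast
  then show thesis using that[OF em(3) mb(1)] *[OF em(3) mb(1) em(1) mb(3,2)] by blast
qed

lemma bot_subs:
  assumes X: "X \<in> Ob C"
  shows "bot_sub C X \<in> subs X"
proof -
  obtain m where m: "m \<in> MM C" "m \<in> Hom C (Dom C m) X" "bot_sub C X = sub_class C m"
    using bot_sub_rep[OF X] .
  show ?thesis using sub_class_subs[OF m(1,2)] m(3) by simp
qed

lemma bot_least:
  assumes A: "A \<in> subs X"
  shows "bot_sub C X \<sqsubseteq>\<^bsub>Sub C X\<^esub> A"
proof -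
  have X: "X \<in> Ob C" using subs_Ob[OF A] .
  obtain m where m: "m \<in> MM C" "m \<in> Hom C (Dom C m) X" "bot_sub C X = sub_class C m" "\<forall>A\<in>subs X. factors C m A"
    using bot_sub_rep[OF X] .
  have "m \<in> bot_sub C X" using sub_class_self[OF m(1)] m(3) by simp
  then show ?thesis using le_iff_factors[OF bot_subs[OF X] A] m(4) A by simp
qed

lemma bot_unique: "\<lbrakk>A \<in> subs X; A \<sqsubseteq>\<^bsub>Sub C X\<^esub> bot_sub C X\<rbrakk> \<Longrightarrow> A = bot_sub C X"
  using sub_antisym[OF _ bot_subs[OF subs_Ob]] bot_least by blast

section \<open>Inverse and direct images\<close>

text \<open>The universal property of the pullback identifies the generalized elements of the inverse
  image, and these determine the class.\<close>

lemma preimage_rep: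
  assumes f: "f \<in> Hom C X Y" and B: "B \<in> subs Y" and n: "n \<in> B" and pb: "is_pullback C f n m h"
  shows "sub_preimage C f B = sub_class C m" "m \<in> MM C" "m \<in> Hom C (Dom C m) X"
    "\<And>W k. k \<in> Hom C W X \<Longrightarrow> factors C k (sub_preimage C f B) \<longleftrightarrow> factors C (f \<cdot> k) B"
proof -
  have main: "m \<in> MM C \<and> m \<in> Hom C (Dom C m) X \<and>
      (\<forall>W k. k \<in> Hom C W X \<longrightarrow> factors C k (sub_class C m) \<longleftrightarrow> factors C (f \<cdot> k) B)"
    if n: "n \<in> B" and pb: "is_pullback C f n m h" for n m h
  proof -
    note N = subs_memD[OF B n] and P = pullback_Hom[OF pb f]
    have mM: "m \<in> MM C" using M_pullback[OF pb f N(1)] .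
    have mS: "sub_class C m \<in> subs X" using sub_class_subs[OF mM P(2)] .
    have mm: "m \<in> sub_class C m" using sub_class_self[OF mM] .
    have "factors C k (sub_class C m) \<longleftrightarrow> factors C (f \<cdot> k) B" if k: "k \<in> Hom C W X" for W k
    proof
      assume "factors C k (sub_class C m)"
      then obtain l where l: "l \<in> Hom C W (Dom C m)" "k = m \<cdot> l"
        unfolding factors_iff[OF mS mm] using HomD[OF k] by auto
      have "f \<cdot> k = n \<cdot> (h \<cdot> l)"
        using comp_assoc[OF l(1) P(2) f] comp_assoc[OF l(1) P(3) P(1)] l(2) P(4) by simp
      then show "factors C (f \<cdot> k) B"
        unfolding factors_iff[OF B n] using comp_Hom[OF P(3) l(1)] HomD[OF comp_Hom[OF f k]] by auto
    next
      assume "factors C (f \<cdot> k) B"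
      then obtain y where y: "y \<in> Hom C W (Dom C n)" "f \<cdot> k = n \<cdot> y"
        unfolding factors_iff[OF B n] using HomD[OF comp_Hom[OF f k]] by auto
      obtain l where l: "l \<in> Hom C W (Dom C m)" "m \<cdot> l = k"
        using pullbackE[OF pb f k y] .
      then show "factors C k (sub_class C m)"
        unfolding factors_iff[OF mS mm] using HomD[OF k] by auto
    qed
    then show ?thesis using mM P(2) by blast
  qed
  note m = main[OF n pb]
  then have mM: "m \<in> MM C" and mh: "m \<in> Hom C (Dom C m) X" by auto
  have mS: "sub_class C m \<in> subs X" using sub_class_subs[OF mM mh] .
  have "k \<in> sub_preimage C f B \<longleftrightarrow> k \<in> sub_class C m" for k
  proof
    assume "k \<in> sub_preimage C f B"
    then obtain n' h' where n': "n' \<in> B" "is_pullback C f n' k h'" unfolding sub_preimage_def by blast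
    note k = main[OF n']
    then have kM: "k \<in> MM C" and kh: "k \<in> Hom C (Dom C k) X" by auto
    have kS: "sub_class C k \<in> subs X" using sub_class_subs[OF kM kh] .
    have "sub_class C k = sub_class C m" by (rule sub_eqI[OF kS mS]) (use k m in blast)
    then show "k \<in> sub_class C m" using sub_class_self[OF kM] by simp
  next
    assume "k \<in> sub_class C m"
    then obtain i where k: "k \<in> MM C" "k \<in> Hom C (Dom C k) X"
      and i: "i \<in> Hom C (Dom C k) (Dom C m)" "is_iso C i" "k = m \<cdot> i"
      unfolding sub_class_iff[OF mh] by blast
    obtain j where j: "j \<in> Hom C (Dom C m) (Dom C k)" "j \<cdot> i = Id C (Dom C k)" "i \<cdot> j = Id C (Dom C m)"
      "is_iso C j" by (rule is_isoE[OF i(2,1)])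
    note N = subs_memD[OF B n] and P = pullback_Hom[OF pb f]
    have "is_pullback C f n k (h \<cdot> i)"
    proof (rule pullbackI[OF f P(1) k(2) comp_Hom[OF P(3) i(1)]])
      show "f \<cdot> k = n \<cdot> (h \<cdot> i)"
        using comp_assoc[OF i(1) P(2) f] comp_assoc[OF i(1) P(3) P(1)] i(3) P(4) by simp
    next
      fix W x y assume x: "x \<in> Hom C W X" and y: "y \<in> Hom C W (Dom C n)" and e: "f \<cdot> x = n \<cdot> y"
      obtain l where l: "l \<in> Hom C W (Dom C m)" "m \<cdot> l = x" "h \<cdot> l = y"
        using pullbackE[OF pb f x y e] .
      have il: "i \<cdot> (j \<cdot> l) = l" using comp_assoc[OF l(1) j(1) i(1)] j(3) comp_id_left[OF l(1)] by simp
      have jl: "j \<cdot> l \<in> Hom C W (Dom C k)" using comp_Hom[OF j(1) l(1)] .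
      have "k \<cdot> (j \<cdot> l) = x" using comp_assoc[OF jl i(1) mh] i(3) il l(2) by simp
      moreover have "(h \<cdot> i) \<cdot> (j \<cdot> l) = y" using comp_assoc[OF jl i(1) P(3)] il l(3) by simp
      ultimately show "\<exists>l\<in>Hom C W (Dom C k). k \<cdot> l = x \<and> (h \<cdot> i) \<cdot> l = y" using jl by blast
    next
      fix W a b assume "a \<in> Hom C W (Dom C k)" "b \<in> Hom C W (Dom C k)" "k \<cdot> a = k \<cdot> b"
      then show "a = b" using monoD[OF M_mono[OF k(1)] k(2)] by blast
    qed
    then show "k \<in> sub_preimage C f B" unfolding sub_preimage_def using k(1) n by blast
  qed
  then have eq: "sub_preimage C f B = sub_class C m" by blast
  show "sub_preimage C f B = sub_class C m" "m \<in> MM C" "m \<in> Hom C (Dom C m) X" by fact+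
  show "factors C k (sub_preimage C f B) \<longleftrightarrow> factors C (f \<cdot> k) B" if "k \<in> Hom C W X" for W k
    using m that unfolding eq by blast
qed

lemma preimage_subs:
  assumes f: "f \<in> Hom C X Y" and B: "B \<in> subs Y"
  shows "sub_preimage C f B \<in> subs X"
proof -
  obtain n where n: "n \<in> B" "n \<in> Hom C (Dom C n) Y" using subsE[OF B] .
  obtain m h where pb: "is_pullback C f n m h" using pullback_exists[OF f n(2)] by blast
  note P = preimage_rep[OF f B n(1) pb]
  show ?thesis using sub_class_subs[OF P(2,3)] P(1) by simp
qed

lemma factors_preimage:
  assumes f: "f \<in> Hom C X Y" and B: "B \<in> subs Y" and k: "k \<in> Hom C W X"
  shows "factors C k (sub_preimage C f B) \<longleftrightarrow> factors C (f \<cdot> k) B"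
proof -
  obtain n where n: "n \<in> B" "n \<in> Hom C (Dom C n) Y" using subsE[OF B] .
  obtain m h where pb: "is_pullback C f n m h" using pullback_exists[OF f n(2)] by blast
  show ?thesis using preimage_rep(4)[OF f B n(1) pb k] .
qed

lemma preimage_mono:
  assumes f: "f \<in> Hom C X Y" and "A \<in> subs Y" "B \<in> subs Y" "A \<sqsubseteq>\<^bsub>Sub C Y\<^esub> B"
  shows "sub_preimage C f A \<sqsubseteq>\<^bsub>Sub C X\<^esub> sub_preimage C f B"
proof -
  note S = preimage_subs[OF f assms(2)] preimage_subs[OF f assms(3)]
  obtain m where m: "m \<in> sub_preimage C f A" "m \<in> Hom C (Dom C m) X" using subsE[OF S(1)] .
  show ?thesis
    using le_iff_factors[OF S m(1)] factors_self[OF S(1) m(1)] factors_le[OF assms(2-4)]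
      factors_preimage[OF f assms(2) m(2)] factors_preimage[OF f assms(3) m(2)] by blast
qed

lemma preimage_comp:
  assumes f: "f \<in> Hom C X Y" and g: "g \<in> Hom C Y Z" and B: "B \<in> subs Z"
  shows "sub_preimage C (g \<cdot> f) B = sub_preimage C f (sub_preimage C g B)"
proof (rule sub_eqI)
  note gB = preimage_subs[OF g B] and gf = comp_Hom[OF g f]
  show "sub_preimage C (g \<cdot> f) B \<in> subs X" using preimage_subs[OF gf B] .
  show "sub_preimage C f (sub_preimage C g B) \<in> subs X" using preimage_subs[OF f gB] .
  show "factors C k (sub_preimage C (g \<cdot> f) B) \<longleftrightarrow> factors C k (sub_preimage C f (sub_preimage C g B))"
    if k: "k \<in> Hom C W X" for W k
    unfolding factors_preimage[OF gf B k] factors_preimage[OF f gB k]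
      factors_preimage[OF g B comp_Hom[OF f k]] comp_assoc[OF k f g] by simp
qed

lemma preimage_Id:
  assumes B: "B \<in> subs X"
  shows "sub_preimage C (Id C X) B = B"
proof (rule sub_eqI[OF preimage_subs[OF id_in_Hom[OF subs_Ob[OF B]] B] B])
  show "factors C k (sub_preimage C (Id C X) B) \<longleftrightarrow> factors C k B" if k: "k \<in> Hom C W X" for W k
    unfolding factors_preimage[OF id_in_Hom[OF subs_Ob[OF B]] B k] comp_id_left[OF k] by simp
qed

text \<open>The diagonal filler turns a factorization of \<open>f \<cdot> m\<close> through \<open>B\<close> into one of its
  \<open>MM\<close>-part. So direct image is left adjoint to inverse image; functoriality of direct images
  and the preservation of \<open>\<sigma>\<close> by direct and of meets by inverse images follow formally.\<close>

lemma image_rep: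
  assumes f: "f \<in> Hom C X Y" and A: "A \<in> subs X" and m: "m \<in> A"
    and e: "e \<in> EE C" "e \<in> Hom C (Dom C m) Z" and n: "n \<in> MM C" "n \<in> Hom C Z Y" and fm: "f \<cdot> m = n \<cdot> e"
  shows "sub_image C f A = sub_class C n"
    "\<And>B. B \<in> subs Y \<Longrightarrow> sub_image C f A \<sqsubseteq>\<^bsub>Sub C Y\<^esub> B \<longleftrightarrow> A \<sqsubseteq>\<^bsub>Sub C X\<^esub> sub_preimage C f B"
proof -
  have main: "sub_class C n \<sqsubseteq>\<^bsub>Sub C Y\<^esub> B \<longleftrightarrow> A \<sqsubseteq>\<^bsub>Sub C X\<^esub> sub_preimage C f B"
    if m: "m \<in> A" and e: "e \<in> EE C" "e \<in> Hom C (Dom C m) (Dom C n)"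
      and n: "n \<in> MM C" "n \<in> Hom C (Dom C n) Y" and fm: "f \<cdot> m = n \<cdot> e" and B: "B \<in> subs Y" for m e n B
  proof -
    note M = subs_memD[OF A m]
    have nS: "sub_class C n \<in> subs Y" using sub_class_subs[OF n] .
    have 1: "sub_class C n \<sqsubseteq>\<^bsub>Sub C Y\<^esub> B \<longleftrightarrow> factors C n B"
      using le_iff_factors[OF nS B sub_class_self[OF n(1)]] .
    have 2: "A \<sqsubseteq>\<^bsub>Sub C X\<^esub> sub_preimage C f B \<longleftrightarrow> factors C (f \<cdot> m) B"
      using le_iff_factors[OF A preimage_subs[OF f B] m] factors_preimage[OF f B M(2)] by simp
    obtain b where b: "b \<in> B" "b \<in> MM C" "b \<in> Hom C (Dom C b) Y" using subsE[OF B] .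
    have "factors C n B" if fB: "factors C (f \<cdot> m) B"
    proof -
      obtain h where h: "h \<in> Hom C (Dom C m) (Dom C b)" "f \<cdot> m = b \<cdot> h"
        using fB HomD[OF comp_Hom[OF f M(2)]] unfolding factors_iff[OF B b(1)] by auto
      obtain d where "d \<in> Hom C (Dom C n) (Dom C b)" "b \<cdot> d = n"
        using diagonal[OF e b(2,3) h(1) n(2)] h(2) fm by metis
      then show ?thesis unfolding factors_iff[OF B b(1)] by auto
    qed
    moreover have "factors C (f \<cdot> m) B" if "factors C n B"
      using factors_comp[OF B n(2) e(2) that] fm by simp
    ultimately show ?thesis using 1 2 by blast
  qed
  have Z: "Z = Dom C n" using HomD[OF n(2)] by simp
  have e': "e \<in> Hom C (Dom C m) (Dom C n)" and n': "n \<in> Hom C (Dom C n) Y" using e(2) n(2) Z by simp_all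
  have nS: "sub_class C n \<in> subs Y" using sub_class_subs[OF n] .
  have fY: "Cod C f = Y" using HomD[OF f] by simp
  have "k \<in> sub_image C f A \<longleftrightarrow> k \<in> sub_class C n" for k
  proof
    assume "k \<in> sub_image C f A"
    then obtain m' c where k: "k \<in> MM C" "Cod C k = Y" and m': "m' \<in> A"
      and c: "c \<in> EE C" "c \<in> Hom C (Dom C m') (Dom C k)" "f \<cdot> m' = k \<cdot> c"
      unfolding sub_image_def fY by blast
    have kh: "k \<in> Hom C (Dom C k) Y" using M_Hom[OF k(1)] k(2) by simp
    have kS: "sub_class C k \<in> subs Y" using sub_class_subs[OF k(1) kh] .
    have *: "sub_class C k \<sqsubseteq>\<^bsub>Sub C Y\<^esub> B \<longleftrightarrow> sub_class C n \<sqsubseteq>\<^bsub>Sub C Y\<^esub> B" if "B \<in> subs Y" for B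
      using main[OF m' c(1,2) k(1) kh c(3) that] main[OF m e(1) e' n(1) n' fm that] by simp
    have "sub_class C k = sub_class C n"
      using sub_antisym[OF kS nS] *[OF kS] *[OF nS] sub_refl[OF kS] sub_refl[OF nS] by simp
    then show "k \<in> sub_class C n" using sub_class_self[OF k(1)] by simp
  next
    assume "k \<in> sub_class C n"
    then obtain i where k: "k \<in> MM C" "k \<in> Hom C (Dom C k) Y"
      and i: "i \<in> Hom C (Dom C k) (Dom C n)" "is_iso C i" "k = n \<cdot> i"
      unfolding sub_class_iff[OF n'] by blast
    obtain j where j: "j \<in> Hom C (Dom C n) (Dom C k)" "j \<cdot> i = Id C (Dom C k)" "i \<cdot> j = Id C (Dom C n)"
      "is_iso C j" by (rule is_isoE[OF i(2,1)])
    have je: "j \<cdot> e \<in> EE C" "j \<cdot> e \<in> Hom C (Dom C m) (Dom C k)"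
      using E_iso[OF e(1) e' j(4,1)] comp_Hom[OF j(1) e'] by auto
    have "i \<cdot> (j \<cdot> e) = e" using comp_assoc[OF e' j(1) i(1)] j(3) comp_id_left[OF e'] by simp
    then have "f \<cdot> m = k \<cdot> (j \<cdot> e)" using comp_assoc[OF je(2) i(1) n'] i(3) fm by simp
    then show "k \<in> sub_image C f A"
      unfolding sub_image_def fY using k(1) HomD[OF k(2)] m je by blast
  qed
  then have eq: "sub_image C f A = sub_class C n" by blast
  then show "sub_image C f A = sub_class C n" .
  show "sub_image C f A \<sqsubseteq>\<^bsub>Sub C Y\<^esub> B \<longleftrightarrow> A \<sqsubseteq>\<^bsub>Sub C X\<^esub> sub_preimage C f B" if "B \<in> subs Y" for B
    unfolding eq using main[OF m e(1) e' n(1) n' fm that] .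
qed

lemma image_factorization:
  assumes f: "f \<in> Hom C X Y" and A: "A \<in> subs X"
  obtains m e n Z where "m \<in> A" "e \<in> EE C" "e \<in> Hom C (Dom C m) Z" "n \<in> MM C" "n \<in> Hom C Z Y"
    "f \<cdot> m = n \<cdot> e"
proof -
  obtain m where m: "m \<in> A" "m \<in> Hom C (Dom C m) X" using subsE[OF A] .
  show thesis using factorize[OF comp_Hom[OF f m(2)]] that[OF m(1)] by metis
qed

lemma image_subs:
  assumes f: "f \<in> Hom C X Y" and A: "A \<in> subs X"
  shows "sub_image C f A \<in> subs Y"
proof -
  obtain m e n Z where r: "m \<in> A" "e \<in> EE C" "e \<in> Hom C (Dom C m) Z" "n \<in> MM C" "n \<in> Hom C Z Y"
    "f \<cdot> m = n \<cdot> e" using image_factorization[OF f A] .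
  show ?thesis using image_rep(1)[OF f A r] sub_class_subs[OF r(4,5)] by simp
qed

lemma image_le_iff:
  assumes f: "f \<in> Hom C X Y" and A: "A \<in> subs X" and B: "B \<in> subs Y"
  shows "sub_image C f A \<sqsubseteq>\<^bsub>Sub C Y\<^esub> B \<longleftrightarrow> A \<sqsubseteq>\<^bsub>Sub C X\<^esub> sub_preimage C f B"
proof -
  obtain m e n Z where r: "m \<in> A" "e \<in> EE C" "e \<in> Hom C (Dom C m) Z" "n \<in> MM C" "n \<in> Hom C Z Y"
    "f \<cdot> m = n \<cdot> e" using image_factorization[OF f A] .
  show ?thesis using image_rep(2)[OF f A r B] .
qed

lemma image_unit: "\<lbrakk>f \<in> Hom C X Y; A \<in> subs X\<rbrakk> \<Longrightarrow> A \<sqsubseteq>\<^bsub>Sub C X\<^esub> sub_preimage C f (sub_image C f A)"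
  using image_le_iff[of f X Y A "sub_image C f A"] image_subs[of f X Y A] sub_refl[of "sub_image C f A" Y]
  by blast

lemma image_counit: "\<lbrakk>f \<in> Hom C X Y; B \<in> subs Y\<rbrakk> \<Longrightarrow> sub_image C f (sub_preimage C f B) \<sqsubseteq>\<^bsub>Sub C Y\<^esub> B"
  using image_le_iff[of f X Y "sub_preimage C f B" B] preimage_subs[of f X Y B]
    sub_refl[of "sub_preimage C f B" X] by blast

lemma image_eqI:
  assumes f: "f \<in> Hom C X Y" and A: "A \<in> subs X" and D: "D \<in> subs Y"
    and *: "\<And>B. B \<in> subs Y \<Longrightarrow> D \<sqsubseteq>\<^bsub>Sub C Y\<^esub> B \<longleftrightarrow> A \<sqsubseteq>\<^bsub>Sub C X\<^esub> sub_preimage C f B"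
  shows "sub_image C f A = D"
proof (rule sub_antisym[OF image_subs[OF f A] D])
  show "sub_image C f A \<sqsubseteq>\<^bsub>Sub C Y\<^esub> D" using image_le_iff[OF f A D] *[OF D] sub_refl[OF D] by simp
  show "D \<sqsubseteq>\<^bsub>Sub C Y\<^esub> sub_image C f A"
    using *[OF image_subs[OF f A]] image_unit[OF f A] by simp
qed

lemma image_mono:
  assumes f: "f \<in> Hom C X Y" and A: "A \<in> subs X" and B: "B \<in> subs X" and "A \<sqsubseteq>\<^bsub>Sub C X\<^esub> B"
  shows "sub_image C f A \<sqsubseteq>\<^bsub>Sub C Y\<^esub> sub_image C f B"
  using image_le_iff[OF f A image_subs[OF f B]] image_unit[OF f B] assms(4)
    sub_trans[OF A B preimage_subs[OF f image_subs[OF f B]]] by blast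

lemma image_comp:
  assumes f: "f \<in> Hom C X Y" and g: "g \<in> Hom C Y Z" and A: "A \<in> subs X"
  shows "sub_image C (g \<cdot> f) A = sub_image C g (sub_image C f A)"
proof (rule image_eqI[OF comp_Hom[OF g f] A image_subs[OF g image_subs[OF f A]]])
  show "sub_image C g (sub_image C f A) \<sqsubseteq>\<^bsub>Sub C Z\<^esub> B \<longleftrightarrow> A \<sqsubseteq>\<^bsub>Sub C X\<^esub> sub_preimage C (g \<cdot> f) B"
    if B: "B \<in> subs Z" for B
    using image_le_iff[OF g image_subs[OF f A] B] image_le_iff[OF f A preimage_subs[OF g B]]
      preimage_comp[OF f g B] by simp
qed

lemma image_bot:
  assumes f: "f \<in> Hom C X Y"
  shows "sub_image C f (bot_sub C X) = bot_sub C Y"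
proof -
  have X: "X \<in> Ob C" and Y: "Y \<in> Ob C" using Hom_Ob[OF f] by auto
  note bX = bot_subs[OF X] and bY = bot_subs[OF Y]
  show ?thesis
    using bot_unique[OF image_subs[OF f bX]] image_le_iff[OF f bX bY] bot_least[OF preimage_subs[OF f bY]]
    by simp
qed

lemma preimage_meet:
  assumes f: "f \<in> Hom C X Y" and A: "A \<in> subs Y" and B: "B \<in> subs Y"
  shows "sub_preimage C f (A \<sqinter>\<^bsub>Sub C Y\<^esub> B) =
    sub_preimage C f A \<sqinter>\<^bsub>Sub C X\<^esub> sub_preimage C f B" (is "?l = ?r")
proof (rule sub_antisym)
  note fA = preimage_subs[OF f A] and fB = preimage_subs[OF f B]
  note M = sub_meet[OF A B] and M' = sub_meet[OF fA fB]
  show l: "?l \<in> subs X" using preimage_subs[OF f M(1)] .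
  show r: "?r \<in> subs X" using M'(1) .
  show "?l \<sqsubseteq>\<^bsub>Sub C X\<^esub> ?r"
    using sub_meet_greatest[OF fA fB l] preimage_mono[OF f M(1) A M(2)] preimage_mono[OF f M(1) B M(3)]
    by blast
  have "sub_image C f ?r \<sqsubseteq>\<^bsub>Sub C Y\<^esub> A \<sqinter>\<^bsub>Sub C Y\<^esub> B"
    using sub_meet_greatest[OF A B image_subs[OF f r]] image_le_iff[OF f r A] image_le_iff[OF f r B] M'
    by blast
  then show "?r \<sqsubseteq>\<^bsub>Sub C X\<^esub> ?l" using image_le_iff[OF f r M(1)] by simp
qed


text \<open>Relates the composites in the definition of the subspace system to direct images.\<close>

lemma image_M:
  assumes m: "m \<in> MM C" "m \<in> Hom C X Y" and A: "A \<in> subs X"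
  shows "sub_image C m A = (\<lambda>k. m \<cdot> k) ` A"
proof -
  obtain a where a: "a \<in> A" "a \<in> MM C" "a \<in> Hom C (Dom C a) X" "A = sub_class C a" using subsE[OF A] .
  have D: "Dom C a \<in> Ob C" using Hom_Ob[OF a(3)] by simp
  have maM: "m \<cdot> a \<in> MM C" using M_comp[OF a(2,3) m] .
  have mah: "m \<cdot> a \<in> Hom C (Dom C a) Y" using comp_Hom[OF m(2) a(3)] .
  have maS: "sub_class C (m \<cdot> a) \<in> subs Y" using sub_class_subs[OF maM mah] .
  have 1: "sub_image C m A = sub_class C (m \<cdot> a)"
  proof (rule image_eqI[OF m(2) A maS])
    show "sub_class C (m \<cdot> a) \<sqsubseteq>\<^bsub>Sub C Y\<^esub> B \<longleftrightarrow> A \<sqsubseteq>\<^bsub>Sub C X\<^esub> sub_preimage C m B" if B: "B \<in> subs Y" for B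
      using le_iff_factors[OF maS B sub_class_self[OF maM]]
        le_iff_factors[OF A preimage_subs[OF m(2) B] a(1)] factors_preimage[OF m(2) B a(3)] by simp
  qed
  have "n \<in> sub_class C (m \<cdot> a) \<longleftrightarrow> n \<in> (\<lambda>k. m \<cdot> k) ` sub_class C a" for n
  proof
    assume "n \<in> sub_class C (m \<cdot> a)"
    then obtain i where i: "i \<in> Hom C (Dom C n) (Dom C a)" "is_iso C i" "n = (m \<cdot> a) \<cdot> i"
      unfolding sub_class_iff[OF mah] by blast
    have ai: "a \<cdot> i \<in> Hom C (Dom C n) X" using comp_Hom[OF a(3) i(1)] .
    have "a \<cdot> i \<in> sub_class C a"
      unfolding sub_class_iff[OF a(3)] using M_iso[OF a(2,3) i(2,1)] HomD[OF ai] ai i by auto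
    moreover have "n = m \<cdot> (a \<cdot> i)" using comp_assoc[OF i(1) a(3) m(2)] i(3) by simp
    ultimately show "n \<in> (\<lambda>k. m \<cdot> k) ` sub_class C a" by blast
  next
    assume "n \<in> (\<lambda>k. m \<cdot> k) ` sub_class C a"
    then obtain k where k: "k \<in> sub_class C a" "n = m \<cdot> k" by blast
    then obtain i where i: "i \<in> Hom C (Dom C k) (Dom C a)" "is_iso C i" "k = a \<cdot> i"
      unfolding sub_class_iff[OF a(3)] by blast
    have n: "n = (m \<cdot> a) \<cdot> i" using comp_assoc[OF i(1) a(3) m(2)] i(3) k(2) by simp
    have nh: "n \<in> Hom C (Dom C k) Y" using comp_Hom[OF mah i(1)] n by simp
    show "n \<in> sub_class C (m \<cdot> a)"
      unfolding sub_class_iff[OF mah] using M_iso[OF maM mah i(2,1)] HomD[OF nh] nh i n by auto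
  qed
  then have "sub_class C (m \<cdot> a) = (\<lambda>k. m \<cdot> k) ` sub_class C a" by blast
  then show ?thesis using 1 a(4) by simp
qed

lemma preimage_image_M:
  assumes m: "m \<in> MM C" "m \<in> Hom C X Y" and A: "A \<in> subs X"
  shows "sub_preimage C m (sub_image C m A) = A"
proof (rule sub_antisym)
  note i = image_subs[OF m(2) A]
  note p = preimage_subs[OF m(2) i]
  show "sub_preimage C m (sub_image C m A) \<in> subs X" using p .
  show "A \<in> subs X" using A .
  show "A \<sqsubseteq>\<^bsub>Sub C X\<^esub> sub_preimage C m (sub_image C m A)" using image_unit[OF m(2) A] .
  obtain k where k: "k \<in> sub_preimage C m (sub_image C m A)" "k \<in> Hom C (Dom C k) X" using subsE[OF p] .
  have "factors C (m \<cdot> k) (sub_image C m A)"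
    using factors_self[OF p k(1)] factors_preimage[OF m(2) i k(2)] by simp
  moreover obtain a where a: "a \<in> A" "a \<in> Hom C (Dom C a) X" using subsE[OF A] .
  moreover have "m \<cdot> a \<in> sub_image C m A" using image_M[OF m A] a(1) by simp
  ultimately obtain h where h: "h \<in> Hom C (Dom C k) (Dom C a)" "m \<cdot> k = (m \<cdot> a) \<cdot> h"
    using factors_iff[OF i] HomD[OF comp_Hom[OF m(2) k(2)]] HomD[OF comp_Hom[OF m(2) a(2)]] by metis
  have "m \<cdot> k = m \<cdot> (a \<cdot> h)" using h comp_assoc[OF h(1) a(2) m(2)] by simp
  then have "k = a \<cdot> h" using monoD[OF M_mono[OF m(1)] m(2) k(2) comp_Hom[OF a(2) h(1)]] by simp
  then have "factors C k A" unfolding factors_iff[OF A a(1)] using h(1) by auto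
  then show "sub_preimage C m (sub_image C m A) \<sqsubseteq>\<^bsub>Sub C X\<^esub> A" using le_iff_factors[OF p A k(1)] by simp
qed

lemma image_preimage_M:
  assumes m: "m \<in> MM C" "m \<in> Hom C X Y" and A: "A \<in> subs Y" and le: "A \<sqsubseteq>\<^bsub>Sub C Y\<^esub> sub_class C m"
  shows "sub_image C m (sub_preimage C m A) = A"
proof (rule sub_antisym)
  note p = preimage_subs[OF m(2) A]
  note i = image_subs[OF m(2) p]
  have mS: "sub_class C m \<in> subs Y" using sub_class_subs[OF m] .
  show "sub_image C m (sub_preimage C m A) \<in> subs Y" using i .
  show "A \<in> subs Y" using A .
  show "sub_image C m (sub_preimage C m A) \<sqsubseteq>\<^bsub>Sub C Y\<^esub> A" using image_counit[OF m(2) A] .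
  obtain a where a: "a \<in> A" "a \<in> Hom C (Dom C a) Y" using subsE[OF A] .
  have "factors C a (sub_class C m)" using le le_iff_factors[OF A mS a(1)] by simp
  then obtain h where h: "h \<in> Hom C (Dom C a) X" "a = m \<cdot> h"
    using factors_iff[OF mS sub_class_self[OF m(1)]] HomD[OF m(2)] by auto
  have "factors C h (sub_preimage C m A)"
    using factors_preimage[OF m(2) A h(1)] factors_self[OF A a(1)] h(2) by simp
  then have "factors C h (sub_preimage C m (sub_image C m (sub_preimage C m A)))"
    using factors_le[OF p preimage_subs[OF m(2) i] image_unit[OF m(2) p]] by simp
  then have "factors C a (sub_image C m (sub_preimage C m A))"
    using factors_preimage[OF m(2) i h(1)] h(2) by simp
  then show "A \<sqsubseteq>\<^bsub>Sub C Y\<^esub> sub_image C m (sub_preimage C m A)" using le_iff_factors[OF A i a(1)] by simp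
qed

section \<open>Preneighbourhood systems\<close>

lemma Fil_iff:
  assumes X: "X \<in> Ob C"
  shows "F \<in> Fil C X \<longleftrightarrow> F \<subseteq> subs X \<and> F \<noteq> {} \<and>
    (\<forall>p\<in>F. \<forall>q\<in>subs X. p \<sqsubseteq>\<^bsub>Sub C X\<^esub> q \<longrightarrow> q \<in> F) \<and> (\<forall>p\<in>F. \<forall>q\<in>F. p \<sqinter>\<^bsub>Sub C X\<^esub> q \<in> F)"
    (is "_ \<longleftrightarrow> ?r")
proof
  interpret L: complete_lattice "Sub C X" using Sub_complete_lattice[OF X] .
  assume F: "F \<in> Fil C X"
  then have inf: "\<Sqinter>\<^bsub>Sub C X\<^esub> S \<in> F" if "finite S" "S \<subseteq> F" for S
    using that unfolding Fil_def by blast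
  have "F \<noteq> {}" using inf[of "{}"] by auto
  moreover have "p \<sqinter>\<^bsub>Sub C X\<^esub> q \<in> F" if "p \<in> F" "q \<in> F" for p q
    using inf[of "{p, q}"] that unfolding meet_def by simp
  ultimately show ?r using F unfolding Fil_def by blast
next
  interpret L: complete_lattice "Sub C X" using Sub_complete_lattice[OF X] .
  assume F: ?r
  have "\<Sqinter>\<^bsub>Sub C X\<^esub> S \<in> F" if "finite S" "S \<subseteq> F" for S
    using that
  proof (induction S)
    case empty
    obtain p where p: "p \<in> F" using F by blast
    have "\<Sqinter>\<^bsub>Sub C X\<^esub> {} \<in> subs X" by (rule L.inf_closed) simp
    moreover have "p \<sqsubseteq>\<^bsub>Sub C X\<^esub> \<Sqinter>\<^bsub>Sub C X\<^esub> {}" using L.inf_greatest[of "{}" p] F p by blast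
    ultimately show ?case using F p by blast
  next
    case (insert x S)
    have S: "S \<subseteq> subs X" and x: "x \<in> subs X" and xS: "insert x S \<subseteq> subs X" using insert.prems F by auto
    let ?i = "\<Sqinter>\<^bsub>Sub C X\<^esub> S" and ?j = "\<Sqinter>\<^bsub>Sub C X\<^esub> (insert x S)"
    have i: "?i \<in> subs X" and j: "?j \<in> subs X" using L.inf_closed[OF S] L.inf_closed[OF xS] by auto
    note M = sub_meet[OF x i]
    have "x \<sqinter>\<^bsub>Sub C X\<^esub> ?i \<sqsubseteq>\<^bsub>Sub C X\<^esub> ?j"
    proof (rule L.inf_greatest[OF xS M(1)])
      fix z assume "z \<in> insert x S"
      then show "x \<sqinter>\<^bsub>Sub C X\<^esub> ?i \<sqsubseteq>\<^bsub>Sub C X\<^esub> z"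
        using M sub_trans[OF M(1) i _ M(3)] L.inf_lower[OF S] S by auto
    qed
    moreover have "x \<sqinter>\<^bsub>Sub C X\<^esub> ?i \<in> F" using F insert by blast
    ultimately show ?case using F j by blast
  qed
  then show "F \<in> Fil C X" using F unfolding Fil_def by blast
qed

lemma pnbd_systemI:
  assumes X: "X \<in> Ob C" and "\<mu> \<in> extensional (subs X)"
    and "\<And>m p. \<lbrakk>m \<in> subs X; p \<in> \<mu> m\<rbrakk> \<Longrightarrow> p \<in> subs X \<and> m \<sqsubseteq>\<^bsub>Sub C X\<^esub> p"
    and "\<And>m. m \<in> subs X \<Longrightarrow> \<mu> m \<noteq> {}"
    and "\<And>m p q. \<lbrakk>m \<in> subs X; p \<in> \<mu> m; q \<in> subs X; p \<sqsubseteq>\<^bsub>Sub C X\<^esub> q\<rbrakk> \<Longrightarrow> q \<in> \<mu> m"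
    and "\<And>m p q. \<lbrakk>m \<in> subs X; p \<in> \<mu> m; q \<in> \<mu> m\<rbrakk> \<Longrightarrow> p \<sqinter>\<^bsub>Sub C X\<^esub> q \<in> \<mu> m"
    and "\<And>m n. \<lbrakk>m \<in> subs X; n \<in> subs X; m \<sqsubseteq>\<^bsub>Sub C X\<^esub> n\<rbrakk> \<Longrightarrow> \<mu> n \<subseteq> \<mu> m"
    and "\<And>p. p \<in> subs X \<Longrightarrow> p \<in> \<mu> (bot_sub C X)"
  shows "pnbd_system C X \<mu>"
proof -
  have "\<mu> m \<in> Fil C X" if m: "m \<in> subs X" for m
    unfolding Fil_iff[OF X]
    using assms(3)[OF m] assms(4)[OF m] assms(5)[OF m] assms(6)[OF m] by blast
  then have "\<mu> \<in> subs X \<rightarrow>\<^sub>E Fil C X" using assms(2) by (simp add: PiE_def)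
  moreover have "\<mu> (bot_sub C X) = subs X" using assms(3)[OF bot_subs[OF X]] assms(8) by blast
  ultimately show ?thesis unfolding pnbd_system_def using assms(3,7) by blast
qed

context
  fixes X \<mu> assumes \<mu>: "pnbd_system C X \<mu>"
begin

lemma pnbd_anti: "\<lbrakk>m \<in> subs X; n \<in> subs X; m \<sqsubseteq>\<^bsub>Sub C X\<^esub> n\<rbrakk> \<Longrightarrow> \<mu> n \<subseteq> \<mu> m"
  using \<mu> unfolding pnbd_system_def by blast

lemma pnbd_bot: "\<mu> (bot_sub C X) = subs X"
  using \<mu> unfolding pnbd_system_def by blast

lemma pnbd_le: "\<lbrakk>m \<in> subs X; p \<in> \<mu> m\<rbrakk> \<Longrightarrow> m \<sqsubseteq>\<^bsub>Sub C X\<^esub> p"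
  using \<mu> unfolding pnbd_system_def by blast

lemma pnbd_Fil: "m \<in> subs X \<Longrightarrow> \<mu> m \<in> Fil C X"
  using \<mu> unfolding pnbd_system_def by blast

lemma pnbd_filter:
  assumes m: "m \<in> subs X"
  shows "\<mu> m \<subseteq> subs X \<and> \<mu> m \<noteq> {} \<and>
    (\<forall>p\<in>\<mu> m. \<forall>q\<in>subs X. p \<sqsubseteq>\<^bsub>Sub C X\<^esub> q \<longrightarrow> q \<in> \<mu> m) \<and>
    (\<forall>p\<in>\<mu> m. \<forall>q\<in>\<mu> m. p \<sqinter>\<^bsub>Sub C X\<^esub> q \<in> \<mu> m)"
  using pnbd_Fil[OF m] Fil_iff[OF subs_Ob[OF m], of "\<mu> m"] by simp

lemma pnbd_subs: "\<lbrakk>m \<in> subs X; p \<in> \<mu> m\<rbrakk> \<Longrightarrow> p \<in> subs X"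
  using pnbd_filter[of m] by blast

lemma pnbd_nonempty: "m \<in> subs X \<Longrightarrow> \<mu> m \<noteq> {}"
  using pnbd_filter[of m] by blast

lemma pnbd_up: "\<lbrakk>m \<in> subs X; p \<in> \<mu> m; q \<in> subs X; p \<sqsubseteq>\<^bsub>Sub C X\<^esub> q\<rbrakk> \<Longrightarrow> q \<in> \<mu> m"
  using pnbd_filter[of m] by blast

lemma pnbd_meet: "\<lbrakk>m \<in> subs X; p \<in> \<mu> m; q \<in> \<mu> m\<rbrakk> \<Longrightarrow> p \<sqinter>\<^bsub>Sub C X\<^esub> q \<in> \<mu> m"
  using pnbd_filter[of m] by blast

end

text \<open>The largest system, hence the one for which every arrow out of the space is a
  preneighbourhood morphism.\<close>

definition discrete :: "'o \<Rightarrow> 'a set \<Rightarrow> 'a set set" where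
  "discrete X = (\<lambda>m\<in>subs X. {p \<in> subs X. m \<sqsubseteq>\<^bsub>Sub C X\<^esub> p})"

lemma discrete_system:
  assumes X: "X \<in> Ob C"
  shows "pnbd_system C X (discrete X)"
proof (rule pnbd_systemI[OF X])
  show "discrete X \<in> extensional (subs X)" unfolding discrete_def by simp
qed (auto simp: discrete_def bot_subs[OF X] bot_least sub_meet sub_refl
  intro: sub_trans sub_meet_greatest)

lemma discrete_morphism:
  assumes "f \<in> Hom C X Y" "pnbd_system C Y \<phi>"
  shows "pnbd_morphism C (X, discrete X) (Y, \<phi>) f"
  unfolding pnbd_morphism_def
  using assms(1) preimage_subs[OF assms(1)] preimage_mono[OF assms(1)] pnbd_le[OF assms(2)]
    pnbd_subs[OF assms(2)]
  by (auto simp: discrete_def)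

lemma pspacesD: "S \<in> pspaces C \<Longrightarrow> fst S \<in> Ob C \<and> pnbd_system C (fst S) (snd S)"
  unfolding pspaces_def by auto

lemma pspacesI: "\<lbrakk>X \<in> Ob C; pnbd_system C X \<mu>\<rbrakk> \<Longrightarrow> (X, \<mu>) \<in> pspaces C"
  unfolding pspaces_def by simp

lemma morphism_Hom: "pnbd_morphism C S T f \<Longrightarrow> f \<in> Hom C (fst S) (fst T)"
  unfolding pnbd_morphism_def by blast

lemma morphismD:
  "\<lbrakk>pnbd_morphism C S T f; u \<in> subs (fst T); p \<in> snd T u\<rbrakk> \<Longrightarrow>
    sub_preimage C f p \<in> snd S (sub_preimage C f u)"
  unfolding pnbd_morphism_def by blast

lemma pspaces_subs: "\<lbrakk>S \<in> pspaces C; u \<in> subs (fst S); p \<in> snd S u\<rbrakk> \<Longrightarrow> p \<in> subs (fst S)"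
  using pnbd_subs[OF conjunct2[OF pspacesD[of S]]] .

lemma morphism_comp:
  assumes f: "pnbd_morphism C S T f" and g: "pnbd_morphism C T U g"
    and U: "\<And>u p. \<lbrakk>u \<in> subs (fst U); p \<in> snd U u\<rbrakk> \<Longrightarrow> p \<in> subs (fst U)"
  shows "pnbd_morphism C S U (g \<cdot> f)"
proof -
  note fh = morphism_Hom[OF f] and gh = morphism_Hom[OF g]
  have "sub_preimage C (g \<cdot> f) p \<in> snd S (sub_preimage C (g \<cdot> f) u)"
    if u: "u \<in> subs (fst U)" and p: "p \<in> snd U u" for u p
    unfolding preimage_comp[OF fh gh u] preimage_comp[OF fh gh U[OF u p]]
    using morphismD[OF f preimage_subs[OF gh u] morphismD[OF g u p]] .
  then show ?thesis unfolding pnbd_morphism_def using comp_Hom[OF gh fh] by blast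
qed

lemma morphism_finer:
  assumes "pnbd_morphism C (X, \<mu>) T f" "\<And>u. u \<in> subs X \<Longrightarrow> \<mu> u \<subseteq> \<mu>' u"
  shows "pnbd_morphism C (X, \<mu>') T f"
proof -
  have f: "f \<in> Hom C X (fst T)" using morphism_Hom[OF assms(1)] by simp
  show ?thesis
    using assms preimage_subs[OF f] unfolding pnbd_morphism_def by fastforce
qed

text \<open>The intersection of all systems that make the given arrows morphisms. The discrete
  one is among them, so the intersection still consists of preneighbourhoods.\<close>

lemma smallest_system_exists:
  assumes X: "X \<in> Ob C" and L: "\<forall>(h, S)\<in>L. S \<in> pspaces C \<and> h \<in> Hom C X (fst S)"
  shows "\<exists>\<pi>. smallest_system C X L \<pi>"
proof -
  define P where "P = (\<lambda>\<pi>. pnbd_system C X \<pi> \<and> (\<forall>(h, S)\<in>L. pnbd_morphism C (X, \<pi>) S h))"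
  define \<pi> where "\<pi> = (\<lambda>u\<in>subs X. {p \<in> subs X. \<forall>\<pi>'. P \<pi>' \<longrightarrow> p \<in> \<pi>' u})"
  have disc: "P (discrete X)"
    unfolding P_def using discrete_system[OF X] L discrete_morphism pspacesD by fastforce
  have sys: "pnbd_system C X \<pi>' " if "P \<pi>'" for \<pi>' using that unfolding P_def by blast
  have mem: "p \<in> \<pi> u \<longleftrightarrow> p \<in> subs X \<and> (\<forall>\<pi>'. P \<pi>' \<longrightarrow> p \<in> \<pi>' u)" if "u \<in> subs X" for u p
    using that unfolding \<pi>_def by simp
  have "pnbd_system C X \<pi>"
  proof (rule pnbd_systemI[OF X])
    show "\<pi> \<in> extensional (subs X)" unfolding \<pi>_def by simp
  next
    fix m p assume m: "m \<in> subs X" and p: "p \<in> \<pi> m"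
    show "p \<in> subs X \<and> m \<sqsubseteq>\<^bsub>Sub C X\<^esub> p"
      using p disc pnbd_le[OF sys[OF disc] m] unfolding mem[OF m] by blast
    show "q \<in> \<pi> m" if "q \<in> subs X" "p \<sqsubseteq>\<^bsub>Sub C X\<^esub> q" for q
      using p that pnbd_up[OF sys m] unfolding mem[OF m] by blast
    show "p \<sqinter>\<^bsub>Sub C X\<^esub> q \<in> \<pi> m" if q: "q \<in> \<pi> m" for q
      using p q pnbd_meet[OF sys m] sub_meet(1) unfolding mem[OF m] by blast
  next
    fix m assume m: "m \<in> subs X"
    interpret L: complete_lattice "Sub C X" using Sub_complete_lattice[OF X] .
    have "\<top>\<^bsub>Sub C X\<^esub> \<in> \<pi>' m" if "P \<pi>'" for \<pi>'
      using pnbd_nonempty[OF sys[OF that] m] pnbd_up[OF sys[OF that] m]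
        pnbd_subs[OF sys[OF that] m] L.top_closed L.top_higher by blast
    then show "\<pi> m \<noteq> {}" using mem[OF m] L.top_closed by blast
  next
    fix m n assume mn: "m \<in> subs X" "n \<in> subs X" "m \<sqsubseteq>\<^bsub>Sub C X\<^esub> n"
    show "\<pi> n \<subseteq> \<pi> m"
      using pnbd_anti[OF sys mn] unfolding subset_iff mem[OF mn(1)] mem[OF mn(2)] by blast
  next
    fix p assume "p \<in> subs X"
    then show "p \<in> \<pi> (bot_sub C X)" unfolding mem[OF bot_subs[OF X]] by (simp add: pnbd_bot[OF sys])
  qed
  moreover have "pnbd_morphism C (X, \<pi>) S h" if hS: "(h, S) \<in> L" for h S
  proof -
    have S: "S \<in> pspaces C" and h: "h \<in> Hom C X (fst S)" using L hS by auto
    have "sub_preimage C h p \<in> \<pi> (sub_preimage C h u)" if u: "u \<in> subs (fst S)" and p: "p \<in> snd S u" for u p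
    proof -
      have p': "p \<in> subs (fst S)" using pnbd_subs[OF conjunct2[OF pspacesD[OF S]] u p] .
      have "sub_preimage C h p \<in> \<pi>' (sub_preimage C h u)" if "P \<pi>'" for \<pi>'
        using that hS morphismD[of "(X, \<pi>')" S h u p] u p unfolding P_def by auto
      then show ?thesis unfolding mem[OF preimage_subs[OF h u]] using preimage_subs[OF h p'] by blast
    qed
    then show ?thesis unfolding pnbd_morphism_def using h by simp
  qed
  moreover have "\<pi> u \<subseteq> \<pi>' u" if "u \<in> subs X" "P \<pi>'" for u \<pi>' using that mem by blast
  ultimately have "smallest_system C X L \<pi>" unfolding smallest_system_def P_def by blast
  then show ?thesis by blast
qed

section \<open>Closed subobjects\<close>

text \<open>If \<open>k\<close> is not least, it belongs to the family whose join is its closure, so it is closed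
  iff it bounds that family, and only the members incomparable with \<open>k\<close> matter. If \<open>k\<close> is least,
  the family is empty.\<close>

lemma closed_subs_iff:
  assumes \<mu>: "pnbd_system C X \<mu>" and X: "X \<in> Ob C"
  shows "k \<in> closed_subs C (X, \<mu>) \<longleftrightarrow> k \<in> subs X \<and> (k = bot_sub C X \<or>
    (\<forall>x\<in>subs X. \<not> x \<sqsubseteq>\<^bsub>Sub C X\<^esub> k \<and> \<not> k \<sqsubseteq>\<^bsub>Sub C X\<^esub> x \<longrightarrow>
      (\<exists>u\<in>\<mu> x. u \<sqinter>\<^bsub>Sub C X\<^esub> k = bot_sub C X)))"
proof (cases "k \<in> subs X")
  case k: True
  interpret L: complete_lattice "Sub C X" using Sub_complete_lattice[OF X] .
  let ?far = "\<lambda>x. \<exists>u\<in>\<mu> x. u \<sqinter>\<^bsub>Sub C X\<^esub> k = bot_sub C X"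
  define Z where "Z = {x \<in> subs X. \<not> (k \<sqsubseteq>\<^bsub>Sub C X\<^esub> x \<and> k \<noteq> x) \<and> \<not> ?far x}"
  have Z: "Z \<subseteq> subs X" unfolding Z_def by blast
  have "pcl C (X, \<mu>) k = \<Squnion>\<^bsub>Sub C X\<^esub> Z"
    unfolding pcl_def Far_def Z_def lless_def fst_conv snd_conv
    by (rule arg_cong[of _ _ "\<lambda>A. \<Squnion>\<^bsub>Sub C X\<^esub> A"]) auto
  then have closed: "k \<in> closed_subs C (X, \<mu>) \<longleftrightarrow> \<Squnion>\<^bsub>Sub C X\<^esub> Z = k"
    unfolding closed_subs_def using k by simp
  have sZ: "\<Squnion>\<^bsub>Sub C X\<^esub> Z \<in> subs X" using L.sup_closed[OF Z] .
  show ?thesis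
  proof (cases "k = bot_sub C X")
    case True
    have "?far x" if x: "x \<in> subs X" for x
    proof -
      obtain u where u: "u \<in> \<mu> x" using pnbd_nonempty[OF \<mu> x] by blast
      note M = sub_meet[OF pnbd_subs[OF \<mu> x u] k]
      have "u \<sqinter>\<^bsub>Sub C X\<^esub> k = bot_sub C X" using bot_unique[OF M(1)] M(3) True by simp
      then show ?thesis using u by blast
    qed
    then have "Z = {}" unfolding Z_def by blast
    then have "\<Squnion>\<^bsub>Sub C X\<^esub> Z \<sqsubseteq>\<^bsub>Sub C X\<^esub> k" using L.sup_least[OF Z k] by blast
    then have "\<Squnion>\<^bsub>Sub C X\<^esub> Z = k" using bot_unique[OF sZ] True by simp
    then show ?thesis using closed True k by simp
  next
    case False
    have "\<not> ?far k"
    proof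
      assume "?far k"
      then obtain u where u: "u \<in> \<mu> k" "u \<sqinter>\<^bsub>Sub C X\<^esub> k = bot_sub C X" by blast
      have "k \<sqsubseteq>\<^bsub>Sub C X\<^esub> u \<sqinter>\<^bsub>Sub C X\<^esub> k"
        using sub_meet_greatest[OF pnbd_subs[OF \<mu> k u(1)] k k pnbd_le[OF \<mu> k u(1)] sub_refl[OF k]] .
      then show False using bot_unique[OF k] u(2) False by simp
    qed
    then have kZ: "k \<in> Z" unfolding Z_def using k by blast
    have "\<Squnion>\<^bsub>Sub C X\<^esub> Z = k \<longleftrightarrow> (\<forall>x\<in>Z. x \<sqsubseteq>\<^bsub>Sub C X\<^esub> k)"
      using L.sup_upper[OF Z] L.sup_least[OF Z k] sub_antisym[OF sZ k] kZ by blast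
    moreover have "(\<forall>x\<in>Z. x \<sqsubseteq>\<^bsub>Sub C X\<^esub> k) \<longleftrightarrow>
        (\<forall>x\<in>subs X. \<not> x \<sqsubseteq>\<^bsub>Sub C X\<^esub> k \<and> \<not> k \<sqsubseteq>\<^bsub>Sub C X\<^esub> x \<longrightarrow> ?far x)"
      unfolding Z_def using sub_refl[OF k] by blast
    ultimately show ?thesis using closed False k by simp
  qed
qed (simp add: closed_subs_def)

text \<open>Only preneighbourhoods of subobjects incomparable with \<open>k\<close> enter the criterion for \<open>k\<close>
  to be closed; below \<open>k\<close> the two systems need not be related.\<close>

lemma closed_subs_finer_off:
  assumes \<mu>: "pnbd_system C X \<mu>" and \<mu>': "pnbd_system C X \<mu>'" and X: "X \<in> Ob C"
    and le: "\<And>x. \<lbrakk>x \<in> subs X; \<not> x \<sqsubseteq>\<^bsub>Sub C X\<^esub> k\<rbrakk> \<Longrightarrow> \<mu> x \<subseteq> \<mu>' x"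
    and k: "k \<in> closed_subs C (X, \<mu>)"
  shows "k \<in> closed_subs C (X, \<mu>')"
  using k le unfolding closed_subs_iff[OF \<mu> X] closed_subs_iff[OF \<mu>' X] by blast

lemma closed_subs_subs: "k \<in> closed_subs C (X, \<mu>) \<Longrightarrow> k \<in> subs X"
  unfolding closed_subs_def by simp

lemma smallest_systemD:
  assumes "smallest_system C X L \<pi>"
  shows "pnbd_system C X \<pi>" "\<And>h S. (h, S) \<in> L \<Longrightarrow> pnbd_morphism C (X, \<pi>) S h"
    "\<And>\<pi>' u. \<lbrakk>pnbd_system C X \<pi>'; \<And>h S. (h, S) \<in> L \<Longrightarrow> pnbd_morphism C (X, \<pi>') S h; u \<in> subs X\<rbrakk>
      \<Longrightarrow> \<pi> u \<subseteq> \<pi>' u"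
  using assms unfolding smallest_system_def by blast+

section \<open>Binary products and compactness\<close>

text \<open>The spaces along which the arrow \<open>S \<rightarrow> 1\<close> is pulled back to test compactness of \<open>S\<close>. Not
  every space is one: the arrow to \<open>1\<close> may fail to be a preneighbourhood morphism.\<close>

definition test_space :: "('o, 'a) pspace \<Rightarrow> bool" where
  "test_space U \<longleftrightarrow> U \<in> pspaces C \<and> pnbd_morphism C U (one_space C) (bang C (fst U))"

text \<open>A product of the underlying objects with the smallest system for its projections. It
  need not have the universal property of a product of preneighbourhood spaces.\<close>

definition product_space ::
  "('o, 'a) pspace \<Rightarrow> ('o, 'a) pspace \<Rightarrow> 'a \<Rightarrow> 'a \<Rightarrow> ('a set \<Rightarrow> 'a set set) \<Rightarrow> bool" where
  "product_space S U p q \<pi> \<longleftrightarrow> is_pullback C (bang C (fst S)) (bang C (fst U)) p q \<and>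
    smallest_system C (Dom C p) {(p, S), (q, U)} \<pi>"

lemma product_spaceD:
  assumes "product_space S U p q \<pi>" "S \<in> pspaces C" "U \<in> pspaces C"
  shows "p \<in> Hom C (Dom C p) (fst S)" "q \<in> Hom C (Dom C p) (fst U)"
    "(Dom C p, \<pi>) \<in> pspaces C"
    "pnbd_morphism C (Dom C p, \<pi>) S p" "pnbd_morphism C (Dom C p, \<pi>) U q"
    "\<And>\<pi>' u. \<lbrakk>pnbd_system C (Dom C p) \<pi>'; pnbd_morphism C (Dom C p, \<pi>') S p;
      pnbd_morphism C (Dom C p, \<pi>') U q; u \<in> subs (Dom C p)\<rbrakk> \<Longrightarrow> \<pi> u \<subseteq> \<pi>' u"
proof -
  have pb: "is_pullback C (bang C (fst S)) (bang C (fst U)) p q"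
    and sm: "smallest_system C (Dom C p) {(p, S), (q, U)} \<pi>"
    using assms(1) unfolding product_space_def by auto
  have X: "fst S \<in> Ob C" "fst U \<in> Ob C" using assms(2,3) pspacesD by blast+
  note P = product_Hom[OF pb X] and Q = smallest_systemD[OF sm]
  show "p \<in> Hom C (Dom C p) (fst S)" "q \<in> Hom C (Dom C p) (fst U)" "(Dom C p, \<pi>) \<in> pspaces C"
    using P pspacesI[OF P(3) Q(1)] by auto
  show "pnbd_morphism C (Dom C p, \<pi>) S p" "pnbd_morphism C (Dom C p, \<pi>) U q" using Q(2) by auto
  show "\<pi> u \<subseteq> \<pi>' u" if "pnbd_system C (Dom C p) \<pi>'" "pnbd_morphism C (Dom C p, \<pi>') S p"
      "pnbd_morphism C (Dom C p, \<pi>') U q" "u \<in> subs (Dom C p)" for \<pi>' u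
    by (rule Q(3)) (use that in auto)
qed

lemma product_space_exists:
  assumes "S \<in> pspaces C" "U \<in> pspaces C"
  obtains p q \<pi> where "product_space S U p q \<pi>"
proof -
  have X: "fst S \<in> Ob C" "fst U \<in> Ob C" using assms pspacesD by blast+
  obtain p q where pb: "is_pullback C (bang C (fst S)) (bang C (fst U)) p q"
    using product_exists[OF X] by blast
  note P = product_Hom[OF pb X]
  obtain \<pi> where "smallest_system C (Dom C p) {(p, S), (q, U)} \<pi>"
    using smallest_system_exists[OF P(3), of "{(p, S), (q, U)}"] P assms by auto
  then show thesis using that pb unfolding product_space_def by blast
qed

lemma compactD:
  assumes "compact_space C S" "test_space U" "product_space S U p q \<pi>"
    "k \<in> closed_subs C (Dom C p, \<pi>)"
  shows "sub_image C q k \<in> closed_subs C U"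
proof -
  have "fst (one_space C) = one C" unfolding one_space_def by simp
  have "stably C (closed_morphism C) S (one_space C) (bang C (fst S))"
    using assms(1) unfolding compact_space_def proper_morphism_def by blast
  moreover have "pnbd_pullback C S U (bang C (fst S)) (bang C (fst U)) (Dom C p, \<pi>) p q"
    using assms(3) unfolding pnbd_pullback_def product_space_def by simp
  ultimately have "closed_morphism C (Dom C p, \<pi>) U q"
    using assms(2) unfolding stably_def test_space_def by blast
  then show ?thesis using assms(4) unfolding closed_morphism_def by blast
qed

lemma compactI:
  assumes "S \<in> pspaces C"
    and "\<And>U p q \<pi> k. \<lbrakk>U \<in> pspaces C; test_space U; product_space S U p q \<pi>;
      k \<in> closed_subs C (Dom C p, \<pi>)\<rbrakk> \<Longrightarrow> sub_image C q k \<in> closed_subs C U"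
  shows "compact_space C S"
proof -
  have "closed_morphism C W U q"
    if U: "U \<in> pspaces C" and g: "pnbd_morphism C U (one_space C) g"
      and pb: "pnbd_pullback C S U (bang C (fst S)) g W p q" for U g W p q
  proof -
    have "g = bang C (fst U)" using bang_eq morphism_Hom[OF g] unfolding one_space_def by simp
    moreover have "W = (Dom C p, snd W)" using pb unfolding pnbd_pullback_def by (cases W) simp
    ultimately have "test_space U" "product_space S U p q (snd W)" "W = (Dom C p, snd W)"
      using U g pb unfolding test_space_def product_space_def pnbd_pullback_def by auto
    then show ?thesis using assms(2)[OF U] unfolding closed_morphism_def by metis
  qed
  then show ?thesis using assms(1) unfolding compact_space_def proper_morphism_def stably_def by blast
qed

lemma compact_pspaces: "compact_space C S \<Longrightarrow> S \<in> pspaces C"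
  unfolding compact_space_def by blast

lemma one_space_subs:
  assumes "p \<in> snd (one_space C) u" "u \<in> subs (fst (one_space C))"
  shows "p \<in> subs (fst (one_space C))"
proof -
  have "one C \<in> Ob C" using one_terminal unfolding is_terminal_def by blast
  then have "sub_class C (Id C (one C)) \<in> subs (one C)" using sub_class_subs[OF M_Id id_in_Hom] by blast
  then show ?thesis using assms unfolding one_space_def by (auto split: if_splits)
qed

lemma test_space_source:
  assumes W: "W \<in> pspaces C" and q: "pnbd_morphism C W U q" and U: "test_space U"
  shows "test_space W"
proof -
  have U': "pnbd_morphism C U (one_space C) (bang C (fst U))" using U unfolding test_space_def by blast
  have m: "pnbd_morphism C W (one_space C) (bang C (fst U) \<cdot> q)"
    by (rule morphism_comp[OF q U']) (rule one_space_subs)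
  have "bang C (fst U) \<cdot> q = bang C (fst W)"
    using bang_eq morphism_Hom[OF m] unfolding one_space_def by simp
  then show ?thesis using m W unfolding test_space_def by simp
qed

lemma stably_closed_image:
  assumes "proper_morphism C S T f" "U \<in> pspaces C" "pnbd_morphism C U T g" "is_pullback C f g p q"
    "smallest_system C (Dom C p) {(p, S), (q, U)} \<pi>" "k \<in> closed_subs C (Dom C p, \<pi>)"
  shows "sub_image C q k \<in> closed_subs C U"
  using assms unfolding proper_morphism_def stably_def pnbd_pullback_def closed_morphism_def by fastforce

lemma product_map:
  assumes S: "S \<in> pspaces C" and T: "T \<in> pspaces C" and U: "U \<in> pspaces C"
    and W: "product_space S U p q \<pi>" and V: "product_space T U p' q' \<nu>" and f: "f \<in> Hom C (fst S) (fst T)"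
  obtains h where "h \<in> Hom C (Dom C p) (Dom C p')" "p' \<cdot> h = f \<cdot> p" "q' \<cdot> h = q" "is_pullback C f p' p h"
proof -
  note P = product_spaceD[OF W S U] and P' = product_spaceD[OF V T U]
  have Y: "fst T \<in> Ob C" and Z: "fst U \<in> Ob C" using T U pspacesD by blast+
  have 1: "is_pullback C (bang C (fst S)) (bang C (fst U)) p q"
    and 2: "is_pullback C (bang C (fst T)) (bang C (fst U)) p' q'"
    using W V unfolding product_space_def by auto
  obtain h where h: "h \<in> Hom C (Dom C p) (Dom C p')" "p' \<cdot> h = f \<cdot> p" "q' \<cdot> h = q"
    using productE[OF 2 Y Z comp_Hom[OF f P(1)] P(2)] .
  show thesis using that[OF h product_pullback[OF 1 2 f Z h]] .
qed

section \<open>Proper morphisms reflect compactness\<close>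

text \<open>The pullback of \<open>f\<close> along \<open>p' : T \<times> U \<rightarrow> T\<close> carries a system \<open>\<pi>'\<close> that may be strictly
  finer than the product system \<open>\<pi>\<close>. Closed subobjects for \<open>\<pi>\<close> are closed for \<open>\<pi>'\<close>, which is
  the direction needed here.\<close>

lemma compact_of_proper:
  assumes S: "S \<in> pspaces C" and T: "compact_space C T" and f: "pnbd_morphism C S T f"
    and pf: "proper_morphism C S T f"
  shows "compact_space C S"
proof (rule compactI[OF S])
  fix U p q \<pi> k
  assume U: "U \<in> pspaces C" and tU: "test_space U" and W: "product_space S U p q \<pi>"
    and k: "k \<in> closed_subs C (Dom C p, \<pi>)"
  note T' = compact_pspaces[OF T]
  obtain p' q' \<nu> where V: "product_space T U p' q' \<nu>" using product_space_exists[OF T' U] .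
  note P = product_spaceD[OF W S U] and P' = product_spaceD[OF V T' U]
  obtain h where h: "h \<in> Hom C (Dom C p) (Dom C p')" "p' \<cdot> h = f \<cdot> p" "q' \<cdot> h = q"
    and pb: "is_pullback C f p' p h"
    using product_map[OF S T' U W V morphism_Hom[OF f]] .
  have X: "Dom C p \<in> Ob C" using Hom_Ob[OF P(1)] by blast
  have "\<forall>(l, R)\<in>{(p, S), (h, (Dom C p', \<nu>))}. R \<in> pspaces C \<and> l \<in> Hom C (Dom C p) (fst R)"
    using S P(1) P'(3) h(1) by simp
  then obtain \<pi>' where \<pi>': "smallest_system C (Dom C p) {(p, S), (h, (Dom C p', \<nu>))} \<pi>'"
    using smallest_system_exists[OF X] by blast
  note Q = smallest_systemD[OF \<pi>']
  have hm: "pnbd_morphism C (Dom C p, \<pi>') (Dom C p', \<nu>) h" and pm: "pnbd_morphism C (Dom C p, \<pi>') S p"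
    using Q(2) by auto
  have qm: "pnbd_morphism C (Dom C p, \<pi>') U q"
    using morphism_comp[OF hm P'(5) pspaces_subs[OF U]] h(3) by simp
  have "k \<in> closed_subs C (Dom C p, \<pi>')"
    using closed_subs_finer_off[OF conjunct2[OF pspacesD[OF P(3)], simplified] Q(1) X _ k] P(6)[OF Q(1) pm qm]
    by blast
  then have "sub_image C h k \<in> closed_subs C (Dom C p', \<nu>)"
    using stably_closed_image[OF pf P'(3,4) pb \<pi>'] by blast
  then have "sub_image C q' (sub_image C h k) \<in> closed_subs C U"
    using compactD[OF T tU V] by blast
  then show "sub_image C q k \<in> closed_subs C U"
    using image_comp[OF h(1) P'(2) closed_subs_subs[OF k]] h(3) by simp
qed

section \<open>Images of compact spaces\<close>

text \<open>The subobjects whose inverse images under \<open>h\<close> are preneighbourhoods form a system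
  \<open>\<nu>'\<close> on \<open>V\<close>, the pushforward of \<open>\<omega>\<close>; minimality of \<open>\<nu>\<close> bounds it by \<open>\<nu>'\<close>. The condition on the least
  subobject is what the axiom \<open>\<nu>' (bot_sub C V) = subs V\<close> requires.\<close>

lemma mediating_morphism:
  assumes \<nu>: "smallest_system C V L \<nu>" and \<omega>: "pnbd_system C W \<omega>" and h: "h \<in> Hom C W V"
    and L: "\<And>l S. (l, S) \<in> L \<Longrightarrow> S \<in> pspaces C \<and> l \<in> Hom C V (fst S) \<and> pnbd_morphism C (W, \<omega>) S (l \<cdot> h)"
    and bot: "sub_preimage C h (bot_sub C V) \<in> \<omega> (sub_preimage C h (bot_sub C V))"
  shows "pnbd_morphism C (W, \<omega>) (V, \<nu>) h"
proof -
  have V: "V \<in> Ob C" using Hom_Ob[OF h] by blast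
  define \<nu>' where
    "\<nu>' = (\<lambda>m\<in>subs V. {r \<in> subs V. m \<sqsubseteq>\<^bsub>Sub C V\<^esub> r \<and> sub_preimage C h r \<in> \<omega> (sub_preimage C h m)})"
  have mem: "r \<in> \<nu>' m \<longleftrightarrow> r \<in> subs V \<and> m \<sqsubseteq>\<^bsub>Sub C V\<^esub> r \<and> sub_preimage C h r \<in> \<omega> (sub_preimage C h m)"
    if "m \<in> subs V" for r m
    using that unfolding \<nu>'_def by simp
  note hp = preimage_subs[OF h]
  have sys: "pnbd_system C V \<nu>'"
  proof (rule pnbd_systemI[OF V])
    show "\<nu>' \<in> extensional (subs V)" unfolding \<nu>'_def by simp
  next
    fix m r assume m: "m \<in> subs V" and r: "r \<in> \<nu>' m"
    note r' = r[unfolded mem[OF m]]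
    show "r \<in> subs V \<and> m \<sqsubseteq>\<^bsub>Sub C V\<^esub> r" using r' by blast
    show "s \<in> \<nu>' m" if s: "s \<in> subs V" "r \<sqsubseteq>\<^bsub>Sub C V\<^esub> s" for s
      unfolding mem[OF m]
      using r' s sub_trans[OF m _ s(1) _ s(2)] pnbd_up[OF \<omega> hp[OF m] _ hp[OF s(1)]]
        preimage_mono[OF h _ s] by blast
    show "r \<sqinter>\<^bsub>Sub C V\<^esub> s \<in> \<nu>' m" if s: "s \<in> \<nu>' m" for s
    proof -
      note s' = s[unfolded mem[OF m]]
      have rs: "r \<in> subs V" "s \<in> subs V" using r' s' by auto
      show ?thesis unfolding mem[OF m] preimage_meet[OF h rs]
        using r' s' sub_meet(1)[OF rs] sub_meet_greatest[OF rs m] pnbd_meet[OF \<omega> hp[OF m]] by blast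
    qed
  next
    fix m assume m: "m \<in> subs V"
    interpret L: complete_lattice "Sub C V" using Sub_complete_lattice[OF V] .
    obtain w where w: "w \<in> \<omega> (sub_preimage C h m)" using pnbd_nonempty[OF \<omega> hp[OF m]] by blast
    have w': "w \<in> subs W" using pnbd_subs[OF \<omega> hp[OF m] w] .
    have t: "\<top>\<^bsub>Sub C V\<^esub> \<in> subs V" by simp
    have "sub_image C h w \<sqsubseteq>\<^bsub>Sub C V\<^esub> \<top>\<^bsub>Sub C V\<^esub>" using L.top_higher[OF image_subs[OF h w']] .
    then have "w \<sqsubseteq>\<^bsub>Sub C W\<^esub> sub_preimage C h \<top>\<^bsub>Sub C V\<^esub>" using image_le_iff[OF h w' t] by simp
    then have "\<top>\<^bsub>Sub C V\<^esub> \<in> \<nu>' m"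
      unfolding mem[OF m] using t L.top_higher[OF m] pnbd_up[OF \<omega> hp[OF m] w hp[OF t]] by blast
    then show "\<nu>' m \<noteq> {}" by blast
  next
    fix m n assume mn: "m \<in> subs V" "n \<in> subs V" "m \<sqsubseteq>\<^bsub>Sub C V\<^esub> n"
    have "\<omega> (sub_preimage C h n) \<subseteq> \<omega> (sub_preimage C h m)"
      using pnbd_anti[OF \<omega> hp[OF mn(1)] hp[OF mn(2)] preimage_mono[OF h mn]] .
    then show "\<nu>' n \<subseteq> \<nu>' m"
      unfolding subset_iff mem[OF mn(1)] mem[OF mn(2)] using sub_trans[OF mn(1,2) _ mn(3)] by blast
  next
    fix r assume r: "r \<in> subs V"
    note b = bot_subs[OF V]
    show "r \<in> \<nu>' (bot_sub C V)"
      unfolding mem[OF b]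
      using r bot_least[OF r] pnbd_up[OF \<omega> hp[OF b] bot hp[OF r]] preimage_mono[OF h b r] by blast
  qed
  have mor: "pnbd_morphism C (V, \<nu>') S l" if lS: "(l, S) \<in> L" for l S
  proof -
    have S: "S \<in> pspaces C" and l: "l \<in> Hom C V (fst S)" and lh: "pnbd_morphism C (W, \<omega>) S (l \<cdot> h)"
      using L[OF lS] by auto
    have "sub_preimage C l a \<in> \<nu>' (sub_preimage C l u)" if u: "u \<in> subs (fst S)" and a: "a \<in> snd S u" for u a
    proof -
      note a' = pspaces_subs[OF S u a]
      have "u \<sqsubseteq>\<^bsub>Sub C (fst S)\<^esub> a" using pnbd_le[OF conjunct2[OF pspacesD[OF S]] u a] .
      then have "sub_preimage C l u \<sqsubseteq>\<^bsub>Sub C V\<^esub> sub_preimage C l a" using preimage_mono[OF l u a'] by blast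
      moreover have "sub_preimage C (l \<cdot> h) a \<in> \<omega> (sub_preimage C (l \<cdot> h) u)"
        using morphismD[OF lh u a] by simp
      ultimately show ?thesis
        unfolding mem[OF preimage_subs[OF l u]] preimage_comp[OF h l u] preimage_comp[OF h l a']
        using preimage_subs[OF l a'] by blast
    qed
    then show ?thesis unfolding pnbd_morphism_def using l by simp
  qed
  have "sub_preimage C h r \<in> \<omega> (sub_preimage C h m)" if m: "m \<in> subs V" and r: "r \<in> \<nu> m" for m r
  proof -
    have "\<nu> m \<subseteq> \<nu>' m" by (rule smallest_systemD(3)[OF \<nu> sys mor m])
    then show ?thesis using r mem[OF m] by blast
  qed
  then show ?thesis unfolding pnbd_morphism_def using h by simp
qed

text \<open>Enlarging a system below the inverse image \<open>s\<close> of the least subobject is how the side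
  condition of \<open>mediating_morphism\<close> is forced without touching the subobjects not below \<open>s\<close>.\<close>

lemma discrete_below_system:
  assumes \<mu>: "pnbd_system C X \<mu>" and X: "X \<in> Ob C" and s: "s \<in> subs X"
  shows "pnbd_system C X (\<lambda>m\<in>subs X. if m \<sqsubseteq>\<^bsub>Sub C X\<^esub> s then {p \<in> subs X. m \<sqsubseteq>\<^bsub>Sub C X\<^esub> p} else \<mu> m)"
    (is "pnbd_system C X ?\<nu>")
proof -
  have mem: "p \<in> ?\<nu> m \<longleftrightarrow> (if m \<sqsubseteq>\<^bsub>Sub C X\<^esub> s then p \<in> subs X \<and> m \<sqsubseteq>\<^bsub>Sub C X\<^esub> p else p \<in> \<mu> m)"
    if "m \<in> subs X" for m p using that by simp
  show ?thesis
  proof (rule pnbd_systemI[OF X])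
    show "?\<nu> \<in> extensional (subs X)" by (rule restrict_extensional)
  next
    fix m p assume m: "m \<in> subs X" and p: "p \<in> ?\<nu> m"
    note p' = p[unfolded mem[OF m]]
    show pm: "p \<in> subs X \<and> m \<sqsubseteq>\<^bsub>Sub C X\<^esub> p"
      using p' pnbd_subs[OF \<mu> m] pnbd_le[OF \<mu> m] by (auto split: if_splits)
    show "q \<in> ?\<nu> m" if q: "q \<in> subs X" "p \<sqsubseteq>\<^bsub>Sub C X\<^esub> q" for q
      unfolding mem[OF m] using p' q pm sub_trans[OF m _ q(1)] pnbd_up[OF \<mu> m _ q] by (auto split: if_splits)
    show "p \<sqinter>\<^bsub>Sub C X\<^esub> q \<in> ?\<nu> m" if q: "q \<in> ?\<nu> m" for q
      unfolding mem[OF m] using p' q[unfolded mem[OF m]] sub_meet(1) sub_meet_greatest[OF _ _ m] pnbd_meet[OF \<mu> m]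
      by (auto split: if_splits)
  next
    fix m assume m: "m \<in> subs X"
    show "?\<nu> m \<noteq> {}" using m pnbd_nonempty[OF \<mu> m] sub_refl[OF m] by auto
  next
    fix m n assume mn: "m \<in> subs X" "n \<in> subs X" "m \<sqsubseteq>\<^bsub>Sub C X\<^esub> n"
    show "?\<nu> n \<subseteq> ?\<nu> m"
    proof
      fix p assume "p \<in> ?\<nu> n"
      then have p: "if n \<sqsubseteq>\<^bsub>Sub C X\<^esub> s then p \<in> subs X \<and> n \<sqsubseteq>\<^bsub>Sub C X\<^esub> p else p \<in> \<mu> n"
        unfolding mem[OF mn(2)] .
      then have "p \<in> subs X \<and> n \<sqsubseteq>\<^bsub>Sub C X\<^esub> p"
        using pnbd_subs[OF \<mu> mn(2)] pnbd_le[OF \<mu> mn(2)] by (auto split: if_splits)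
      then have "p \<in> subs X \<and> m \<sqsubseteq>\<^bsub>Sub C X\<^esub> p" using sub_trans[OF mn(1,2) _ mn(3)] by blast
      moreover have "p \<in> \<mu> m" if "\<not> m \<sqsubseteq>\<^bsub>Sub C X\<^esub> s"
        using that p pnbd_anti[OF \<mu> mn] sub_trans[OF mn(1,2) s mn(3)] by (auto split: if_splits)
      ultimately show "p \<in> ?\<nu> m" unfolding mem[OF mn(1)] by simp
    qed
  next
    fix p assume "p \<in> subs X"
    then show "p \<in> ?\<nu> (bot_sub C X)" unfolding mem[OF bot_subs[OF X]] using bot_least s by simp
  qed
qed

text \<open>The restriction of \<open>h\<close> to the inverse image of \<open>t\<close> is a pullback of \<open>f\<close>, hence in \<open>EE\<close>; so
  \<open>t\<close> is the \<open>MM\<close>-part of the composite of \<open>h\<close> with that inverse image. The domain of \<open>t\<close> gets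
  the discrete system, for which \<open>g \<cdot> m\<close> is a morphism.\<close>

lemma image_preimage_stably_E:
  assumes S: "S \<in> pspaces C" and T: "T \<in> pspaces C" and f: "f \<in> Hom C (fst S) (fst T)"
    and E: "stably C (\<lambda>W U q. q \<in> EE C) S T f" and pb: "is_pullback C f g p h"
    and g: "pnbd_morphism C V T g" and V: "V \<in> pspaces C" and t: "t \<in> subs (fst V)"
  shows "sub_image C h (sub_preimage C h t) = t"
proof -
  note P = pullback_Hom[OF pb f]
  have gh: "g \<in> Hom C (fst V) (fst T)" using morphism_Hom[OF g] .
  then have Dg: "Dom C g = fst V" using HomD[OF gh] by simp
  have h: "h \<in> Hom C (Dom C p) (fst V)" using P(3) Dg by simp
  obtain m where m: "m \<in> t" "m \<in> MM C" "m \<in> Hom C (Dom C m) (fst V)" "t = sub_class C m" using subsE[OF t] .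
  obtain a b where ab: "is_pullback C h m a b" using pullback_exists[OF h m(3)] by blast
  note Q = pullback_Hom[OF ab h]
  note R = preimage_rep[OF h t m(1) ab]
  have pb2: "is_pullback C f (g \<cdot> m) (p \<cdot> a) b" using pullback_paste[OF pb ab f] .
  have pa: "p \<cdot> a \<in> Hom C (Dom C a) (fst S)" using comp_Hom[OF P(2) Q(2)] .
  have Dpa: "Dom C (p \<cdot> a) = Dom C a" using HomD[OF pa] by simp
  have Dm: "Dom C m \<in> Ob C" using Hom_Ob[OF m(3)] by blast
  define M where "M = (Dom C m, discrete (Dom C m))"
  have M: "M \<in> pspaces C" unfolding M_def using pspacesI[OF Dm discrete_system[OF Dm]] .
  have gm: "pnbd_morphism C M T (g \<cdot> m)"
    unfolding M_def using discrete_morphism[OF comp_Hom[OF gh m(3)] conjunct2[OF pspacesD[OF T]]] by simp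
  have "\<forall>(l, R)\<in>{(p \<cdot> a, S), (b, M)}. R \<in> pspaces C \<and> l \<in> Hom C (Dom C a) (fst R)"
    using S M pa Q(3) unfolding M_def by simp
  then obtain \<pi> where "smallest_system C (Dom C a) {(p \<cdot> a, S), (b, M)} \<pi>"
    using smallest_system_exists[OF Q(5)] by blast
  then have "pnbd_pullback C S M f (g \<cdot> m) (Dom C a, \<pi>) (p \<cdot> a) b"
    unfolding pnbd_pullback_def using pb2 Dpa by simp
  then have b: "b \<in> EE C" using E M gm unfolding stably_def by blast
  have "a \<in> sub_preimage C h t" using R(1) sub_class_self[OF R(2)] by simp
  then show ?thesis
    using image_rep(1)[OF h preimage_subs[OF h t] _ b Q(3) m(2,3) Q(4)] m(4) by simp
qed

text \<open>Stable continuity gives closedness of \<open>k = h\<^sup>-\<^sup>1 t\<close> only for the system \<open>\<pi>'\<close>, which is finer than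
  the product system \<open>\<pi>\<close>. But \<open>\<pi>'\<close> is bounded by the system \<open>\<omega>\<close> that agrees with \<open>\<pi>\<close> off the inverse
  image \<open>s\<close> of the least subobject, and \<open>s\<close> lies below \<open>k\<close>.\<close>

lemma compact_image:
  assumes S: "compact_space C S" and T: "T \<in> pspaces C" and f: "pnbd_morphism C S T f"
    and cont: "stably C (continuous_morphism C) S T f" and E: "stably C (\<lambda>W U q. q \<in> EE C) S T f"
  shows "compact_space C T"
proof (rule compactI[OF T])
  fix U p' q' \<nu> t
  assume U: "U \<in> pspaces C" and tU: "test_space U" and V: "product_space T U p' q' \<nu>"
    and t: "t \<in> closed_subs C (Dom C p', \<nu>)"
  note S' = compact_pspaces[OF S]
  obtain p q \<pi> where W: "product_space S U p q \<pi>" using product_space_exists[OF S' U] .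
  note P = product_spaceD[OF W S' U] and P' = product_spaceD[OF V T U]
  note fh = morphism_Hom[OF f] and t' = closed_subs_subs[OF t]
  obtain h where h: "h \<in> Hom C (Dom C p) (Dom C p')" "p' \<cdot> h = f \<cdot> p" "q' \<cdot> h = q"
    and pb: "is_pullback C f p' p h"
    using product_map[OF S' T U W V fh] .
  have X: "Dom C p \<in> Ob C" using Hom_Ob[OF P(1)] by blast
  have V': "Dom C p' \<in> Ob C" using Hom_Ob[OF P'(1)] by blast
  have \<pi>: "pnbd_system C (Dom C p) \<pi>" using pspacesD[OF P(3)] by simp
  have "\<forall>(l, R)\<in>{(p, S), (h, (Dom C p', \<nu>))}. R \<in> pspaces C \<and> l \<in> Hom C (Dom C p) (fst R)"
    using S' P(1) P'(3) h(1) by simp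
  then obtain \<pi>' where \<pi>': "smallest_system C (Dom C p) {(p, S), (h, (Dom C p', \<nu>))} \<pi>'"
    using smallest_system_exists[OF X] by blast
  note Q = smallest_systemD[OF \<pi>']
  let ?k = "sub_preimage C h t"
  define s where "s = sub_preimage C h (bot_sub C (Dom C p'))"
  have sS: "s \<in> subs (Dom C p)" unfolding s_def using preimage_subs[OF h(1) bot_subs[OF V']] .
  have sk: "s \<sqsubseteq>\<^bsub>Sub C (Dom C p)\<^esub> ?k"
    unfolding s_def using preimage_mono[OF h(1) bot_subs[OF V'] t' bot_least[OF t']] .
  have kS: "?k \<in> subs (Dom C p)" using preimage_subs[OF h(1) t'] .
  define \<omega> where "\<omega> = (\<lambda>m\<in>subs (Dom C p). if m \<sqsubseteq>\<^bsub>Sub C (Dom C p)\<^esub> s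
    then {r \<in> subs (Dom C p). m \<sqsubseteq>\<^bsub>Sub C (Dom C p)\<^esub> r} else \<pi> m)"
  have \<omega>: "pnbd_system C (Dom C p) \<omega>" unfolding \<omega>_def using discrete_below_system[OF \<pi> X sS] .
  have \<pi>\<omega>: "\<pi> u \<subseteq> \<omega> u" if u: "u \<in> subs (Dom C p)" for u
    unfolding \<omega>_def using u pnbd_subs[OF \<pi> u] pnbd_le[OF \<pi> u] by auto
  have pm: "pnbd_morphism C (Dom C p, \<omega>) S p" and qm: "pnbd_morphism C (Dom C p, \<omega>) U q"
    using morphism_finer[OF P(4) \<pi>\<omega>] morphism_finer[OF P(5) \<pi>\<omega>] by auto
  have fpm: "pnbd_morphism C (Dom C p, \<omega>) T (f \<cdot> p)" using morphism_comp[OF pm f pspaces_subs[OF T]] .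
  have hm: "pnbd_morphism C (Dom C p, \<omega>) (Dom C p', \<nu>) h"
  proof (rule mediating_morphism[OF _ \<omega> h(1)])
    show "smallest_system C (Dom C p') {(p', T), (q', U)} \<nu>" using V unfolding product_space_def by blast
    show "S \<in> pspaces C \<and> l \<in> Hom C (Dom C p') (fst S) \<and> pnbd_morphism C (Dom C p, \<omega>) S (l \<cdot> h)"
      if "(l, S) \<in> {(p', T), (q', U)}" for l S
      using that T U P'(1,2) fpm qm h(2,3) by auto
    show "sub_preimage C h (bot_sub C (Dom C p')) \<in> \<omega> (sub_preimage C h (bot_sub C (Dom C p')))"
      unfolding s_def[symmetric] unfolding \<omega>_def using sS sub_refl[OF sS] by simp
  qed
  have "\<pi>' u \<subseteq> \<omega> u" if u: "u \<in> subs (Dom C p)" for u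
    by (rule Q(3)[OF \<omega> _ u]) (use pm hm in auto)
  moreover have "\<omega> u = \<pi> u" if "u \<in> subs (Dom C p)" "\<not> u \<sqsubseteq>\<^bsub>Sub C (Dom C p)\<^esub> ?k" for u
    using that sub_trans[OF that(1) sS kS _ sk] unfolding \<omega>_def by auto
  ultimately have off: "\<pi>' u \<subseteq> \<pi> u" if "u \<in> subs (Dom C p)" "\<not> u \<sqsubseteq>\<^bsub>Sub C (Dom C p)\<^esub> ?k" for u
    using that by blast
  have "pnbd_pullback C S (Dom C p', \<nu>) f p' (Dom C p, \<pi>') p h"
    unfolding pnbd_pullback_def using pb \<pi>' by simp
  then have "continuous_morphism C (Dom C p, \<pi>') (Dom C p', \<nu>) h"
    using cont P'(3,4) unfolding stably_def by blast
  then have "?k \<in> closed_subs C (Dom C p, \<pi>')" using t unfolding continuous_morphism_def by blast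
  then have "?k \<in> closed_subs C (Dom C p, \<pi>)" using closed_subs_finer_off[OF Q(1) \<pi> X off] by blast
  then have "sub_image C q ?k \<in> closed_subs C U" using compactD[OF S tU W] by blast
  moreover have "sub_image C q ?k = sub_image C q' (sub_image C h ?k)"
    using image_comp[OF h(1) P'(2) kS] h(3) by simp
  moreover have "sub_image C h ?k = t"
    using image_preimage_stably_E[OF S' T fh E pb P'(4,3)] t' by simp
  ultimately show "sub_image C q' t \<in> closed_subs C U" by simp
qed

section \<open>Finite products of compact spaces\<close>

text \<open>For the smallest system making \<open>q\<close> a morphism, the inverse \<open>i\<close> is a morphism as well,
  because it preserves the least subobject; thus closed subobjects are transported.\<close>

lemma system_along_iso:
  assumes U: "U \<in> pspaces C" and q: "q \<in> Hom C W (fst U)" and i: "i \<in> Hom C (fst U) W"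
    and qi: "q \<cdot> i = Id C (fst U)" and iq: "i \<cdot> q = Id C W"
  obtains \<omega> where "pnbd_system C W \<omega>" "pnbd_morphism C (W, \<omega>) U q" "closed_morphism C (W, \<omega>) U q"
proof -
  have W: "W \<in> Ob C" and Y: "fst U \<in> Ob C" using Hom_Ob[OF q] by auto
  have \<phi>: "pnbd_system C (fst U) (snd U)" using pspacesD[OF U] by blast
  obtain \<omega> where sm: "smallest_system C W {(q, U)} \<omega>"
    using smallest_system_exists[OF W, of "{(q, U)}"] U q by auto
  note Q = smallest_systemD[OF sm]
  have qm: "pnbd_morphism C (W, \<omega>) U q" using Q(2) by simp
  have inv1: "sub_preimage C i (sub_preimage C q y) = y" if "y \<in> subs (fst U)" for y
    using preimage_comp[OF i q that] preimage_Id[OF that] qi by simp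
  have inv2: "sub_preimage C q (sub_preimage C i x) = x" if "x \<in> subs W" for x
    using preimage_comp[OF q i that] preimage_Id[OF that] iq by simp
  note bU = bot_subs[OF Y] and bW = bot_subs[OF W]
  have ibot: "sub_preimage C i (bot_sub C W) = bot_sub C (fst U)"
  proof (rule bot_unique[OF preimage_subs[OF i bW]])
    show "sub_preimage C i (bot_sub C W) \<sqsubseteq>\<^bsub>Sub C (fst U)\<^esub> bot_sub C (fst U)"
      using preimage_mono[OF i bW preimage_subs[OF q bU] bot_least[OF preimage_subs[OF q bU]]] inv1[OF bU]
      by simp
  qed
  have idm: "pnbd_morphism C U U (q \<cdot> i)"
    unfolding qi pnbd_morphism_def using id_in_Hom[OF Y] preimage_Id pnbd_subs[OF \<phi>] by simp
  have im: "pnbd_morphism C (fst U, snd U) (W, \<omega>) i"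
  proof (rule mediating_morphism[OF sm \<phi> i])
    show "S \<in> pspaces C \<and> l \<in> Hom C W (fst S) \<and> pnbd_morphism C (fst U, snd U) S (l \<cdot> i)"
      if "(l, S) \<in> {(q, U)}" for l S
      using that U q idm by simp
    show "sub_preimage C i (bot_sub C W) \<in> snd U (sub_preimage C i (bot_sub C W))"
      unfolding ibot pnbd_bot[OF \<phi>] using bU .
  qed
  have "sub_image C q k \<in> closed_subs C U" if k: "k \<in> closed_subs C (W, \<omega>)" for k
  proof -
    note kS = closed_subs_subs[OF k]
    let ?k = "sub_preimage C i k"
    have k'S: "?k \<in> subs (fst U)" using preimage_subs[OF i kS] .
    have "sub_image C q k = ?k"
    proof (rule image_eqI[OF q kS k'S])
      fix y assume y: "y \<in> subs (fst U)"
      note qy = preimage_subs[OF q y]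
      show "?k \<sqsubseteq>\<^bsub>Sub C (fst U)\<^esub> y \<longleftrightarrow> k \<sqsubseteq>\<^bsub>Sub C W\<^esub> sub_preimage C q y"
        using preimage_mono[OF q k'S y] preimage_mono[OF i kS qy] inv1[OF y] inv2[OF kS] by auto
    qed
    moreover have "?k = bot_sub C (fst U) \<or> (\<forall>y\<in>subs (fst U).
        \<not> y \<sqsubseteq>\<^bsub>Sub C (fst U)\<^esub> ?k \<and> \<not> ?k \<sqsubseteq>\<^bsub>Sub C (fst U)\<^esub> y \<longrightarrow>
        (\<exists>u\<in>snd U y. u \<sqinter>\<^bsub>Sub C (fst U)\<^esub> ?k = bot_sub C (fst U)))"
    proof (cases "k = bot_sub C W")
      case False
      have "\<exists>u\<in>snd U y. u \<sqinter>\<^bsub>Sub C (fst U)\<^esub> ?k = bot_sub C (fst U)"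
        if y: "y \<in> subs (fst U)" and yk: "\<not> y \<sqsubseteq>\<^bsub>Sub C (fst U)\<^esub> ?k" "\<not> ?k \<sqsubseteq>\<^bsub>Sub C (fst U)\<^esub> y" for y
      proof -
        note qy = preimage_subs[OF q y]
        have "\<not> sub_preimage C q y \<sqsubseteq>\<^bsub>Sub C W\<^esub> k" "\<not> k \<sqsubseteq>\<^bsub>Sub C W\<^esub> sub_preimage C q y"
          using preimage_mono[OF i qy kS] preimage_mono[OF i kS qy] inv1[OF y] yk by auto
        then obtain u where u: "u \<in> \<omega> (sub_preimage C q y)" "u \<sqinter>\<^bsub>Sub C W\<^esub> k = bot_sub C W"
          using k False qy unfolding closed_subs_iff[OF Q(1) W] by blast
        have "sub_preimage C i u \<in> snd U y"
          using morphismD[OF im, of "sub_preimage C q y" u] qy u(1) inv1[OF y] by simp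
        moreover have "sub_preimage C i u \<sqinter>\<^bsub>Sub C (fst U)\<^esub> ?k = bot_sub C (fst U)"
          using preimage_meet[OF i pnbd_subs[OF Q(1) qy u(1)] kS] u(2) ibot by simp
        ultimately show ?thesis by blast
      qed
      then show ?thesis by blast
    qed (use ibot in simp)
    ultimately show ?thesis
      using closed_subs_iff[OF \<phi> Y, of ?k] k'S by simp
  qed
  then show thesis using that[OF Q(1) qm] unfolding closed_morphism_def by blast
qed

text \<open>By induction, replacing \<open>U\<close> by \<open>D j \<times> U\<close>: this is again a test space, its projection to \<open>U\<close> is
  closed as \<open>D j\<close> is compact, and \<open>W\<close> is a product of it with the remaining factors. Products of
  some of the factors alone do not occur, as they may lack the universal property.
  The object \<open>W\<close> is given in advance, and for no factors \<open>q\<close> is merely invertible.\<close>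

lemma finite_product_system:
  assumes "finite I" and "\<forall>i\<in>I. compact_space C (D i)" and "test_space U"
    and "q \<in> Hom C W (fst U)" and "\<forall>i\<in>I. p i \<in> Hom C W (fst (D i))"
    and "\<And>K x y. \<lbrakk>x \<in> Hom C K (fst U); \<forall>i\<in>I. y i \<in> Hom C K (fst (D i))\<rbrakk>
      \<Longrightarrow> \<exists>h\<in>Hom C K W. q \<cdot> h = x \<and> (\<forall>i\<in>I. p i \<cdot> h = y i)"
    and "\<And>K h k. \<lbrakk>h \<in> Hom C K W; k \<in> Hom C K W; q \<cdot> h = q \<cdot> k; \<forall>i\<in>I. p i \<cdot> h = p i \<cdot> k\<rbrakk> \<Longrightarrow> h = k"
  shows "\<exists>\<omega>. pnbd_system C W \<omega> \<and> pnbd_morphism C (W, \<omega>) U q \<and>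
    (\<forall>i\<in>I. pnbd_morphism C (W, \<omega>) (D i) (p i)) \<and> closed_morphism C (W, \<omega>) U q"
  using assms
proof (induction I arbitrary: U q)
  case empty
  have U: "U \<in> pspaces C" using empty.prems(2) unfolding test_space_def by blast
  note q = empty.prems(3)
  have Y: "fst U \<in> Ob C" and W: "W \<in> Ob C" using Hom_Ob[OF q] by auto
  obtain i where i: "i \<in> Hom C (fst U) W" "q \<cdot> i = Id C (fst U)"
    using empty.prems(5)[OF id_in_Hom[OF Y]] by blast
  have "q \<cdot> (i \<cdot> q) = q \<cdot> Id C W"
    using comp_assoc[OF q i(1) q] i(2) comp_id_left[OF q] comp_id_right[OF q] by simp
  then have "i \<cdot> q = Id C W"
    using empty.prems(6)[OF comp_Hom[OF i(1) q] id_in_Hom[OF W]] by blast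
  then show ?case using system_along_iso[OF U q i] by blast
next
  case (insert j I)
  have U: "U \<in> pspaces C" using insert.prems(2) unfolding test_space_def by blast
  have Dj: "compact_space C (D j)" using insert.prems(1) by blast
  note Sj = compact_pspaces[OF Dj] and q = insert.prems(3)
  have pj: "p j \<in> Hom C W (fst (D j))" using insert.prems(4) by blast
  obtain p' q' \<nu> where V: "product_space (D j) U p' q' \<nu>" using product_space_exists[OF Sj U] .
  note P = product_spaceD[OF V Sj U]
  have pb: "is_pullback C (bang C (fst (D j))) (bang C (fst U)) p' q'"
    using V unfolding product_space_def by blast
  have X: "fst (D j) \<in> Ob C" "fst U \<in> Ob C" using Sj U pspacesD by blast+
  obtain r where r: "r \<in> Hom C W (Dom C p')" "p' \<cdot> r = p j" "q' \<cdot> r = q"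
    using productE[OF pb X pj q] .
  let ?V = "(Dom C p', \<nu>)"
  have tV: "test_space ?V" using test_space_source[OF P(3,5) insert.prems(2)] .
  have "\<exists>\<omega>. pnbd_system C W \<omega> \<and> pnbd_morphism C (W, \<omega>) ?V r \<and>
    (\<forall>i\<in>I. pnbd_morphism C (W, \<omega>) (D i) (p i)) \<and> closed_morphism C (W, \<omega>) ?V r"
  proof (rule insert.IH)
    show "\<forall>i\<in>I. compact_space C (D i)" "test_space ?V" "\<forall>i\<in>I. p i \<in> Hom C W (fst (D i))"
      "r \<in> Hom C W (fst ?V)"
      using insert.prems(1,4) tV r(1) by simp_all
  next
    fix K x y assume x: "x \<in> Hom C K (fst ?V)" and y: "\<forall>i\<in>I. y i \<in> Hom C K (fst (D i))"
    have x': "x \<in> Hom C K (Dom C p')" using x by simp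
    \<comment> \<open>A cone over \<open>D j \<times> U\<close> and the factors in \<open>I\<close> has its \<open>j\<close>-th component hidden in \<open>x\<close>.\<close>
    have "\<forall>i\<in>insert j I. (y(j := p' \<cdot> x)) i \<in> Hom C K (fst (D i))"
      using y comp_Hom[OF P(1) x'] by simp
    then obtain h where h: "h \<in> Hom C K W" "q \<cdot> h = q' \<cdot> x"
      "\<forall>i\<in>insert j I. p i \<cdot> h = (y(j := p' \<cdot> x)) i"
      using insert.prems(5)[OF comp_Hom[OF P(2) x']] by blast
    have "p' \<cdot> (r \<cdot> h) = p' \<cdot> x" using comp_assoc[OF h(1) r(1) P(1)] r(2) h(3) by simp
    moreover have "q' \<cdot> (r \<cdot> h) = q' \<cdot> x" using comp_assoc[OF h(1) r(1) P(2)] r(3) h(2) by simp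
    ultimately have "r \<cdot> h = x" using pullback_eq[OF pb comp_Hom[OF r(1) h(1)] x'] by blast
    moreover have "p i \<cdot> h = y i" if "i \<in> I" for i
      using h(3) that insert.hyps(2) by (auto split: if_splits)
    ultimately show "\<exists>h\<in>Hom C K W. r \<cdot> h = x \<and> (\<forall>i\<in>I. p i \<cdot> h = y i)" using h(1) by blast
  next
    fix K h k assume h: "h \<in> Hom C K W" and k: "k \<in> Hom C K W" and e: "r \<cdot> h = r \<cdot> k"
      and eI: "\<forall>i\<in>I. p i \<cdot> h = p i \<cdot> k"
    have "q \<cdot> h = q \<cdot> k" using comp_assoc[OF h r(1) P(2)] comp_assoc[OF k r(1) P(2)] r(3) e by simp
    moreover have "p j \<cdot> h = p j \<cdot> k"
      using comp_assoc[OF h r(1) P(1)] comp_assoc[OF k r(1) P(1)] r(2) e by simp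
    ultimately show "h = k" using insert.prems(6)[OF h k] eI by blast
  qed
  then obtain \<omega> where \<omega>: "pnbd_system C W \<omega>" "pnbd_morphism C (W, \<omega>) ?V r"
    "\<forall>i\<in>I. pnbd_morphism C (W, \<omega>) (D i) (p i)" "closed_morphism C (W, \<omega>) ?V r" by blast
  have "pnbd_morphism C (W, \<omega>) U q"
    using morphism_comp[OF \<omega>(2) P(5) pspaces_subs[OF U]] r(3) by simp
  moreover have "pnbd_morphism C (W, \<omega>) (D j) (p j)"
    using morphism_comp[OF \<omega>(2) P(4) pspaces_subs[OF Sj]] r(2) by simp
  moreover have "sub_image C q k \<in> closed_subs C U" if k: "k \<in> closed_subs C (W, \<omega>)" for k
  proof -
    have "sub_image C r k \<in> closed_subs C ?V" using \<omega>(4) k unfolding closed_morphism_def by blast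
    then have "sub_image C q' (sub_image C r k) \<in> closed_subs C U"
      using compactD[OF Dj insert.prems(2) V] by blast
    then show ?thesis using image_comp[OF r(1) P(2) closed_subs_subs[OF k]] r(3) by simp
  qed
  ultimately show ?case using \<omega>(1,3) unfolding closed_morphism_def by blast
qed

lemma pNbd_Hom: "a \<in> Hom (pNbd C) S T \<longleftrightarrow>
    S \<in> pspaces C \<and> T \<in> pspaces C \<and> (\<exists>f. a = (S, f, T) \<and> pnbd_morphism C S T f)"
  unfolding Hom_def pNbd_def by auto

lemma pNbd_productE:
  assumes lim: "is_limit (pNbd C) I D {} P p"
  obtains c where "P \<in> pspaces C" "\<forall>i\<in>I. pnbd_morphism C P (D i) (c i)"
    "\<And>K y. \<lbrakk>K \<in> pspaces C; \<forall>i\<in>I. pnbd_morphism C K (D i) (y i)\<rbrakk>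
      \<Longrightarrow> \<exists>!h. pnbd_morphism C K P h \<and> (\<forall>i\<in>I. c i \<cdot> h = y i)"
proof -
  have cone: "is_cone (pNbd C) I D {} P p" and D: "\<forall>i\<in>I. D i \<in> pspaces C"
    using lim unfolding is_limit_def is_diagram_def pNbd_def by auto
  have P: "P \<in> pspaces C" and pH: "\<forall>i\<in>I. p i \<in> Hom (pNbd C) P (D i)"
    using cone unfolding is_cone_def by (auto simp: pNbd_def)
  define c where "c = (\<lambda>i. fst (snd (p i)))"
  have pc: "p i = (P, c i, D i) \<and> pnbd_morphism C P (D i) (c i)" if "i \<in> I" for i
    using pH that unfolding pNbd_Hom c_def by fastforce
  have "\<exists>!h. pnbd_morphism C K P h \<and> (\<forall>i\<in>I. c i \<cdot> h = y i)"
    if K: "K \<in> pspaces C" and y: "\<forall>i\<in>I. pnbd_morphism C K (D i) (y i)" for K y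
  proof -
    have "is_cone (pNbd C) I D {} K (\<lambda>i. (K, y i, D i))"
      unfolding is_cone_def pNbd_Hom using K D y by (simp add: pNbd_def)
    then have ex: "\<exists>!a. a \<in> Hom (pNbd C) K P \<and> (\<forall>i\<in>I. p i \<cdot>\<^bsub>pNbd C\<^esub> a = (K, y i, D i))"
      using lim unfolding is_limit_def by blast
    have eq: "(K, h, P) \<in> Hom (pNbd C) K P \<and> (\<forall>i\<in>I. p i \<cdot>\<^bsub>pNbd C\<^esub> (K, h, P) = (K, y i, D i)) \<longleftrightarrow>
        pnbd_morphism C K P h \<and> (\<forall>i\<in>I. c i \<cdot> h = y i)" for h
      using K P pc unfolding pNbd_Hom by (auto simp: pNbd_def)
    obtain a where a: "a \<in> Hom (pNbd C) K P" "\<forall>i\<in>I. p i \<cdot>\<^bsub>pNbd C\<^esub> a = (K, y i, D i)"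
      using ex by blast
    obtain h where h: "a = (K, h, P)" using a(1) unfolding pNbd_Hom by blast
    show ?thesis
    proof (rule ex1I[of _ h])
      show "pnbd_morphism C K P h \<and> (\<forall>i\<in>I. c i \<cdot> h = y i)" using eq[of h] a h by simp
      fix k assume "pnbd_morphism C K P k \<and> (\<forall>i\<in>I. c i \<cdot> k = y i)"
      then have "(K, k, P) = a" using eq[of k] ex a by blast
      then show "k = h" using h by simp
    qed
  qed
  then show thesis using that[of c] P pc by blast
qed

text \<open>The universal property is used twice: on discrete spaces, to see that \<open>P\<close> is a product
  in \<open>C\<close>, and on \<open>P \<times> U\<close> with the system \<open>\<omega>\<close>, to see that its projection to \<open>P\<close> is a morphism, so
  that \<open>\<omega>\<close> is finer than the product system.\<close>

lemma compact_finite_product: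
  assumes I: "finite I" and D: "\<forall>i\<in>I. compact_space C (D i)" and lim: "is_limit (pNbd C) I D {} P p"
  shows "compact_space C P"
proof -
  obtain c where P: "P \<in> pspaces C" and c: "\<forall>i\<in>I. pnbd_morphism C P (D i) (c i)"
    and uni: "\<And>K y. \<lbrakk>K \<in> pspaces C; \<forall>i\<in>I. pnbd_morphism C K (D i) (y i)\<rbrakk>
      \<Longrightarrow> \<exists>!h. pnbd_morphism C K P h \<and> (\<forall>i\<in>I. c i \<cdot> h = y i)"
    by (rule pNbd_productE[OF lim]) (rule that)
  have DS: "D i \<in> pspaces C" if "i \<in> I" for i using D that compact_pspaces by blast
  have disc: "pnbd_morphism C (K, discrete K) S y" if "y \<in> Hom C K (fst S)" "S \<in> pspaces C" for K S y
    using discrete_morphism[OF that(1) conjunct2[OF pspacesD[OF that(2)]]] by simp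
  have un: "h = k" if h: "h \<in> Hom C K (fst P)" and k: "k \<in> Hom C K (fst P)"
    and e: "\<forall>i\<in>I. c i \<cdot> h = c i \<cdot> k" for K h k
  proof -
    have K: "K \<in> Ob C" using Hom_Ob[OF h] by blast
    note hd = disc[OF h P] and kd = disc[OF k P]
    have Kp: "(K, discrete K) \<in> pspaces C" using pspacesI[OF K discrete_system[OF K]] .
    have "\<forall>i\<in>I. pnbd_morphism C (K, discrete K) (D i) (c i \<cdot> k)"
      using morphism_comp[OF kd] c pspaces_subs[OF DS] by blast
    then have "\<exists>!h. pnbd_morphism C (K, discrete K) P h \<and> (\<forall>i\<in>I. c i \<cdot> h = c i \<cdot> k)"
      by (rule uni[OF Kp])
    then show ?thesis using hd kd e by blast
  qed
  show ?thesis
  proof (rule compactI[OF P])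
    fix U p0 q0 \<pi> k
    assume U: "U \<in> pspaces C" and tU: "test_space U" and W: "product_space P U p0 q0 \<pi>"
      and k: "k \<in> closed_subs C (Dom C p0, \<pi>)"
    note Q = product_spaceD[OF W P U]
    have pb: "is_pullback C (bang C (fst P)) (bang C (fst U)) p0 q0"
      using W unfolding product_space_def by blast
    have X: "fst P \<in> Ob C" "fst U \<in> Ob C" using P U pspacesD by blast+
    have WO: "Dom C p0 \<in> Ob C" using Hom_Ob[OF Q(1)] by blast
    have ch: "c i \<in> Hom C (fst P) (fst (D i))" if "i \<in> I" for i using c that morphism_Hom by blast
    have "\<exists>\<omega>. pnbd_system C (Dom C p0) \<omega> \<and> pnbd_morphism C (Dom C p0, \<omega>) U q0 \<and>
      (\<forall>i\<in>I. pnbd_morphism C (Dom C p0, \<omega>) (D i) (c i \<cdot> p0)) \<and>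
      closed_morphism C (Dom C p0, \<omega>) U q0"
    proof (rule finite_product_system[OF I D tU Q(2)])
      show "\<forall>i\<in>I. c i \<cdot> p0 \<in> Hom C (Dom C p0) (fst (D i))" using comp_Hom[OF ch Q(1)] by blast
    next
      fix K x y assume x: "x \<in> Hom C K (fst U)" and y: "\<forall>i\<in>I. y i \<in> Hom C K (fst (D i))"
      have K: "K \<in> Ob C" using Hom_Ob[OF x] by blast
      have "\<forall>i\<in>I. pnbd_morphism C (K, discrete K) (D i) (y i)" using y disc DS by blast
      then obtain l where l: "pnbd_morphism C (K, discrete K) P l" "\<forall>i\<in>I. c i \<cdot> l = y i"
        using uni[OF pspacesI[OF K discrete_system[OF K]]] by blast
      have lh: "l \<in> Hom C K (fst P)" using morphism_Hom[OF l(1)] by simp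
      obtain h where h: "h \<in> Hom C K (Dom C p0)" "p0 \<cdot> h = l" "q0 \<cdot> h = x"
        using productE[OF pb X lh x] .
      have "(c i \<cdot> p0) \<cdot> h = y i" if "i \<in> I" for i
        using comp_assoc[OF h(1) Q(1) ch[OF that]] h(2) l(2) that by simp
      then show "\<exists>h\<in>Hom C K (Dom C p0). q0 \<cdot> h = x \<and> (\<forall>i\<in>I. (c i \<cdot> p0) \<cdot> h = y i)" using h by blast
    next
      fix K h k assume h: "h \<in> Hom C K (Dom C p0)" and k: "k \<in> Hom C K (Dom C p0)"
        and e: "q0 \<cdot> h = q0 \<cdot> k" and ec: "\<forall>i\<in>I. (c i \<cdot> p0) \<cdot> h = (c i \<cdot> p0) \<cdot> k"
      have "\<forall>i\<in>I. c i \<cdot> (p0 \<cdot> h) = c i \<cdot> (p0 \<cdot> k)"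
        using ec comp_assoc[OF h Q(1) ch] comp_assoc[OF k Q(1) ch] by simp
      then have "p0 \<cdot> h = p0 \<cdot> k" using un[OF comp_Hom[OF Q(1) h] comp_Hom[OF Q(1) k]] by blast
      then show "h = k" using pullback_eq[OF pb h k _ e] by blast
    qed
    then obtain \<omega> where \<omega>: "pnbd_system C (Dom C p0) \<omega>" "pnbd_morphism C (Dom C p0, \<omega>) U q0"
      "\<forall>i\<in>I. pnbd_morphism C (Dom C p0, \<omega>) (D i) (c i \<cdot> p0)"
      "closed_morphism C (Dom C p0, \<omega>) U q0" by blast
    obtain h where h: "pnbd_morphism C (Dom C p0, \<omega>) P h" "\<forall>i\<in>I. c i \<cdot> h = c i \<cdot> p0"
      using uni[OF pspacesI[OF WO \<omega>(1)] \<omega>(3)] by blast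
    have "h = p0" using un[OF _ Q(1) h(2)] morphism_Hom[OF h(1)] by simp
    then have "pnbd_morphism C (Dom C p0, \<omega>) P p0" using h(1) by simp
    then have "k \<in> closed_subs C (Dom C p0, \<omega>)"
      using closed_subs_finer_off[OF conjunct2[OF pspacesD[OF Q(3)], simplified] \<omega>(1) WO _ k]
        Q(6)[OF \<omega>(1) _ \<omega>(2)] by blast
    then show "sub_image C q0 k \<in> closed_subs C U" using \<omega>(4) unfolding closed_morphism_def by blast
  qed
qed

section \<open>Closed subspaces of compact spaces\<close>

lemma sub_space_fst: "fst (sub_space C S m) = Dom C m"
  unfolding sub_space_def by simp

lemma sub_space_mem:
  assumes m: "m \<in> MM C" "m \<in> Hom C (Dom C m) X" and a: "a \<in> subs (Dom C m)"
  shows "u \<in> snd (sub_space C (X, \<mu>) m) a \<longleftrightarrow> u \<in> subs (Dom C m) \<and>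
    (\<exists>v\<in>\<mu> (sub_image C m a). sub_preimage C m v \<sqsubseteq>\<^bsub>Sub C (Dom C m)\<^esub> u)"
  using a unfolding sub_space_def image_M[OF m a] by simp

text \<open>The axiom for the least subobject holds since direct images preserve it and \<open>m\<close> is
  monic.\<close>

lemma sub_space_system:
  assumes \<mu>: "pnbd_system C X \<mu>" and m: "m \<in> MM C" "m \<in> Hom C (Dom C m) X"
  shows "pnbd_system C (Dom C m) (snd (sub_space C (X, \<mu>) m))" (is "pnbd_system C ?M ?\<nu>")
proof -
  have M: "?M \<in> Ob C" using Hom_Ob[OF m(2)] by blast
  note mem = sub_space_mem[OF m, of _ _ \<mu>]
  note im = image_subs[OF m(2)] and pre = preimage_subs[OF m(2)]
  note \<mu>S = pnbd_subs[OF \<mu> im]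
  show ?thesis
  proof (rule pnbd_systemI[OF M])
    show "?\<nu> \<in> extensional (subs ?M)" unfolding sub_space_def by simp
  next
    fix a p assume a: "a \<in> subs ?M" and p: "p \<in> ?\<nu> a"
    obtain v where pS: "p \<in> subs ?M" and v: "v \<in> \<mu> (sub_image C m a)"
      "sub_preimage C m v \<sqsubseteq>\<^bsub>Sub C ?M\<^esub> p"
      using p unfolding mem[OF a] by blast
    note vS = \<mu>S[OF a v(1)]
    have "a \<sqsubseteq>\<^bsub>Sub C ?M\<^esub> sub_preimage C m v"
      using pnbd_le[OF \<mu> im[OF a] v(1)] image_le_iff[OF m(2) a vS] by blast
    then show "p \<in> subs ?M \<and> a \<sqsubseteq>\<^bsub>Sub C ?M\<^esub> p" using pS sub_trans[OF a pre[OF vS] pS _ v(2)] by blast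
    show "q \<in> ?\<nu> a" if q: "q \<in> subs ?M" "p \<sqsubseteq>\<^bsub>Sub C ?M\<^esub> q" for q
      unfolding mem[OF a] using q(1) v(1) sub_trans[OF pre[OF vS] pS q(1) v(2) q(2)] by blast
    show "p \<sqinter>\<^bsub>Sub C ?M\<^esub> q \<in> ?\<nu> a" if q: "q \<in> ?\<nu> a" for q
    proof -
      obtain w where qS: "q \<in> subs ?M" and w: "w \<in> \<mu> (sub_image C m a)"
        "sub_preimage C m w \<sqsubseteq>\<^bsub>Sub C ?M\<^esub> q"
        using q unfolding mem[OF a] by blast
      note wS = \<mu>S[OF a w(1)]
      have "sub_preimage C m (v \<sqinter>\<^bsub>Sub C X\<^esub> w) \<sqsubseteq>\<^bsub>Sub C ?M\<^esub> p \<sqinter>\<^bsub>Sub C ?M\<^esub> q"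
        unfolding preimage_meet[OF m(2) vS wS] using sub_meet_mono[OF pre[OF vS] pre[OF wS] pS qS v(2) w(2)] .
      then show ?thesis
        unfolding mem[OF a] using sub_meet(1)[OF pS qS] pnbd_meet[OF \<mu> im[OF a] v(1) w(1)] by blast
    qed
  next
    fix a assume a: "a \<in> subs ?M"
    obtain v where v: "v \<in> \<mu> (sub_image C m a)" using pnbd_nonempty[OF \<mu> im[OF a]] by blast
    have "sub_preimage C m v \<in> ?\<nu> a"
      unfolding mem[OF a] using v pre[OF \<mu>S[OF a v]] sub_refl[OF pre[OF \<mu>S[OF a v]]] by blast
    then show "?\<nu> a \<noteq> {}" by blast
  next
    fix a b assume ab: "a \<in> subs ?M" "b \<in> subs ?M" "a \<sqsubseteq>\<^bsub>Sub C ?M\<^esub> b"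
    show "?\<nu> b \<subseteq> ?\<nu> a"
      using pnbd_anti[OF \<mu> im[OF ab(1)] im[OF ab(2)] image_mono[OF m(2) ab]]
      unfolding subset_iff mem[OF ab(1)] mem[OF ab(2)] by blast
  next
    fix p assume p: "p \<in> subs ?M"
    note b = bot_subs[OF M]
    have X: "X \<in> Ob C" using Hom_Ob[OF m(2)] by blast
    have "bot_sub C X \<in> \<mu> (sub_image C m (bot_sub C ?M))"
      unfolding image_bot[OF m(2)] pnbd_bot[OF \<mu>] using bot_subs[OF X] .
    moreover have "sub_preimage C m (bot_sub C X) = bot_sub C ?M"
      using preimage_image_M[OF m b] image_bot[OF m(2)] by simp
    ultimately show "p \<in> ?\<nu> (bot_sub C ?M)" unfolding mem[OF b] using p bot_least[OF p] by metis
  qed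
qed

text \<open>Continuity of the projection \<open>p' : X \<times> U \<rightarrow> X\<close> makes \<open>h = m \<times> 1\<close> a closed subobject. Both
  projections are morphisms for the subspace system \<open>\<omega>\<close> that \<open>h\<close> induces, so the product system on
  \<open>M \<times> U\<close> is coarser than \<open>\<omega>\<close>, and separating preneighbourhoods extend to \<open>X \<times> U\<close>.\<close>

lemma compact_closed_subspace:
  assumes cont: "\<forall>S\<in>pspaces C. \<forall>T\<in>pspaces C. \<forall>f. pnbd_morphism C S T f \<longrightarrow> continuous_morphism C S T f"
    and S: "compact_space C S" and mM: "m \<in> MM C" and cod: "Cod C m = fst S"
    and cl: "sub_class C m \<in> closed_subs C S"
  shows "compact_space C (sub_space C S m)"
proof -
  obtain X \<mu> where Sx: "S = (X, \<mu>)" by (cases S)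
  have m: "m \<in> MM C" "m \<in> Hom C (Dom C m) X" using M_Hom[OF mM] mM cod Sx by simp_all
  note S' = compact_pspaces[OF S]
  have \<mu>: "pnbd_system C X \<mu>" using pspacesD[OF S'] Sx by simp
  define T where "T = sub_space C S m"
  have fT: "fst T = Dom C m" unfolding T_def by (rule sub_space_fst)
  have memT: "u \<in> snd T a \<longleftrightarrow> u \<in> subs (Dom C m) \<and>
      (\<exists>v\<in>\<mu> (sub_image C m a). sub_preimage C m v \<sqsubseteq>\<^bsub>Sub C (Dom C m)\<^esub> u)" if "a \<in> subs (Dom C m)" for u a
    unfolding T_def Sx using sub_space_mem[OF m that] .
  have "pnbd_system C (Dom C m) (snd T)" unfolding T_def Sx using sub_space_system[OF \<mu> m] .
  then have T': "T \<in> pspaces C" using pspacesI[of "fst T" "snd T"] Hom_Ob[OF m(2)] unfolding fT[symmetric] by simp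
  have "compact_space C T"
  proof (rule compactI[OF T'])
    fix U p q \<pi> k
    assume U: "U \<in> pspaces C" and tU: "test_space U" and W: "product_space T U p q \<pi>"
      and k: "k \<in> closed_subs C (Dom C p, \<pi>)"
    obtain p' q' \<nu> where V: "product_space S U p' q' \<nu>" using product_space_exists[OF S' U] .
    note P = product_spaceD[OF W T' U] and P' = product_spaceD[OF V S' U]
    let ?W = "Dom C p" and ?V = "Dom C p'"
    have mTS: "m \<in> Hom C (fst T) (fst S)" using m(2) fT Sx by simp
    obtain h where h: "h \<in> Hom C ?W ?V" "p' \<cdot> h = m \<cdot> p" "q' \<cdot> h = q" and pb: "is_pullback C m p' p h"
      using product_map[OF T' S' U W V mTS] .
    have ph: "p \<in> Hom C ?W (Dom C m)" and p'h: "p' \<in> Hom C ?V X" using P(1) P'(1) fT Sx by simp_all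
    have \<nu>: "pnbd_system C ?V \<nu>" and \<pi>: "pnbd_system C ?W \<pi>" using pspacesD[OF P'(3)] pspacesD[OF P(3)] by simp_all
    have WO: "?W \<in> Ob C" and VO: "?V \<in> Ob C" using Hom_Ob[OF h(1)] by auto
    have pb': "is_pullback C p' m h p"
    proof (rule pullbackI[OF p'h m(2) h(1) ph h(2)])
      show "\<exists>l\<in>Hom C K ?W. h \<cdot> l = x \<and> p \<cdot> l = y"
        if x: "x \<in> Hom C K ?V" and y: "y \<in> Hom C K (Dom C m)" and e: "p' \<cdot> x = m \<cdot> y" for K x y
      proof -
        obtain l where "l \<in> Hom C K ?W" "p \<cdot> l = y" "h \<cdot> l = x"
          by (rule pullbackE[OF pb m(2) y x e[symmetric]])
        then show ?thesis by blast
      qed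
      show "l = l'" if "l \<in> Hom C K ?W" "l' \<in> Hom C K ?W" "h \<cdot> l = h \<cdot> l'" "p \<cdot> l = p \<cdot> l'" for K l l'
        using pullback_eq[OF pb that(1,2,4,3)] .
    qed
    have Dh: "Dom C h = ?W" using HomD[OF h(1)] by simp
    have hM: "h \<in> MM C" using M_pullback[OF pb' p'h m(1)] .
    have mS: "sub_class C m \<in> subs X" using sub_class_subs[OF m] .
    have hp: "sub_class C h = sub_preimage C p' (sub_class C m)"
      using preimage_rep(1)[OF p'h mS sub_class_self[OF m(1)] pb'] by simp
    have "continuous_morphism C (?V, \<nu>) S p'" using cont S' P'(3,4) by blast
    then have hcl: "sub_class C h \<in> closed_subs C (?V, \<nu>)"
      using cl unfolding hp continuous_morphism_def by blast
    have hS: "sub_class C h \<in> subs ?V" using closed_subs_subs[OF hcl] .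
    note hi = image_subs[OF h(1)] and hpre = preimage_subs[OF h(1)]
    let ?\<omega> = "snd (sub_space C (?V, \<nu>) h)"
    have \<omega>: "pnbd_system C ?W ?\<omega>" using sub_space_system[OF \<nu> hM] h(1) Dh by simp
    have mem\<omega>: "u \<in> ?\<omega> a \<longleftrightarrow> u \<in> subs ?W \<and> (\<exists>v\<in>\<nu> (sub_image C h a). sub_preimage C h v \<sqsubseteq>\<^bsub>Sub C ?W\<^esub> u)"
      if "a \<in> subs ?W" for u a
      using sub_space_mem[OF hM, of ?V a u \<nu>] h(1) Dh that by simp
    have "sub_preimage C h u \<in> ?\<omega> (sub_preimage C h c)" if c: "c \<in> subs ?V" and u: "u \<in> \<nu> c" for c u
    proof -
      note uS = pnbd_subs[OF \<nu> c u]
      have "u \<in> \<nu> (sub_image C h (sub_preimage C h c))"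
        using pnbd_anti[OF \<nu> hi[OF hpre[OF c]] c image_counit[OF h(1) c]] u by blast
      then show ?thesis unfolding mem\<omega>[OF hpre[OF c]] using hpre[OF uS] sub_refl[OF hpre[OF uS]] by blast
    qed
    then have hm: "pnbd_morphism C (?W, ?\<omega>) (?V, \<nu>) h" unfolding pnbd_morphism_def using h(1) by simp
    have qm: "pnbd_morphism C (?W, ?\<omega>) U q"
      using morphism_comp[OF hm P'(5) pspaces_subs[OF U]] h(3) by simp
    have "sub_preimage C p a \<in> ?\<omega> (sub_preimage C p b)" if b: "b \<in> subs (Dom C m)" and a: "a \<in> snd T b" for a b
    proof -
      obtain v where aS: "a \<in> subs (Dom C m)" and v: "v \<in> \<mu> (sub_image C m b)"
        "sub_preimage C m v \<sqsubseteq>\<^bsub>Sub C (Dom C m)\<^esub> a"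
        using a unfolding memT[OF b] by blast
      note mb = image_subs[OF m(2) b] and pb = preimage_subs[OF ph b]
      have vS: "v \<in> subs X" using pnbd_subs[OF \<mu> mb v(1)] .
      note p'v = preimage_subs[OF p'h vS] and p'mb = preimage_subs[OF p'h mb]
      have "sub_preimage C p' v \<in> \<nu> (sub_preimage C p' (sub_image C m b))"
        using morphismD[OF P'(4), of "sub_image C m b" v] mb v(1) Sx by simp
      moreover have "sub_image C h (sub_preimage C p b) \<sqsubseteq>\<^bsub>Sub C ?V\<^esub> sub_preimage C p' (sub_image C m b)"
        unfolding image_le_iff[OF h(1) pb p'mb] preimage_comp[OF h(1) p'h mb, symmetric] h(2)
          preimage_comp[OF ph m(2) mb]
        using preimage_mono[OF ph b preimage_subs[OF m(2) mb] image_unit[OF m(2) b]] .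
      ultimately have "sub_preimage C p' v \<in> \<nu> (sub_image C h (sub_preimage C p b))"
        using pnbd_anti[OF \<nu> hi[OF pb] p'mb] by blast
      moreover have "sub_preimage C h (sub_preimage C p' v) \<sqsubseteq>\<^bsub>Sub C ?W\<^esub> sub_preimage C p a"
        unfolding preimage_comp[OF h(1) p'h vS, symmetric] h(2) preimage_comp[OF ph m(2) vS]
        using preimage_mono[OF ph preimage_subs[OF m(2) vS] aS v(2)] .
      ultimately show ?thesis unfolding mem\<omega>[OF pb] using preimage_subs[OF ph aS] by blast
    qed
    then have pm: "pnbd_morphism C (?W, ?\<omega>) T p" unfolding pnbd_morphism_def fT using ph by simp
    have \<pi>\<omega>: "\<pi> a \<subseteq> ?\<omega> a" if "a \<in> subs ?W" for a using P(6)[OF \<omega> pm qm that] .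
    note kS = closed_subs_subs[OF k]
    let ?k = "sub_image C h k"
    have kV: "?k \<in> subs ?V" using hi[OF kS] .
    have kh: "?k \<sqsubseteq>\<^bsub>Sub C ?V\<^esub> sub_class C h"
    proof -
      obtain n where n: "n \<in> k" "n \<in> Hom C (Dom C n) ?W" using subsE[OF kS] .
      have hn: "h \<cdot> n \<in> ?k" using image_M[OF hM h(1) kS] n(1) by blast
      have "factors C (h \<cdot> n) (sub_class C h)"
        using factors_comp[OF hS h(1) n(2) factors_self[OF hS sub_class_self[OF hM]]] .
      then show ?thesis using le_iff_factors[OF kV hS hn] by simp
    qed
    have "\<exists>u\<in>\<nu> x. u \<sqinter>\<^bsub>Sub C ?V\<^esub> ?k = bot_sub C ?V"
      if x: "x \<in> subs ?V" and xk: "\<not> x \<sqsubseteq>\<^bsub>Sub C ?V\<^esub> ?k" "\<not> ?k \<sqsubseteq>\<^bsub>Sub C ?V\<^esub> x" and kb: "?k \<noteq> bot_sub C ?V" for x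
    proof (cases "x \<sqsubseteq>\<^bsub>Sub C ?V\<^esub> sub_class C h")
      case False
      \<comment> \<open>A subobject above \<open>h\<close> would be above its part \<open>?k\<close>; so \<open>x\<close> is separated already from \<open>h\<close>.\<close>
      have "\<not> sub_class C h \<sqsubseteq>\<^bsub>Sub C ?V\<^esub> x" using sub_trans[OF kV hS x kh] xk(2) by blast
      moreover have "sub_class C h \<noteq> bot_sub C ?V"
      proof
        assume hb: "sub_class C h = bot_sub C ?V"
        show False using bot_unique[OF kV kh[unfolded hb]] kb by contradiction
      qed
      ultimately obtain u where u: "u \<in> \<nu> x" "u \<sqinter>\<^bsub>Sub C ?V\<^esub> sub_class C h = bot_sub C ?V"
        using hcl x False unfolding closed_subs_iff[OF \<nu> VO] by blast
      have uS: "u \<in> subs ?V" using pnbd_subs[OF \<nu> x u(1)] .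
      have "u \<sqinter>\<^bsub>Sub C ?V\<^esub> ?k \<sqsubseteq>\<^bsub>Sub C ?V\<^esub> bot_sub C ?V"
        using sub_meet_mono[OF uS kV uS hS sub_refl[OF uS] kh] u(2) by simp
      then show ?thesis using bot_unique[OF sub_meet(1)[OF uS kV]] u(1) by blast
    next
      case True
      \<comment> \<open>Here \<open>x\<close> is the direct image of a subobject of \<open>M \<times> U\<close>, which is separated from \<open>k\<close> there.\<close>
      let ?y = "sub_preimage C h x"
      have y: "?y \<in> subs ?W" using hpre[OF x] .
      have hy: "sub_image C h ?y = x" using image_preimage_M[OF hM h(1) x True] .
      have "\<not> ?y \<sqsubseteq>\<^bsub>Sub C ?W\<^esub> k" "\<not> k \<sqsubseteq>\<^bsub>Sub C ?W\<^esub> ?y"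
        using image_mono[OF h(1) y kS] image_mono[OF h(1) kS y] hy xk by auto
      moreover have "k \<noteq> bot_sub C ?W" using kb image_bot[OF h(1)] by auto
      ultimately obtain u where u: "u \<in> \<pi> ?y" "u \<sqinter>\<^bsub>Sub C ?W\<^esub> k = bot_sub C ?W"
        using k y unfolding closed_subs_iff[OF \<pi> WO] by blast
      have "u \<in> ?\<omega> ?y" using \<pi>\<omega>[OF y] u(1) by blast
      then obtain v where uS: "u \<in> subs ?W" and v: "v \<in> \<nu> x" "sub_preimage C h v \<sqsubseteq>\<^bsub>Sub C ?W\<^esub> u"
        unfolding mem\<omega>[OF y] hy by blast
      have vS: "v \<in> subs ?V" using pnbd_subs[OF \<nu> x v(1)] .
      let ?w = "v \<sqinter>\<^bsub>Sub C ?V\<^esub> ?k"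
      note Mw = sub_meet[OF vS kV]
      have "sub_preimage C h ?w \<sqsubseteq>\<^bsub>Sub C ?W\<^esub> bot_sub C ?W"
        unfolding preimage_meet[OF h(1) vS kV] preimage_image_M[OF hM h(1) kS] u(2)[symmetric]
        using sub_meet_mono[OF hpre[OF vS] kS uS kS v(2) sub_refl[OF kS]] .
      then have "sub_preimage C h ?w = bot_sub C ?W" using bot_unique[OF hpre[OF Mw(1)]] by blast
      then have "?w = bot_sub C ?V"
        using image_preimage_M[OF hM h(1) Mw(1) sub_trans[OF Mw(1) kV hS Mw(3) kh]] image_bot[OF h(1)] by simp
      then show ?thesis using v(1) by blast
    qed
    then have "?k \<in> closed_subs C (?V, \<nu>)" unfolding closed_subs_iff[OF \<nu> VO] using kV by blast
    then have "sub_image C q' ?k \<in> closed_subs C U" using compactD[OF S tU V] by blast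
    then show "sub_image C q k \<in> closed_subs C U" using image_comp[OF h(1) P'(2) kS] h(3) by simp
  qed
  then show ?thesis unfolding T_def .
qed

end

theorem mainTheorem15:
  fixes C :: "('o, 'a, 'm) ctx_scheme"
  assumes "internal_context C"
  shows
    "(\<forall>S\<in>pspaces C. \<forall>T\<in>pspaces C. \<forall>f.
        compact_space C T \<and> pnbd_morphism C S T f \<and> proper_morphism C S T f
        \<longrightarrow> compact_space C S) \<and>
     (\<forall>S\<in>pspaces C. \<forall>T\<in>pspaces C. \<forall>f.
        compact_space C S \<and> pnbd_morphism C S T f \<and>
        stably C (continuous_morphism C) S T f \<and> stably C (\<lambda>W U q. q \<in> EE C) S T f
        \<longrightarrow> compact_space C T) \<and>
     (\<forall>(I :: 'i set) D P p.
        finite I \<and> (\<forall>i\<in>I. compact_space C (D i)) \<and> is_limit (pNbd C) I D {} P p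
        \<longrightarrow> compact_space C P) \<and>
     ((\<forall>S\<in>pspaces C. \<forall>T\<in>pspaces C. \<forall>f.
         pnbd_morphism C S T f \<longrightarrow> continuous_morphism C S T f) \<longrightarrow>
      (\<forall>S m.
         compact_space C S \<and> m \<in> MM C \<and> Cod C m = fst S \<and> sub_class C m \<in> closed_subs C S
         \<longrightarrow> compact_space C (sub_space C S m)))"
proof -
  interpret internal_context C by fact
  show ?thesis
  proof (intro conjI ballI allI impI; (elim conjE)?)
    show "compact_space C S"
      if "S \<in> pspaces C" "compact_space C T" "pnbd_morphism C S T f" "proper_morphism C S T f" for S T f
      using compact_of_proper[OF that] .
    show "compact_space C T"
      if "T \<in> pspaces C" "compact_space C S" "pnbd_morphism C S T f"
        "stably C (continuous_morphism C) S T f" "stably C (\<lambda>W U q. q \<in> EE C) S T f" for S T f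
      using compact_image[OF that(2,1,3-5)] .
    show "compact_space C P"
      if "finite I" "\<forall>i\<in>I. compact_space C (D i)" "is_limit (pNbd C) I D {} P p" for I :: "'i set" and D P p
      using compact_finite_product[OF that] .
    show "compact_space C (sub_space C S m)"
      if "\<forall>S\<in>pspaces C. \<forall>T\<in>pspaces C. \<forall>f. pnbd_morphism C S T f \<longrightarrow> continuous_morphism C S T f"
        "compact_space C S" "m \<in> MM C" "Cod C m = fst S" "sub_class C m \<in> closed_subs C S" for S m
      using compact_closed_subspace[OF that] .
  qed
qed

end
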